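(* Let $I$ be an open interval of $\mathbb R$, let $\tilde\varphi_0(z)=a+\tilde\varphi(z)$ and $\tilde\psi_0(z)$ be $1$-summable formal series in the directions of $I$, with $a\in\mathbb C$ and $\tilde\varphi(z)\in z^{-1}\mathbb C[[z^{-1}]]$, and let $H(t)\in\mathbb C\{t\}$. Then the formal series $\tilde\psi_0\circ(\mathrm{id}+\tilde\varphi_0)$ and $H\circ\tilde\varphi$ are $1$-summable in the directions of $I$ and $$\mathcal S^I\bigl(\tilde\psi_0\circ(\mathrm{id}+\tilde\varphi_0)\bigr)=(\mathcal S^I\tilde\psi_0)\circ(\mathrm{id}+\mathcal S^I\tilde\varphi_0),\qquad \mathcal S^I(H\circ\tilde\varphi)=H\circ\mathcal S^I\tilde\varphi.$$ More precisely, if $\mathcal B\tilde\varphi\in\mathcal N(I,\gamma,\alpha)$ and $\mathcal B\tilde\psi_0\in\mathbb C\delta\oplus\mathcal N(I,\gamma)$ with $\alpha,\gamma:I\to\mathbb R$ locally bounded, $\alpha\ge0$, and $\rho$ is a positive number smaller than the radius of convergence of $H$, then $$\mathcal B\bigl(\tilde\psi_0\circ(\mathrm{id}+\tilde\varphi_0)\bigr)\in\mathbb C\delta\oplus\mathcal N(I,\gamma_1),\quad\gamma_1:=\gamma+|a|+\sqrt\alpha,$$ $$\mathcal B(H\circ\tilde\varphi)\in\mathbb C\delta\oplus\mathcal N(I,\gamma_2),\quad\gamma_2:=\gamma+\rho^{-1}\alpha,$$ $$z\in\mathcal D(I,\gamma_1)\Rightarrow z+\mathcal S^I\tilde\varphi_0(z)\in\mathcal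 D(I,\gamma),\qquad z\in\mathcal D(I,\gamma_2)\Rightarrow|\mathcal S^I\tilde\varphi(z)|\le\rho,$$ and the two identities above hold in $\mathcal D(I,\gamma_1)$ and $\mathcal D(I,\gamma_2)$ respectively.
   Context: Composition of formal series: $\tilde\psi\circ(\mathrm{id}+\tilde\chi)=\sum_{p\ge0}\frac1{p!}\tilde\chi^p\,\partial^p\tilde\psi$ for $\tilde\psi,\tilde\chi\in\mathbb C[[z^{-1}]]$, $\partial=d/dz$; and $H\circ\tilde\varphi=\sum_{p\ge0}h_p\tilde\varphi^p$ for $H(t)=\sum h_pt^p$ (both formally convergent). The formal Borel transform is $\mathcal B(a+\sum_{n\ge0}a_nz^{-n-1})=a\delta+\sum a_n\frac{\zeta^n}{n!}$, with $\delta$ a symbol. A function on $I$ is locally bounded if bounded on compact subintervals. For $\gamma:I\to\mathbb R$, $\alpha:I\to\mathbb R^+$ locally bounded, $\mathcal N(I,\gamma,\alpha)$ is the set of $\hat\varphi\in\mathbb C\{\zeta\}$ extending analytically to the open sector $\{\xi e^{\mathrm i\theta}\mid\xi>0,\theta\in I\}$ with $|\hat\varphi(\xi e^{\mathrm i\theta})|\le\alpha(\theta)e^{\gamma(\theta)\xi}$; $\mathcal N(I,\gamma)=\bigcup_\alpha\mathcal N(I,\gamma,\alpha)$, $\mathcal N(I)=\bigcup_\gamma\mathcal N(I,\gamma)$. A formal series is $1$-summable in the directions of $I$ if its Borel transform belongs to $\mathbb C\delta\oplus\mathcal N(I)$. Let $\Pi^\theta_c=\{\mathrm{Re}(ze^{\mathrm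 i\theta})>c\}$, $\mathcal D(I,\gamma)=\bigcup_{\theta\in I}\Pi^\theta_{\gamma(\theta)}$. If $\mathcal B\tilde\varphi_0=a\delta+\hat\varphi$ with $\hat\varphi\in\mathcal N(I,\gamma)$, the Borel sum is $\mathcal S^I\tilde\varphi_0(z)=a+\int_0^{+\infty}e^{-z\xi e^{\mathrm i\theta}}\hat\varphi(\xi e^{\mathrm i\theta})e^{\mathrm i\theta}d\xi$ for any $\theta\in I$ with $z\in\Pi^\theta_{\gamma(\theta)}$, a well-defined holomorphic function on $\mathcal D(I,\gamma)$. When $|I|>\pi$ one takes $\gamma>0$ and the half-planes are regarded as subsets of the Riemann surface of the logarithm, $\Pi^\theta_{\gamma(\theta)}$ being replaced by its lift $\{z=re^{\mathrm i t}\mid r>\gamma(\theta),\ |t+\theta|<\arccos(\gamma(\theta)/r)\}$ ($t=\arg z\in\mathbb R$ not taken modulo $2\pi$), with additions such as $z+\mathcal S^I\tilde\varphi_0(z)$ performed inside the lifted half-plane of the same direction $\theta$. *)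

theory Defs
  imports "HOL-Analysis.Analysis"
begin

text \<open>A formal series in \<open>z\<^sup>-\<^sup>1\<close> is a complex \<open>fps\<close> in the indeterminate \<open>X = z\<^sup>-\<^sup>1\<close>:
  coefficient \<open>n\<close> is the coefficient of \<open>z\<^sup>-\<^sup>n\<close>.  Since \<open>dX/dz = - X\<^sup>2\<close>, the derivation
  \<open>d/dz\<close> is \<open>- X\<^sup>2 d/dX\<close>.\<close>

definition deriv_z :: "complex fps \<Rightarrow> complex fps" where
  "deriv_z f = - (fps_X ^ 2 * fps_deriv f)"

text \<open>\<open>\<psi> \<circ> (id + \<omega>)\<close>; the sum is taken in the (Krull) topology carried by \<open>fps\<close>.  The other
  composition, \<open>\<Sum>p. h\<^sub>p \<phi>\<^sup>p\<close> with \<open>\<phi>\<close> without constant term, is the library's \<open>fps_compose\<close>.\<close>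

definition shift_compose :: "complex fps \<Rightarrow> complex fps \<Rightarrow> complex fps" where
  "shift_compose \<psi> \<omega> = (\<Sum>p. fps_const (1 / fact p) * \<omega> ^ p * (deriv_z ^^ p) \<psi>)"

lemma fps_nth_deriv_z:
  "fps_nth (deriv_z f) n = (if n = 0 then 0 else - of_nat (n - 1) * fps_nth f (n - 1))"
proof (cases "n < 2")
  case True
  then show ?thesis by (auto simp: deriv_z_def fps_X_power_mult_nth less_2_cases_iff)
next
  case False
  then obtain m where "n = Suc (Suc m)" by (metis add_2_eq_Suc le_Suc_ex not_less)
  then show ?thesis by (simp add: deriv_z_def fps_X_power_mult_nth ring_distribs)
qed

lemma fps_nth_deriv_z_funpow: "n < p \<Longrightarrow> fps_nth ((deriv_z ^^ p) f) n = 0"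
proof (induction p arbitrary: n)
  case (Suc p)
  then show ?case by (cases n) (auto simp: fps_nth_deriv_z)
qed auto

lemma shift_compose_nth:
  "fps_nth (shift_compose \<psi> \<omega>) n =
     (\<Sum>p\<le>n. fps_nth (fps_const (1 / fact p) * \<omega> ^ p * (deriv_z ^^ p) \<psi>) n)"
  and shift_compose_sums:
  "(\<lambda>p. fps_const (1 / fact p) * \<omega> ^ p * (deriv_z ^^ p) \<psi>) sums shift_compose \<psi> \<omega>"
proof -
  define t where "t p = fps_const (1 / fact p) * \<omega> ^ p * (deriv_z ^^ p) \<psi>" for p
  define S where "S = Abs_fps (\<lambda>n. \<Sum>p\<le>n. fps_nth (t p) n)"
  have t0: "fps_nth (t p) n = 0" if "n < p" for p n
    unfolding t_def fps_mult_nth[of _ "(deriv_z ^^ p) \<psi>"]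
    using that by (intro sum.neutral) (auto simp: fps_nth_deriv_z_funpow)
  have "(\<lambda>N. \<Sum>p<N. t p) \<longlonglongrightarrow> S"
  proof (rule tendsto_fpsI)
    fix n
    have "fps_nth (\<Sum>p<N. t p) n = fps_nth S n" if "N > n" for N
      using that by (auto simp: S_def fps_sum_nth intro!: sum.mono_neutral_right t0)
    then show "\<forall>\<^sub>F N in sequentially. fps_nth (\<Sum>p<N. t p) n = fps_nth S n"
      by (auto intro: eventually_mono[OF eventually_gt_at_top[of n]])
  qed
  then have *: "t sums S" by (simp add: sums_def)
  then have "shift_compose \<psi> \<omega> = S"
    unfolding shift_compose_def t_def by (simp add: sums_iff)
  with * show "fps_nth (shift_compose \<psi> \<omega>) n =
     (\<Sum>p\<le>n. fps_nth (fps_const (1 / fact p) * \<omega> ^ p * (deriv_z ^^ p) \<psi>) n)"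
    and "(\<lambda>p. fps_const (1 / fact p) * \<omega> ^ p * (deriv_z ^^ p) \<psi>) sums shift_compose \<psi> \<omega>"
    by (simp_all add: S_def t_def[abs_def])
qed

text \<open>The formal Borel transform \<open>a \<delta> + \<Sum> a\<^sub>n \<zeta>\<^sup>n / n!\<close> is represented by the pair of the
  coefficient of \<open>\<delta>\<close> and the series in \<open>\<zeta>\<close>.  Thus \<open>\<complex>\<delta> \<oplus> V\<close> is \<open>UNIV \<times> V\<close>, and
  \<open>V\<close> itself is \<open>{0} \<times> V\<close>.\<close>

definition borel_transform :: "complex fps \<Rightarrow> complex \<times> complex fps" where
  "borel_transform f = (fps_nth f 0, Abs_fps (\<lambda>n. fps_nth f (Suc n) / fact n))"

definition locally_bounded_on :: "real set \<Rightarrow> (real \<Rightarrow> real) \<Rightarrow> bool" where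
  "locally_bounded_on I g \<longleftrightarrow> (\<forall>s t. {s..t} \<subseteq> I \<longrightarrow> bounded (g ` {s..t}))"

text \<open>An extension of a convergent germ along all the rays with direction in \<open>I\<close> takes the same
  values on the rays \<open>\<theta>\<close> and \<open>\<theta> + 2\<pi>\<close>, so it lives on a subset of \<open>\<complex>\<close> even if \<open>I\<close> is long.\<close>

definition sector :: "real set \<Rightarrow> complex set" where
  "sector I = {rcis \<xi> \<theta> | \<xi> \<theta>. \<xi> > 0 \<and> \<theta> \<in> I}"

definition extends_to_sector :: "real set \<Rightarrow> complex fps \<Rightarrow> (complex \<Rightarrow> complex) \<Rightarrow> bool" where
  "extends_to_sector I g F \<longleftrightarrow> F holomorphic_on sector I \<and>
     (\<exists>r>0. \<forall>\<zeta>\<in>sector I. norm \<zeta> < r \<longrightarrow> F \<zeta> = eval_fps g \<zeta>)"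

definition NN_bound :: "real set \<Rightarrow> (real \<Rightarrow> real) \<Rightarrow> (real \<Rightarrow> real) \<Rightarrow> complex fps set" where
  "NN_bound I \<gamma> \<alpha> = {g. fps_conv_radius g > 0 \<and>
     (\<exists>F. extends_to_sector I g F \<and>
        (\<forall>\<theta>\<in>I. \<forall>\<xi>>0. norm (F (rcis \<xi> \<theta>)) \<le> \<alpha> \<theta> * exp (\<gamma> \<theta> * \<xi>)))}"

definition NN_rate :: "real set \<Rightarrow> (real \<Rightarrow> real) \<Rightarrow> complex fps set" where
  "NN_rate I \<gamma> = (\<Union>\<alpha>\<in>{\<alpha>. locally_bounded_on I \<alpha> \<and> (\<forall>\<theta>\<in>I. \<alpha> \<theta> \<ge> 0)}. NN_bound I \<gamma> \<alpha>)"

definition NN :: "real set \<Rightarrow> complex fps set" where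
  "NN I = (\<Union>\<gamma>\<in>{\<gamma>. locally_bounded_on I \<gamma>}. NN_rate I \<gamma>)"

definition one_summable :: "real set \<Rightarrow> complex fps \<Rightarrow> bool" where
  "one_summable I f \<longleftrightarrow> borel_transform f \<in> UNIV \<times> NN I"

text \<open>The extension of the Borel transform is unique on \<open>sector I\<close> (for an interval \<open>I\<close>).\<close>

definition borel_ext :: "real set \<Rightarrow> complex fps \<Rightarrow> complex \<Rightarrow> complex" where
  "borel_ext I f = (SOME F. extends_to_sector I (snd (borel_transform f)) F)"

definition laplace_dir :: "real set \<Rightarrow> real \<Rightarrow> complex fps \<Rightarrow> complex \<Rightarrow> complex" where
  "laplace_dir I \<theta> f z = fst (borel_transform f) +
     (LINT \<xi>:{0<..}|lborel. exp (- z * rcis \<xi> \<theta>) * borel_ext I f (rcis \<xi> \<theta>) * cis \<theta>)"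


text \<open>Intervals of length at most \<open>\<pi>\<close>: half-planes and Borel sums in the complex plane.\<close>

definition half_plane :: "real \<Rightarrow> real \<Rightarrow> complex set" where
  "half_plane \<theta> c = {z. Re (z * cis \<theta>) > c}"

definition DD :: "real set \<Rightarrow> (real \<Rightarrow> real) \<Rightarrow> complex set" where
  "DD I \<gamma> = (\<Union>\<theta>\<in>I. half_plane \<theta> (\<gamma> \<theta>))"

text \<open>\<open>borel_sum I \<gamma> f z\<close> is the value common to all the directions \<open>\<theta> \<in> I\<close> whose half-plane
  contains \<open>z\<close>; it is meant for \<open>z \<in> DD I \<gamma>\<close> and \<open>borel_transform f \<in> UNIV \<times> NN_rate I \<gamma>\<close>.\<close>

definition borel_sum :: "real set \<Rightarrow> (real \<Rightarrow> real) \<Rightarrow> complex fps \<Rightarrow> complex \<Rightarrow> complex" where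
  "borel_sum I \<gamma> f z =
     (THE s. \<forall>\<theta>\<in>I. z \<in> half_plane \<theta> (\<gamma> \<theta>) \<longrightarrow> s = laplace_dir I \<theta> f z)"


text \<open>Intervals of length greater than \<open>\<pi>\<close>: the same on the Riemann surface of the logarithm,
  whose points are given by polar coordinates \<open>(r, t)\<close> with \<open>r > 0\<close> and \<open>t\<close> not reduced modulo
  \<open>2\<pi>\<close>; \<open>log_proj\<close> is the projection to the plane.\<close>

definition long_interval :: "real set \<Rightarrow> bool" where
  "long_interval I \<longleftrightarrow> emeasure lborel I > ennreal pi"

definition log_proj :: "real \<times> real \<Rightarrow> complex" where
  "log_proj p = rcis (fst p) (snd p)"

text \<open>Only used with \<open>c > 0\<close>.\<close>

definition log_half_plane :: "real \<Rightarrow> real \<Rightarrow> (real \<times> real) set" where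
  "log_half_plane \<theta> c = {(r, t). r > c \<and> \<bar>t + \<theta>\<bar> < arccos (c / r)}"

definition log_DD :: "real set \<Rightarrow> (real \<Rightarrow> real) \<Rightarrow> (real \<times> real) set" where
  "log_DD I \<gamma> = (\<Union>\<theta>\<in>I. log_half_plane \<theta> (\<gamma> \<theta>))"

definition log_borel_sum ::
    "real set \<Rightarrow> (real \<Rightarrow> real) \<Rightarrow> complex fps \<Rightarrow> real \<times> real \<Rightarrow> complex" where
  "log_borel_sum I \<gamma> f p =
     (THE s. \<forall>\<theta>\<in>I. p \<in> log_half_plane \<theta> (\<gamma> \<theta>) \<longrightarrow> s = laplace_dir I \<theta> f (log_proj p))"

text \<open>The sum \<open>p + w\<close> performed inside the lifted half-planes of direction \<open>\<theta>\<close>: the point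
  \<open>(r, t)\<close> above \<open>log_proj p + w\<close> with \<open>- \<pi> < t + \<theta> \<le> \<pi>\<close>.  It is the only point above
  \<open>log_proj p + w\<close> that can lie in some \<open>log_half_plane \<theta> c\<close> with \<open>c > 0\<close>.\<close>

definition log_add :: "real \<Rightarrow> real \<times> real \<Rightarrow> complex \<Rightarrow> real \<times> real" where
  "log_add \<theta> p w =
     (norm (log_proj p + w), Arg ((log_proj p + w) * cis \<theta>) - \<theta>)"

lemma log_proj_log_add: "log_proj (log_add \<theta> p w) = log_proj p + w"
proof -
  define v where "v = log_proj p + w"
  have "rcis (norm v) (Arg (v * cis \<theta>) - \<theta>) = rcis (norm (v * cis \<theta>)) (Arg (v * cis \<theta>)) * cis (- \<theta>)"
    by (simp add: rcis_def cis_mult norm_mult)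
  also have "\<dots> = v * (cis \<theta> * cis (- \<theta>))"
    by (simp add: rcis_cmod_Arg mult.assoc)
  finally show ?thesis
    by (simp add: log_add_def log_proj_def v_def cis_mult)
qed

definition growth_rate :: "real set \<Rightarrow> (real \<Rightarrow> real) \<Rightarrow> bool" where
  "growth_rate I \<gamma> \<longleftrightarrow> locally_bounded_on I \<gamma> \<and> (long_interval I \<longrightarrow> (\<forall>\<theta>\<in>I. \<gamma> \<theta> > 0))"

text \<open>On the domain of rate \<open>\<gamma>'\<close> the map \<open>id + S \<omega>\<close> takes values in the domain of rate \<open>\<gamma>\<close>
  (in the lifted half-plane of the same direction, on the Riemann surface of the logarithm), and
  \<open>S (\<psi> \<circ> (id + \<omega>)) = S \<psi> \<circ> (id + S \<omega>)\<close>, where \<open>\<omega>\<close> and \<open>\<psi>\<close> have rate \<open>\<gamma>\<close>.\<close>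

definition shift_identity_on ::
    "real set \<Rightarrow> (real \<Rightarrow> real) \<Rightarrow> (real \<Rightarrow> real) \<Rightarrow> complex fps \<Rightarrow> complex fps \<Rightarrow> bool" where
  "shift_identity_on I \<gamma> \<gamma>' \<psi> \<omega> \<longleftrightarrow>
     (if long_interval I then
        \<forall>\<theta>\<in>I. \<forall>p\<in>log_half_plane \<theta> (\<gamma>' \<theta>).
          p \<in> log_DD I \<gamma> \<and>
          log_add \<theta> p (log_borel_sum I \<gamma> \<omega> p) \<in> log_half_plane \<theta> (\<gamma> \<theta>) \<and>
          log_borel_sum I \<gamma>' (shift_compose \<psi> \<omega>) p =
            log_borel_sum I \<gamma> \<psi> (log_add \<theta> p (log_borel_sum I \<gamma> \<omega> p))
      else
        \<forall>z\<in>DD I \<gamma>'.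
          z \<in> DD I \<gamma> \<and>
          z + borel_sum I \<gamma> \<omega> z \<in> DD I \<gamma> \<and>
          borel_sum I \<gamma>' (shift_compose \<psi> \<omega>) z = borel_sum I \<gamma> \<psi> (z + borel_sum I \<gamma> \<omega> z))"

text \<open>On the domain of rate \<open>\<gamma>'\<close>, \<open>\<bar>S \<phi>\<bar> \<le> \<rho>\<close> and \<open>S (H \<circ> \<phi>) = H \<circ> S \<phi>\<close>, where \<open>\<phi>\<close> has
  rate \<open>\<gamma>\<close> and \<open>\<rho>\<close> is smaller than the radius of convergence of \<open>H\<close>.\<close>

definition subst_identity_on ::
    "real set \<Rightarrow> (real \<Rightarrow> real) \<Rightarrow> (real \<Rightarrow> real) \<Rightarrow> real \<Rightarrow> complex fps \<Rightarrow> complex fps \<Rightarrow> bool" where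
  "subst_identity_on I \<gamma> \<gamma>' \<rho> H \<phi> \<longleftrightarrow>
     (if long_interval I then
        \<forall>p\<in>log_DD I \<gamma>'.
          p \<in> log_DD I \<gamma> \<and>
          norm (log_borel_sum I \<gamma> \<phi> p) \<le> \<rho> \<and>
          log_borel_sum I \<gamma>' (fps_compose H \<phi>) p = eval_fps H (log_borel_sum I \<gamma> \<phi> p)
      else
        \<forall>z\<in>DD I \<gamma>'.
          z \<in> DD I \<gamma> \<and>
          norm (borel_sum I \<gamma> \<phi> z) \<le> \<rho> \<and>
          borel_sum I \<gamma>' (fps_compose H \<phi>) z = eval_fps H (borel_sum I \<gamma> \<phi> z))"

end

theory Submission
  imports Defs "HOL-Complex_Analysis.Complex_Analysis"
begin

text \<open>
  The Borel transform turns products of formal series without constant term into convolutions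
  and \<open>d/dz\<close> into multiplication by \<open>- \<zeta>\<close>, so \<open>H \<circ> \<phi>\<close> and \<open>\<psi> \<circ> (id + a + \<phi>)\<close> become
  the series \<open>\<Sum>p h\<^sub>p F\<^sup>*\<^sup>p\<close> and \<open>\<Sum>p 1/p! F\<^sup>*\<^sup>p * ((- \<zeta>)\<^sup>p exp (- a \<zeta>) P)\<close>.  If \<open>F\<close> and \<open>P\<close>
  are bounded on a ray by \<open>\<alpha> exp (\<gamma> \<xi>)\<close> and \<open>\<beta> exp (\<gamma> \<xi>)\<close>, the terms are bounded by convolutions
  of monomials, and the two series sum to at most a constant times \<open>exp ((\<gamma> + \<alpha>/\<rho>) \<xi>)\<close> and
  \<open>exp ((\<gamma> + \<bar>a\<bar> + sqrt \<alpha>) \<xi>)\<close>, the latter because \<open>\<Sum>p \<alpha>\<^sup>p \<xi>\<^bsup>2p\<^esup>/(2p)! \<le> exp (sqrt \<alpha> \<xi>)\<close>.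
  The same bounds dominate the partial sums under the Laplace integral, which maps convolutions
  to products; this gives both identities in each direction.  Two directions less than \<open>\<pi>\<close> apart
  give the same sum by Cauchy's theorem far away and analytic continuation elsewhere.
\<close>

section \<open>Convolution on a star-shaped domain\<close>

text \<open>A convolution at \<open>z\<close> integrates over the segment from 0 to
  \<open>z\<close>, here with w = t z, so all functions live on an open star-shaped set: the sector
  together with the disc of the germ. There a function is tied to its formal series by its
  derivatives at 0. The constant \<open>a\<close> has only a multiple of \<delta> as Borel
  transform. It is therefore split off as an inner translation, which costs |a| in the rate. In the
  remaining shift the \<open>p\<close>-fold convolution contributes \<xi>^(p-1)/(p-1)! and the
  factor (- \<zeta>)^p counts as p! times \<xi>^p/p!; together they give p! \<xi>^(2p)/(2p)!, and
  the Taylor coefficient 1/p! cancels p!. This is the origin of the square root. The same rates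
  control the Laplace side: |S \<phi>| is at most \<alpha>/x, where x = Re (z exp(i \<theta>)) -
  \<gamma>. This is at most \<rho> if x > \<alpha>/\<rho>, and at most sqrt \<alpha> if x > sqrt
  \<alpha>. In the comparison of two directions, the half-planes in between may miss the given
  point; a distance below \<open>pi\<close> ensures that all of them share a disc far away.\<close>

definition borel_conv :: "(complex \<Rightarrow> complex) \<Rightarrow> (complex \<Rightarrow> complex) \<Rightarrow> complex \<Rightarrow> complex" where
  "borel_conv f g z =
     z * integral {0..1} (\<lambda>t. f (of_real t * z) * g (of_real (1 - t) * z))"

lemma DERIV_power_over_fact:
  "((\<lambda>t::real. t ^ Suc k / fact (Suc k)) has_field_derivative t ^ k / fact k) (at t within S)"
proof (rule DERIV_cong[OF DERIV_cdivide[OF DERIV_power_Suc[OF DERIV_ident]]])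
  have "1 + real k \<noteq> 0"
    by linarith
  then show "(1 + of_nat k) * (1 * t ^ k) / fact (Suc k) = t ^ k / fact k"
    by (simp only: fact_Suc of_nat_Suc mult_1 mult_divide_mult_cancel_left_if) simp
qed

text \<open>The Beta integral in normalised form, which is the convolution of s^m/m! and s^n/n! at
  1. Integration by parts moves one power from 1 - t to t, hence the induction on \<open>n\<close>
  with \<open>m\<close> arbitrary.\<close>

lemma beta_has_integral:
  "((\<lambda>t::real. t ^ m / fact m * ((1 - t) ^ n / fact n)) has_integral 1 / fact (m + n + 1)) {0..1}"
proof (induction n arbitrary: m)
  case 0
  have "((\<lambda>t::real. t ^ m / fact m) has_integral (1 ^ Suc m / fact (Suc m) - 0 ^ Suc m / fact (Suc m))) {0..1}"
    by (rule fundamental_theorem_of_calculus)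
      (auto simp flip: has_real_derivative_iff_has_vector_derivative intro!: DERIV_power_over_fact
        simp del: fact_Suc power_Suc)
  then show ?case by simp
next
  case (Suc n)
  let ?P = "\<lambda>t::real. t ^ Suc m / fact (Suc m) * ((1 - t) ^ Suc n / fact (Suc n))"
  have "((\<lambda>t. t ^ m / fact m * ((1 - t) ^ Suc n / fact (Suc n))
        - t ^ Suc m / fact (Suc m) * ((1 - t) ^ n / fact n)) has_integral (?P 1 - ?P 0)) {0..1}"
  proof (rule fundamental_theorem_of_calculus)
    fix t :: real
    have 2: "((\<lambda>t. (1 - t) ^ Suc n / fact (Suc n)) has_field_derivative - ((1 - t) ^ n / fact n))
        (at t within {0..1})"
      by (rule DERIV_cong[OF DERIV_chain2[OF DERIV_power_over_fact]])
        (auto intro!: derivative_eq_intros)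
    show "(?P has_vector_derivative t ^ m / fact m * ((1 - t) ^ Suc n / fact (Suc n))
        - t ^ Suc m / fact (Suc m) * ((1 - t) ^ n / fact n)) (at t within {0..1})"
      unfolding has_real_derivative_iff_has_vector_derivative[symmetric]
      using DERIV_mult[OF DERIV_power_over_fact[of m t "{0..1}"] 2] by (simp add: mult.commute)
  qed simp
  from has_integral_add[OF this Suc.IH[of "Suc m"]] show ?case by simp
qed

text \<open>Invariance under contraction towards 0 keeps the segment from 0 to \<open>z\<close>,
  hence every value entering a convolution at \<open>z\<close>, inside the domain.\<close>

locale star_domain =
  fixes U :: "complex set"
  assumes open_U: "open U" and zero_in: "0 \<in> U"
    and scale: "\<And>z t. z \<in> U \<Longrightarrow> 0 \<le> t \<Longrightarrow> t \<le> 1 \<Longrightarrow> of_real t * z \<in> U"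
begin

lemma starlike_U: "starlike U"
  unfolding starlike_def
proof (intro bexI[of _ 0] ballI subsetI)
  fix x y assume x: "x \<in> U" and "y \<in> closed_segment 0 x"
  then obtain u where "0 \<le> u" "u \<le> 1" "y = of_real u * x"
    by (auto simp: in_segment scaleR_conv_of_real)
  with scale x show "y \<in> U" by blast
qed (fact zero_in)

text \<open>Used with \<open>h\<close> equal to t and to 1 - t, the two arguments of a convolution.
  Differentiation under the integral sign asks for continuity in both variables jointly.\<close>

lemma cont_scaled:
  assumes "f holomorphic_on U" "B \<subseteq> U" "continuous_on T h" "h ` T \<subseteq> {0..1}"
  shows "continuous_on (B \<times> T) (\<lambda>p. f (of_real (h (snd p)) * fst p))"
proof (rule continuous_on_compose2[OF holomorphic_on_imp_continuous_on[OF assms(1)]])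
  show "continuous_on (B \<times> T) (\<lambda>p. complex_of_real (h (snd p)) * fst p)"
    by (intro continuous_intros continuous_on_compose2[OF assms(3)]) auto
  show "(\<lambda>p. complex_of_real (h (snd p)) * fst p) ` (B \<times> T) \<subseteq> U"
    using assms scale by (force simp: image_subset_iff)
qed

lemma cont_scaled_fixed:
  assumes "f holomorphic_on U" "z \<in> U" "continuous_on T h" "h ` T \<subseteq> {0..1}"
  shows "continuous_on T (\<lambda>t. f (of_real (h t) * z))"
  by (rule continuous_on_compose2[OF holomorphic_on_imp_continuous_on[OF assms(1)]])
     (use assms scale in \<open>auto intro!: continuous_intros simp: image_subset_iff\<close>)

lemma continuous_on_conv_integrand:
  assumes "f holomorphic_on U" "g holomorphic_on U" "z \<in> U"
  shows "continuous_on {0..1} (\<lambda>t. f (of_real t * z) * g (of_real (1 - t) * z))"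
  using assms by (intro continuous_on_mult cont_scaled_fixed continuous_intros) auto

text \<open>Differentiation under the integral sign gives an expression with derivatives of both
  factors; an integration by parts moves the derivative from \<open>g\<close> to \<open>f\<close>
  and leaves a boundary term.\<close>

lemma has_field_derivative_borel_conv:
  assumes f: "f holomorphic_on U" and g: "g holomorphic_on U" and z: "z \<in> U"
  shows "(borel_conv f g has_field_derivative f 0 * g z + borel_conv (deriv f) g z) (at z)"
proof -
  obtain e where e: "e > 0" "ball z e \<subseteq> U"
    using open_U z by (meson openE)
  have f': "deriv f holomorphic_on U" and g': "deriv g holomorphic_on U"
    using f g open_U by (auto intro: holomorphic_deriv)
  have df: "(f has_field_derivative deriv f w) (at w)"
    and dg: "(g has_field_derivative deriv g w) (at w)" if "w \<in> U" for w
    using f g open_U that by (auto intro: holomorphic_derivI)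
  define k where "k w t = f (of_real t * w) * g (of_real (1 - t) * w)" for w :: complex and t :: real
  define k' where "k' w t = of_real t * deriv f (of_real t * w) * g (of_real (1 - t) * w)
      + of_real (1 - t) * f (of_real t * w) * deriv g (of_real (1 - t) * w)" for w :: complex and t :: real
  have cont: "continuous_on {0..1} (k w)" if "w \<in> U" for w
    unfolding k_def using continuous_on_conv_integrand[OF f g that] .
  have int: "((\<lambda>w. integral (cbox 0 1) (k w)) has_field_derivative integral (cbox 0 1) (k' z))
        (at z within ball z e)"
  proof (rule leibniz_rule_field_derivative)
    show "continuous_on (ball z e \<times> cbox 0 1) (\<lambda>(x, t). k' x t)"
      unfolding k'_def case_prod_unfold using e f g f' g'
      by (intro continuous_on_add continuous_on_mult cont_scaled[where h="\<lambda>t. t"]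
          cont_scaled[where h="\<lambda>t. 1 - t"] continuous_intros) auto
  next
    fix w :: complex and t :: real assume w: "w \<in> ball z e" and t: "t \<in> cbox 0 1"
    have "of_real t * w \<in> U" "of_real (1 - t) * w \<in> U"
      using w t e by (auto intro!: scale simp: subset_iff simp del: of_real_diff)
    from this[THEN df] this[THEN dg]
    show "((\<lambda>w. k w t) has_field_derivative k' w t) (at w within ball z e)"
      unfolding k_def k'_def
      by (auto intro!: derivative_eq_intros DERIV_chain2[where f=f] DERIV_chain2[where f=g]
          simp: algebra_simps simp del: of_real_diff)
  next
    fix w assume "w \<in> ball z e"
    with e cont show "k w integrable_on cbox 0 1" by (auto intro!: integrable_continuous_interval)
  qed (use e in auto)
  have D: "(borel_conv f g has_field_derivative
        integral {0..1} (k z) + z * integral {0..1} (k' z)) (at z)"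
    using int e unfolding borel_conv_def[abs_def] k_def[symmetric]
    by (auto intro!: derivative_eq_intros simp: at_within_open[of z "ball z e"])
  define l where "l t = deriv f (of_real t * z) * g (of_real (1 - t) * z)" for t :: real
  \<comment> \<open>Chosen so that its derivative in \<open>t\<close> is the integrand of
    \<open>z\<close> times the convolution with \<open>deriv f\<close>, minus the integrand found
    under the integral sign. Its only nonzero boundary value is \<open>f 0 * g z\<close>, at t =
    0.\<close>
  define P where "P t = of_real (1 - t) * (f (of_real t * z) * g (of_real (1 - t) * z))" for t :: real
  have "((\<lambda>t. z * l t - (k z t + z * k' z t)) has_integral P 1 - P 0) {0..1}"
  proof (rule fundamental_theorem_of_calculus)
    fix t :: real assume t: "t \<in> {0..1}"
    have "of_real t * z \<in> U" "of_real (1 - t) * z \<in> U"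
      using z t by (auto intro!: scale simp del: of_real_diff)
    note fg = df[OF this(1)] dg[OF this(2)]
    have "((\<lambda>w. f (w * z)) has_field_derivative deriv f (of_real t * z) * z) (at (of_real t))"
      by (rule DERIV_chain2[where f=f]) (use fg(1) in \<open>auto intro!: derivative_eq_intros\<close>)
    moreover have "((\<lambda>w. g ((1 - w) * z)) has_field_derivative
        deriv g (of_real (1 - t) * z) * (- z)) (at (of_real t))"
      by (rule DERIV_chain2[where f=g]) (use fg(2) in \<open>auto intro!: derivative_eq_intros\<close>)
    moreover have "((\<lambda>w. 1 - w) has_field_derivative - 1) (at (complex_of_real t))"
      by (auto intro!: derivative_eq_intros)
    ultimately have "((\<lambda>w. (1 - w) * (f (w * z) * g ((1 - w) * z)))
        has_field_derivative z * l t - (k z t + z * k' z t)) (at (of_real t))"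
      unfolding k_def k'_def l_def
      by (intro DERIV_cong[OF DERIV_mult[OF _ DERIV_mult]]) (assumption | simp add: algebra_simps)+
    from has_vector_derivative_real_field[OF this]
    show "(P has_vector_derivative z * l t - (k z t + z * k' z t)) (at t within {0..1})"
      by (simp add: P_def[abs_def])
  qed simp
  moreover have "l integrable_on {0..1}"
    unfolding l_def using continuous_on_conv_integrand[OF f' g z] by (rule integrable_continuous_interval)
  then have "((\<lambda>t. z * l t) has_integral z * integral {0..1} l) {0..1}"
    by (intro has_integral_mult_right) (rule integrable_integral)
  ultimately have "((\<lambda>t. z * l t - (z * l t - (k z t + z * k' z t)))
      has_integral z * integral {0..1} l - (P 1 - P 0)) {0..1}"
    by (rule has_integral_diff[rotated])
  then have "((\<lambda>t. k z t + z * k' z t) has_integral f 0 * g z + z * integral {0..1} l) {0..1}"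
    by (simp add: P_def add.commute)
  moreover have "k' z integrable_on {0..1}"
    unfolding k'_def using f g f' g' z
    by (intro integrable_continuous_interval continuous_on_add continuous_on_mult
        cont_scaled_fixed[where h="\<lambda>t. t"] cont_scaled_fixed[where h="\<lambda>t. 1 - t"]
        continuous_intros) auto
  then have "((\<lambda>t. k z t + z * k' z t) has_integral
      integral {0..1} (k z) + z * integral {0..1} (k' z)) {0..1}"
    using integrable_continuous_interval[OF cont[OF z]]
    by (intro has_integral_add has_integral_mult_right integrable_integral)
  ultimately have "integral {0..1} (k z) + z * integral {0..1} (k' z)
      = f 0 * g z + z * integral {0..1} l"
    by (rule has_integral_unique[rotated])
  with D show ?thesis by (simp add: borel_conv_def l_def[abs_def])
qed

lemma holomorphic_borel_conv:
  assumes "f holomorphic_on U" "g holomorphic_on U"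
  shows "borel_conv f g holomorphic_on U"
  using has_field_derivative_borel_conv[OF assms] open_U
  by (auto simp: holomorphic_on_open)

text \<open>Each derivative moves onto \<open>f\<close> and releases one boundary term, so a Cauchy
  product builds up; the base case holds because the convolution has a factor \<open>z\<close>. The
  total order is n - 1, since a convolution gains one integration.\<close>

lemma higher_deriv_borel_conv:
  assumes "f holomorphic_on U" "g holomorphic_on U"
  shows "(deriv ^^ n) (borel_conv f g) 0 = (\<Sum>i<n. (deriv ^^ i) f 0 * (deriv ^^ (n - 1 - i)) g 0)"
  using assms
proof (induction n arbitrary: f)
  case 0
  then show ?case by (simp add: borel_conv_def)
next
  case (Suc n)
  have f': "deriv f holomorphic_on U"
    using Suc.prems open_U by (auto intro: holomorphic_deriv)
  have "(deriv ^^ Suc n) (borel_conv f g) 0 = (deriv ^^ n) (deriv (borel_conv f g)) 0"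
    by (simp add: funpow_Suc_right del: funpow.simps)
  also have "\<dots> = (deriv ^^ n) (\<lambda>z. f 0 * g z + borel_conv (deriv f) g z) 0"
    using has_field_derivative_borel_conv[OF Suc.prems] open_U zero_in
    by (intro higher_deriv_cong_ev) (auto intro!: DERIV_imp_deriv simp: eventually_nhds)
  also have "\<dots> = f 0 * (deriv ^^ n) g 0 + (deriv ^^ n) (borel_conv (deriv f) g) 0"
    using Suc.prems f' open_U zero_in
    by (subst higher_deriv_add[where S=U])
       (auto intro!: holomorphic_intros holomorphic_borel_conv higher_deriv_cmult)
  also have "\<dots> = f 0 * (deriv ^^ n) g 0 +
      (\<Sum>i<n. (deriv ^^ Suc i) f 0 * (deriv ^^ (n - Suc i)) g 0)"
    using Suc.IH[OF f' Suc.prems(2)] by (simp add: funpow_Suc_right del: funpow.simps)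
  also have "\<dots> = (\<Sum>i<Suc n. (deriv ^^ i) f 0 * (deriv ^^ (Suc n - 1 - i)) g 0)"
    by (subst sum.lessThan_Suc_shift) simp
  finally show ?case .
qed

text \<open>The bound is the convolution of \<open>A s\<^sup>m / m!\<close> and \<open>B s\<^sup>n / n!\<close>.\<close>

lemma norm_borel_conv_le:
  assumes f: "f holomorphic_on U" and g: "g holomorphic_on U" and z: "z \<in> U"
    and fb: "\<And>t. 0 \<le> t \<Longrightarrow> t \<le> 1 \<Longrightarrow>
      norm (f (of_real t * z)) \<le> A * (t * norm z) ^ m / fact m * exp (c * (t * norm z))"
    and gb: "\<And>t. 0 \<le> t \<Longrightarrow> t \<le> 1 \<Longrightarrow>
      norm (g (of_real t * z)) \<le> B * (t * norm z) ^ n / fact n * exp (c * (t * norm z))"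
  shows "norm (borel_conv f g z)
    \<le> A * B * norm z ^ (m + n + 1) / fact (m + n + 1) * exp (c * norm z)"
proof -
  define C where "C = A * B * norm z ^ (m + n) * exp (c * norm z)"
  have I: "((\<lambda>t. C * (t ^ m / fact m * ((1 - t) ^ n / fact n)))
      has_integral C * (1 / fact (m + n + 1))) {0..1}"
    by (intro has_integral_mult_right beta_has_integral)
  have "norm (integral {0..1} (\<lambda>t. f (of_real t * z) * g (of_real (1 - t) * z)))
      \<le> integral {0..1} (\<lambda>t. C * (t ^ m / fact m * ((1 - t) ^ n / fact n)))"
  proof (rule integral_norm_bound_integral)
    show "(\<lambda>t. f (of_real t * z) * g (of_real (1 - t) * z)) integrable_on {0..1}"
      using continuous_on_conv_integrand[OF f g z] by (rule integrable_continuous_interval)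
    show "(\<lambda>t. C * (t ^ m / fact m * ((1 - t) ^ n / fact n))) integrable_on {0..1}"
      using I by (rule has_integral_integrable)
  next
    fix t :: real assume t: "t \<in> {0..1}"
    have "norm (f (of_real t * z) * g (of_real (1 - t) * z))
      \<le> (A * (t * norm z) ^ m / fact m * exp (c * (t * norm z)))
        * (B * ((1 - t) * norm z) ^ n / fact n * exp (c * ((1 - t) * norm z)))"
      unfolding norm_mult using t fb[of t] gb[of "1 - t"]
      by (intro mult_mono) (auto intro: order_trans[OF norm_ge_zero])
    also have "\<dots> = C * (t ^ m / fact m * ((1 - t) ^ n / fact n))"
    proof -
      \<comment> \<open>The weights exp (c s) and exp (c (|z| - s)) multiply to a constant, so the
        rate \<open>c\<close> is kept and only the Beta integral remains.\<close>
      have "exp (c * norm z) = exp (c * (t * norm z)) * exp (c * ((1 - t) * norm z))"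
        by (simp add: exp_add[symmetric] algebra_simps)
      then show ?thesis
        by (simp add: C_def power_mult_distrib power_add mult_ac)
    qed
    finally show "norm (f (of_real t * z) * g (of_real (1 - t) * z))
      \<le> C * (t ^ m / fact m * ((1 - t) ^ n / fact n))" .
  qed
  also have "\<dots> = C / fact (m + n + 1)"
    using integral_unique[OF I] by simp
  finally have "norm (borel_conv f g z) \<le> norm z * (C / fact (m + n + 1))"
    unfolding borel_conv_def norm_mult by (intro mult_left_mono) auto
  then show ?thesis by (simp add: C_def mult_ac)
qed

end

section \<open>Formal series and their Borel transforms\<close>

lemma deriv_z_add: "deriv_z (f + g) = deriv_z f + deriv_z g"
  and deriv_z_const_mult: "deriv_z (fps_const c * f) = fps_const c * deriv_z f"
  and deriv_z_0: "deriv_z 0 = 0"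
  by (simp_all add: deriv_z_def algebra_simps)

lemma deriv_z_funpow_add: "(deriv_z ^^ q) (f + g) = (deriv_z ^^ q) f + (deriv_z ^^ q) g"
  by (induction q) (simp_all add: deriv_z_add)

lemma deriv_z_funpow_const_mult: "(deriv_z ^^ q) (fps_const c * f) = fps_const c * (deriv_z ^^ q) f"
  by (induction q) (simp_all add: deriv_z_const_mult)

lemma deriv_z_funpow_sum: "(deriv_z ^^ q) (\<Sum>k\<in>A. f k) = (\<Sum>k\<in>A. (deriv_z ^^ q) (f k))"
proof (induction A rule: infinite_finite_induct)
  have *: "(deriv_z ^^ q) 0 = 0" by (induction q) (simp_all add: deriv_z_0)
  case (infinite A)
  with * show ?case by simp
next
  case empty
  show ?case by (induction q) (simp_all add: deriv_z_0)
qed (simp add: deriv_z_funpow_add)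

lemma deriv_z_funpow_nth_eq_0:
  assumes "\<And>m. m \<le> n \<Longrightarrow> fps_nth f m = 0" "m \<le> n"
  shows "fps_nth ((deriv_z ^^ q) f) m = 0"
  using assms(2)
proof (induction q arbitrary: m)
  case (Suc q)
  then show ?case by (simp add: fps_nth_deriv_z)
qed (use assms(1) in simp)

lemma fps_mult_nth_eq_0:
  fixes f g :: "complex fps"
  assumes "\<And>m. m \<le> n \<Longrightarrow> fps_nth g m = 0"
  shows "fps_nth (f * g) n = 0"
  unfolding fps_mult_nth using assms by (intro sum.neutral) auto

text \<open>Taylor's formula for two successive translations. A constant \<open>a\<close> does not
  raise the order, so convergence rests on \<open>deriv_z\<close>, which raises it by at least one;
  in a fixed coefficient all sums are finite and can be regrouped by the binomial theorem.\<close>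

lemma shift_compose_const_add:
  "shift_compose (shift_compose \<psi> (fps_const a)) \<omega> = shift_compose \<psi> (fps_const a + \<omega>)"
proof (rule fps_ext)
  fix n
  define X where "X = shift_compose \<psi> (fps_const a)"
  define c where "c k = fps_const (a ^ k / fact k)" for k
  \<comment> \<open>The terms of \<open>X\<close> that reach order \<open>n\<close>. The remainder
    \<open>R\<close> vanishes up to order \<open>n\<close> and stays invisible in coefficient
    \<open>n\<close> after derivatives and products.\<close>
  define P where "P = (\<Sum>k\<le>n. c k * (deriv_z ^^ k) \<psi>)"
  define R where "R = X - P"
  define g where "g q k = fps_nth (fps_const (1 / fact q) * \<omega> ^ q * (c k * (deriv_z ^^ (q + k)) \<psi>)) n"
    for q k
  have g0: "g q k = 0" if "n < q + k" for q k
    unfolding g_def using that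
    by (intro fps_mult_nth_eq_0) (auto simp: c_def fps_nth_deriv_z_funpow)
  have R0: "fps_nth R m = 0" if "m \<le> n" for m
  proof -
    have "fps_nth X m = (\<Sum>k\<le>m. fps_nth (c k * (deriv_z ^^ k) \<psi>) m)"
      by (simp add: X_def c_def shift_compose_nth fps_const_power mult.assoc)
    also have "\<dots> = (\<Sum>k\<le>n. fps_nth (c k * (deriv_z ^^ k) \<psi>) m)"
      using that by (intro sum.mono_neutral_left) (auto simp: c_def fps_nth_deriv_z_funpow)
    finally show ?thesis by (simp add: R_def P_def fps_sum_nth)
  qed
  have "fps_nth (shift_compose X \<omega>) n =
      (\<Sum>q\<le>n. fps_nth (fps_const (1 / fact q) * \<omega> ^ q * (deriv_z ^^ q) X) n)"
    by (rule shift_compose_nth)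
  also have "\<dots> = (\<Sum>q\<le>n. \<Sum>k\<le>n. g q k)"
  proof (rule sum.cong)
    fix q
    have "(deriv_z ^^ q) X = (deriv_z ^^ q) P + (deriv_z ^^ q) R"
      by (simp add: R_def flip: deriv_z_funpow_add)
    moreover have "fps_nth (fps_const (1 / fact q) * \<omega> ^ q * (deriv_z ^^ q) R) n = 0"
      using R0 by (intro fps_mult_nth_eq_0 deriv_z_funpow_nth_eq_0[of n]) auto
    moreover have "fps_nth (fps_const (1 / fact q) * \<omega> ^ q * (deriv_z ^^ q) P) n = (\<Sum>k\<le>n. g q k)"
      by (simp add: P_def g_def c_def deriv_z_funpow_sum deriv_z_funpow_const_mult
          sum_distrib_left fps_sum_nth funpow_add del: fps_const_mult)
    ultimately show "fps_nth (fps_const (1 / fact q) * \<omega> ^ q * (deriv_z ^^ q) X) n = (\<Sum>k\<le>n. g q k)"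
      by (simp add: distrib_left)
  qed simp
  also have "\<dots> = (\<Sum>(q,k)\<in>{..n} \<times> {..n}. g q k)"
    by (simp add: sum.cartesian_product)
  \<comment> \<open>Terms with q + k > n vanish, so the square shrinks to a triangle, which is then
    summed along p = q + k.\<close>
  also have "\<dots> = (\<Sum>(q,k)\<in>{(q, k). q + k \<le> n}. g q k)"
    by (rule sum.mono_neutral_right) (auto intro: g0)
  also have "\<dots> = (\<Sum>p\<le>n. \<Sum>q\<le>p. g q (p - q))"
    by (rule sum.triangle_reindex_eq)
  also have "\<dots> = (\<Sum>p\<le>n. fps_nth (fps_const (1 / fact p) * (fps_const a + \<omega>) ^ p * (deriv_z ^^ p) \<psi>) n)"
  proof (rule sum.cong)
    fix p
    have "fps_const (1 / fact p) * (fps_const a + \<omega>) ^ p =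
      (\<Sum>q\<le>p. fps_const (1 / fact p) * (of_nat (p choose q) * \<omega> ^ q * fps_const a ^ (p - q)))"
      by (simp add: add.commute[of "fps_const a"] binomial_ring sum_distrib_left)
    also have "\<dots> = (\<Sum>q\<le>p. fps_const (1 / fact q) * \<omega> ^ q * c (p - q))"
    proof (rule sum.cong)
      fix q assume "q \<in> {..p}"
      then have "1 / fact p * of_nat (p choose q) * a ^ (p - q) = 1 / fact q * (a ^ (p - q) / fact (p - q))"
        by (simp add: binomial_fact)
      then have "fps_const (1 / fact p) * of_nat (p choose q) * fps_const a ^ (p - q)
          = fps_const (1 / fact q) * c (p - q)"
        unfolding c_def fps_of_nat[symmetric] fps_const_power fps_const_mult by simp
      then show "fps_const (1 / fact p) * (of_nat (p choose q) * \<omega> ^ q * fps_const a ^ (p - q))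
          = fps_const (1 / fact q) * \<omega> ^ q * c (p - q)"
        by (metis (no_types, lifting) mult.assoc mult.commute)
    qed simp
    finally show "(\<Sum>q\<le>p. g q (p - q)) =
        fps_nth (fps_const (1 / fact p) * (fps_const a + \<omega>) ^ p * (deriv_z ^^ p) \<psi>) n"
      by (simp add: g_def sum_distrib_right fps_sum_nth mult.assoc)
  qed simp
  also have "\<dots> = fps_nth (shift_compose \<psi> (fps_const a + \<omega>)) n"
    by (rule shift_compose_nth[symmetric])
  finally show "fps_nth (shift_compose X \<omega>) n = fps_nth (shift_compose \<psi> (fps_const a + \<omega>)) n" .
qed

text \<open>The index is shifted by one, since the zeroth convolution power would be \<open>\<delta>\<close>.\<close>

primrec borel_conv_power :: "(complex \<Rightarrow> complex) \<Rightarrow> nat \<Rightarrow> complex \<Rightarrow> complex" where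
  "borel_conv_power f 0 = f"
| "borel_conv_power f (Suc p) = borel_conv f (borel_conv_power f p)"

text \<open>The Borel transform of \<open>\<phi>\<^sup>p (d/dz)\<^sup>p \<chi>\<close>, where \<open>f\<close> and \<open>g\<close> are those of \<open>\<phi>\<close> and \<open>\<chi>\<close>.\<close>

fun shift_term :: "(complex \<Rightarrow> complex) \<Rightarrow> (complex \<Rightarrow> complex) \<Rightarrow> nat \<Rightarrow> complex \<Rightarrow> complex" where
  "shift_term f g 0 = g"
| "shift_term f g (Suc p) = borel_conv (borel_conv_power f p) (\<lambda>z. (- z) ^ Suc p * g z)"

lemma sum_even_power_le_exp:
  assumes "0 \<le> (y::real)"
  shows "(\<Sum>p<N. y ^ (2 * p) / fact (2 * p)) \<le> exp y"
proof -
  have "(\<Sum>p<N. y ^ (2 * p) / fact (2 * p)) \<le> (\<Sum>n<2 * N. y ^ n / fact n)"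
    by (induction N) (use assms in \<open>simp_all add: add_increasing2 del: fact_Suc\<close>)
  also have "\<dots> \<le> exp y"
    unfolding exp_def using assms summable_exp_generic[of y]
    by (auto intro!: sum_le_suminf simp: scaleR_conv_of_real divide_inverse mult.commute)
  finally show ?thesis .
qed

text \<open>The exponential series in - a z, in the shape that occurs both in the Borel image of a
  translation by \<open>a\<close> and in the expansion of a Laplace integral around a point.\<close>

lemma exp_shift_sums:
  fixes a z c :: complex
  shows "(\<lambda>p. 1 / fact p * (a ^ p * ((- z) ^ p * c))) sums (exp (- a * z) * c)"
proof -
  have "(\<lambda>p. (- a * z) ^ p /\<^sub>R fact p * c) sums (exp (- a * z) * c)"
    by (intro sums_mult2 exp_converges)
  moreover have "(- a * z) ^ p /\<^sub>R fact p * c = 1 / fact p * (a ^ p * ((- z) ^ p * c))" for p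
  proof -
    have "(- a * z) ^ p = a ^ p * (- z) ^ p"
      by (simp flip: power_mult_distrib)
    then show ?thesis by (simp add: scaleR_conv_of_real divide_inverse)
  qed
  ultimately show ?thesis by simp
qed

section \<open>Holomorphic representatives of Borel transforms\<close>

context star_domain
begin

text \<open>\<open>f\<close> is the Borel transform of \<open>F\<close> without its \<open>\<delta>\<close> part: the factorials of the
  transform turn the coefficients of \<open>F\<close> into the derivatives of \<open>f\<close> at \<open>0\<close>.\<close>

definition borel_rep :: "(complex \<Rightarrow> complex) \<Rightarrow> complex fps \<Rightarrow> bool" where
  "borel_rep f F \<longleftrightarrow> f holomorphic_on U \<and> (\<forall>n. (deriv ^^ n) f 0 = fps_nth F (Suc n))"

text \<open>The bound concerns the whole segment from 0 to \<open>z\<close>, since a convolution at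
  \<open>z\<close> depends on all of it. The rate \<open>c\<close> is 0 on compact sets and the
  growth rate along a ray.\<close>

definition ray_bound :: "real \<Rightarrow> real \<Rightarrow> (complex \<Rightarrow> complex) \<Rightarrow> complex \<Rightarrow> bool" where
  "ray_bound A c f z \<longleftrightarrow>
     0 \<le> A \<and> (\<forall>t\<in>{0..1}. norm (f (of_real t * z)) \<le> A * exp (c * (t * norm z)))"

lemma ray_bound_scale:
  assumes "ray_bound A c f z" "0 \<le> t" "t \<le> 1"
  shows "ray_bound A c f (of_real t * z)"
  unfolding ray_bound_def
proof (intro conjI ballI)
  fix s :: real assume "s \<in> {0..1}"
  then have "s * t \<in> {0..1}"
    using assms by (auto simp: mult_le_one)
  then have "norm (f (of_real (s * t) * z)) \<le> A * exp (c * ((s * t) * norm z))"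
    using assms(1) unfolding ray_bound_def by blast
  then show "norm (f (of_real s * (of_real t * z))) \<le> A * exp (c * (s * norm (of_real t * z)))"
    using assms by (simp add: norm_mult mult.assoc)
qed (use assms in \<open>simp add: ray_bound_def\<close>)

lemma ray_boundD:
  assumes "ray_bound A c f z"
  shows "0 \<le> A" "norm (f z) \<le> A * exp (c * norm z)"
  using assms unfolding ray_bound_def by (auto dest: bspec[of _ _ 1])

lemma borel_rep_holo: "borel_rep f F \<Longrightarrow> f holomorphic_on U"
  by (simp add: borel_rep_def)

text \<open>With both constant terms zero, coefficient n + 1 of the product pairs positive orders
  only, which leaves \<open>n\<close> products: the same range as in
  \<open>higher_deriv_borel_conv\<close>.\<close>

lemma borel_rep_conv:
  assumes "borel_rep f F" "borel_rep g G" "fps_nth F 0 = 0" "fps_nth G 0 = 0"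
  shows "borel_rep (borel_conv f g) (F * G)"
  unfolding borel_rep_def
proof (intro conjI allI)
  fix n
  have "fps_nth (F * G) (Suc n) = (\<Sum>i\<le>Suc n. fps_nth F i * fps_nth G (Suc n - i))"
    by (simp add: fps_mult_nth atLeast0AtMost)
  also have "\<dots> = (\<Sum>i\<le>n. fps_nth F (Suc i) * fps_nth G (n - i))"
    using assms by (subst sum.atMost_Suc_shift) simp
  also have "\<dots> = (\<Sum>i<n. fps_nth F (Suc i) * fps_nth G (Suc (n - 1 - i)))"
    using assms by (auto simp: lessThan_Suc_atMost[symmetric] Suc_diff_Suc intro!: sum.cong)
  finally show "(deriv ^^ n) (borel_conv f g) 0 = fps_nth (F * G) (Suc n)"
    using assms(1,2) by (simp add: borel_rep_def higher_deriv_borel_conv)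
qed (use assms in \<open>auto simp: borel_rep_def intro: holomorphic_borel_conv\<close>)

lemma borel_rep_conv_power:
  assumes "borel_rep f F" "fps_nth F 0 = 0"
  shows "borel_rep (borel_conv_power f p) (F ^ Suc p)"
  by (induction p) (use assms in \<open>auto intro!: borel_rep_conv[of f F] simp: fps_power_zeroth\<close>)

text \<open>In the Leibniz rule at 0 only the term with \<open>z\<close> differentiated once
  survives, n times the derivative of order n - 1; up to sign this is the effect of d/dz on z^-n.
  For n = 0 the truncated subtraction is harmless because of the factor \<open>n\<close>.\<close>

lemma borel_rep_deriv_z:
  assumes "borel_rep f F"
  shows "borel_rep (\<lambda>z. - z * f z) (deriv_z F)"
  unfolding borel_rep_def
proof (intro conjI allI)
  have f: "f holomorphic_on U" using assms by (simp add: borel_rep_def)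
  then show "(\<lambda>z. - z * f z) holomorphic_on U" by (intro holomorphic_intros)
  fix n
  have "(deriv ^^ n) (\<lambda>z. - (z * f z)) 0 = - (deriv ^^ n) (\<lambda>z. z * f z) 0"
    using f open_U zero_in by (intro higher_deriv_uminus) (auto intro!: holomorphic_intros)
  also have "(deriv ^^ n) (\<lambda>z. z * f z) 0 =
      (\<Sum>i = 0..n. of_nat (n choose i) * (deriv ^^ i) (\<lambda>z. z) 0 * (deriv ^^ (n - i)) f 0)"
    using f open_U zero_in by (intro higher_deriv_mult) auto
  also have "\<dots> = (\<Sum>i = 0..n. if i = 1 then of_nat n * (deriv ^^ (n - 1)) f 0 else 0)"
    by (intro sum.cong) (auto simp: higher_deriv_id)
  also have "\<dots> = of_nat n * fps_nth F n"
  proof (cases n)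
    case (Suc m)
    have "(deriv ^^ m) f 0 = fps_nth F (Suc m)" using assms by (simp add: borel_rep_def)
    moreover have "(\<Sum>i = 0..n. if i = 1 then c else 0) = c" for c :: complex
      using Suc by simp
    ultimately show ?thesis by (simp only: Suc diff_Suc_1)
  qed simp
  finally show "(deriv ^^ n) (\<lambda>z. - z * f z) 0 = fps_nth (deriv_z F) (Suc n)"
    by (simp add: fps_nth_deriv_z)
qed

lemma borel_rep_deriv_z_funpow:
  assumes "borel_rep f F"
  shows "borel_rep (\<lambda>z. (- z) ^ p * f z) ((deriv_z ^^ p) F)"
proof (induction p)
  case (Suc p)
  from borel_rep_deriv_z[OF this] show ?case by (simp add: mult.assoc)
qed (use assms in simp)

lemma borel_rep_cmult:
  assumes "borel_rep f F"
  shows "borel_rep (\<lambda>z. c * f z) (fps_const c * F)"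
  using assms higher_deriv_cmult[of f U 0 _ c] open_U zero_in
  by (auto simp: borel_rep_def intro!: holomorphic_intros)

text \<open>Supplies the bounds of rate 0 for the Weierstrass M-tests; the product of
  \<open>K\<close> with the unit interval is compact.\<close>

lemma compact_ray_bound:
  assumes "f holomorphic_on U" "compact K" "K \<subseteq> U"
  obtains A where "\<And>z. z \<in> K \<Longrightarrow> ray_bound A 0 f z"
proof -
  have "continuous_on (K \<times> {0..1}) (\<lambda>p. f (of_real (snd p) * fst p))"
    using assms by (intro cont_scaled[where h="\<lambda>t. t"]) auto
  then have "bounded ((\<lambda>p. f (of_real (snd p) * fst p)) ` (K \<times> {0..1}))"
    using assms by (intro compact_imp_bounded compact_continuous_image compact_Times) auto
  then obtain A where "0 < A" and
    A: "\<And>y. y \<in> (\<lambda>p. f (of_real (snd p) * fst p)) ` (K \<times> {0..1}) \<Longrightarrow> norm y \<le> A"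
    unfolding bounded_pos by blast
  have "ray_bound A 0 f z" if "z \<in> K" for z
    using that A \<open>0 < A\<close> by (force simp: ray_bound_def)
  then show ?thesis by (rule that)
qed

text \<open>Locally uniform convergence of holomorphic functions carries over to all derivatives at
  0, so the derivatives are summed term by term and meet the coefficients given by
  \<open>coeff\<close>.\<close>

lemma borel_rep_suminf:
  assumes rep: "\<And>p. borel_rep (f p) (F p)"
    and coeff: "\<And>n. (\<lambda>p. fps_nth (F p) (Suc n)) sums fps_nth S (Suc n)"
    and bound: "\<And>K. compact K \<Longrightarrow> K \<subseteq> U \<Longrightarrow>
      \<exists>M. summable M \<and> (\<forall>p. \<forall>z\<in>K. norm (f p z) \<le> M p)"
  shows "borel_rep (\<lambda>z. \<Sum>p. f p z) S"
proof -
  have holo: "f p holomorphic_on U" for p using rep by (rule borel_rep_holo)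
  have ul: "uniform_limit K (\<lambda>N z. \<Sum>p<N. f p z) (\<lambda>z. \<Sum>p. f p z) sequentially"
    if "compact K" "K \<subseteq> U" for K
    using bound[OF that] by (auto intro: Weierstrass_m_test)
  have 1: "(\<lambda>z. \<Sum>p. f p z) holomorphic_on U"
  proof (rule holomorphic_uniform_sequence[OF open_U])
    fix x assume "x \<in> U"
    then obtain d where "d > 0" "cball x d \<subseteq> U" using open_U open_contains_cball by blast
    then show "\<exists>d>0. cball x d \<subseteq> U \<and>
        uniform_limit (cball x d) (\<lambda>N z. \<Sum>p<N. f p z) (\<lambda>z. \<Sum>p. f p z) sequentially"
      using ul by auto
  qed (intro holomorphic_intros holo)
  obtain d where d: "d > 0" "cball 0 d \<subseteq> U" using open_U zero_in open_contains_cball by blast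
  have "(deriv ^^ n) (\<lambda>z. \<Sum>p. f p z) 0 = fps_nth S (Suc n)" for n
  proof (rule LIMSEQ_unique)
    show "(\<lambda>N. (deriv ^^ n) (\<lambda>z. \<Sum>p<N. f p z) 0) \<longlonglongrightarrow> (deriv ^^ n) (\<lambda>z. \<Sum>p. f p z) 0"
    proof (rule higher_deriv_complex_uniform_limit[where A="ball 0 d"])
      show "uniform_limit (ball 0 d) (\<lambda>N z. \<Sum>p<N. f p z) (\<lambda>z. \<Sum>p. f p z) sequentially"
        using ul[OF compact_cball d(2)] ball_subset_cball by (rule uniform_limit_on_subset)
      have "(\<lambda>z. \<Sum>p<N. f p z) holomorphic_on ball 0 d" for N
        using d by (intro holomorphic_intros holomorphic_on_subset[OF holo]) auto
      then show "\<forall>\<^sub>F N in sequentially. (\<lambda>z. \<Sum>p<N. f p z) holomorphic_on ball 0 d" by simp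
    qed (use d in auto)
    have "(deriv ^^ n) (\<lambda>z. \<Sum>p<N. f p z) 0 = (\<Sum>p<N. fps_nth (F p) (Suc n))" for N
    proof (induction N)
      case (Suc N)
      have "(deriv ^^ n) (\<lambda>z. (\<Sum>p<N. f p z) + f N z) 0 = (deriv ^^ n) (\<lambda>z. \<Sum>p<N. f p z) 0 + (deriv ^^ n) (f N) 0"
        by (rule higher_deriv_add[OF _ _ open_U zero_in]) (intro holomorphic_intros holo)+
      with Suc rep[of N] show ?case by (simp add: borel_rep_def)
    qed simp
    with coeff[of n] show "(\<lambda>N. (deriv ^^ n) (\<lambda>z. \<Sum>p<N. f p z) 0) \<longlonglongrightarrow> fps_nth S (Suc n)"
      by (simp add: sums_def)
  qed
  with 1 show ?thesis by (simp add: borel_rep_def)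
qed

lemma shift_compose_nth_sums:
  "(\<lambda>p. fps_nth (fps_const (1 / fact p) * (\<omega> ^ p * (deriv_z ^^ p) \<psi>)) n) sums
     fps_nth (shift_compose \<psi> \<omega>) n"
  unfolding shift_compose_nth mult.assoc
  by (rule sums_finite) (auto simp: not_le fps_nth_deriv_z_funpow intro!: fps_mult_nth_eq_0)

text \<open>Powers of the constant \<open>a\<close> act as scalars and not as convolutions, so the
  series a^p (- z)^p f / p! collapses to an exponential factor.\<close>

lemma borel_rep_shift_const:
  assumes f: "borel_rep f F"
  shows "borel_rep (\<lambda>z. exp (- a * z) * f z) (shift_compose F (fps_const a))"
proof -
  have "borel_rep (\<lambda>z. \<Sum>p. 1 / fact p * (a ^ p * ((- z) ^ p * f z))) (shift_compose F (fps_const a))"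
  proof (rule borel_rep_suminf)
    show "borel_rep (\<lambda>z. 1 / fact p * (a ^ p * ((- z) ^ p * f z)))
        (fps_const (1 / fact p) * (fps_const a ^ p * (deriv_z ^^ p) F))" for p
      unfolding fps_const_power by (intro borel_rep_cmult borel_rep_deriv_z_funpow f)
  next
    fix K :: "complex set" assume K: "compact K" "K \<subseteq> U"
    from compact_ray_bound[OF borel_rep_holo[OF f] K]
    obtain A where A: "\<And>z. z \<in> K \<Longrightarrow> ray_bound A 0 f z" by blast
    obtain R where "0 < R" and R: "\<And>z. z \<in> K \<Longrightarrow> norm z \<le> R"
      using compact_imp_bounded[OF K(1)] unfolding bounded_pos by blast
    have "norm (1 / fact p * (a ^ p * ((- z) ^ p * f z))) \<le> inverse (fact p) * (norm a * R) ^ p * A"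
      if "z \<in> K" for p z
      using ray_boundD[OF A[OF that]] R[OF that] \<open>0 < R\<close>
      by (auto simp: norm_mult norm_power norm_inverse norm_divide power_mult_distrib divide_inverse mult.assoc
          intro!: mult_mono power_mono)
    moreover have "summable (\<lambda>p. inverse (fact p) * (norm a * R) ^ p * A)"
      by (intro summable_mult2 summable_exp)
    ultimately show "\<exists>M. summable M \<and> (\<forall>p. \<forall>z\<in>K. norm (1 / fact p * (a ^ p * ((- z) ^ p * f z))) \<le> M p)"
      by blast
  qed (rule shift_compose_nth_sums)
  moreover have "(\<Sum>p. 1 / fact p * (a ^ p * ((- z) ^ p * f z))) = exp (- a * z) * f z" for z
    by (rule sums_unique[symmetric], rule exp_shift_sums)
  ultimately show ?thesis by simp
qed

lemma holomorphic_borel_conv_power: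
  "f holomorphic_on U \<Longrightarrow> borel_conv_power f p holomorphic_on U"
  by (induction p) (auto intro: holomorphic_borel_conv)

text \<open>Each convolution with \<open>f\<close> contributes a factor \<open>A\<close> and one
  integration in |z|; index \<open>p\<close> stands for p + 1 factors, hence the exponents p + 1 and
  p.\<close>

lemma norm_borel_conv_power_le:
  assumes f: "f holomorphic_on U" and "z \<in> U" "ray_bound A c f z"
  shows "norm (borel_conv_power f p z) \<le> A ^ Suc p * norm z ^ p / fact p * exp (c * norm z)"
  using assms(2,3)
proof (induction p arbitrary: z)
  case 0
  then show ?case using ray_boundD by simp
next
  case (Suc p)
  have "norm (borel_conv f (borel_conv_power f p) z)
    \<le> A * A ^ Suc p * norm z ^ (0 + p + 1) / fact (0 + p + 1) * exp (c * norm z)"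
  proof (rule norm_borel_conv_le[OF f holomorphic_borel_conv_power[OF f] Suc.prems(1)])
    fix t :: real assume t: "0 \<le> t" "t \<le> 1"
    show "norm (f (of_real t * z)) \<le> A * (t * norm z) ^ 0 / fact 0 * exp (c * (t * norm z))"
      using Suc.prems(2) t by (simp add: ray_bound_def)
    show "norm (borel_conv_power f p (of_real t * z))
        \<le> A ^ Suc p * (t * norm z) ^ p / fact p * exp (c * (t * norm z))"
      using Suc.IH[OF scale[OF Suc.prems(1) t] ray_bound_scale[OF Suc.prems(2) t]] t
      by (simp add: norm_mult)
  qed
  then show ?case by simp
qed

text \<open>Reading z^p as p! times z^p/p! fits the monomial form of
  \<open>norm_borel_conv_le\<close>; the exponents p - 1 and p then combine to (p - 1) + p + 1 = 2
  p.\<close>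

lemma norm_shift_term_le:
  assumes f: "f holomorphic_on U" and g: "g holomorphic_on U" and z: "z \<in> U"
    and fb: "ray_bound A c f z" and gb: "ray_bound B c g z"
  shows "norm (1 / fact p * shift_term f g p z)
    \<le> A ^ p * B * norm z ^ (2 * p) / fact (2 * p) * exp (c * norm z)"
proof (cases p)
  case 0
  then show ?thesis using ray_boundD[OF gb] by simp
next
  case (Suc q)
  have "norm (borel_conv (borel_conv_power f q) (\<lambda>z. (- z) ^ p * g z) z)
    \<le> A ^ p * (B * fact p) * norm z ^ (q + p + 1) / fact (q + p + 1) * exp (c * norm z)"
  proof (rule norm_borel_conv_le[OF holomorphic_borel_conv_power[OF f] _ z])
    fix t :: real assume t: "0 \<le> t" "t \<le> 1"
    show "norm (borel_conv_power f q (of_real t * z))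
        \<le> A ^ p * (t * norm z) ^ q / fact q * exp (c * (t * norm z))"
      using norm_borel_conv_power_le[OF f scale[OF z t] ray_bound_scale[OF fb t], of q] t
      by (simp add: norm_mult Suc)
    have "(t * norm z) ^ p * norm (g (of_real t * z)) \<le> (t * norm z) ^ p * (B * exp (c * (t * norm z)))"
      using gb t unfolding ray_bound_def by (intro mult_left_mono) auto
    then show "norm ((- (of_real t * z)) ^ p * g (of_real t * z))
        \<le> B * fact p * (t * norm z) ^ p / fact p * exp (c * (t * norm z))"
      using t by (simp add: norm_mult norm_power mult_ac)
  qed (use g in \<open>auto intro!: holomorphic_intros\<close>)
  moreover have "q + p + 1 = 2 * p" using Suc by simp
  moreover have "shift_term f g p = borel_conv (borel_conv_power f q) (\<lambda>z. (- z) ^ p * g z)"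
    by (simp add: Suc)
  ultimately have "norm (shift_term f g p z)
      \<le> fact p * (A ^ p * B * norm z ^ (2 * p) / fact (2 * p) * exp (c * norm z))"
    by (simp only: mult_ac times_divide_eq_right times_divide_eq_left)
  then show ?thesis
    by (simp add: norm_mult norm_divide field_simps del: fact_Suc)
qed

lemma borel_rep_shift:
  assumes f: "borel_rep f F" and F0: "fps_nth F 0 = 0" and g: "borel_rep g G"
  shows "borel_rep (\<lambda>z. \<Sum>p. 1 / fact p * shift_term f g p z) (shift_compose G F)"
proof (rule borel_rep_suminf)
  have rep: "borel_rep (shift_term f g p) (F ^ p * (deriv_z ^^ p) G)" for p
  proof (cases p)
    case 0
    with g show ?thesis by simp
  next
    case (Suc q)
    \<comment> \<open>\<open>G\<close> may have a constant term: for p > 0 the derivative removes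
      it, and for p = 0 there is no convolution.\<close>
    have "fps_nth (F ^ Suc q) 0 = 0" "fps_nth ((deriv_z ^^ Suc q) G) 0 = 0"
      using F0 by (simp_all add: fps_nth_deriv_z)
    from borel_rep_conv[OF borel_rep_conv_power[OF f F0] borel_rep_deriv_z_funpow[OF g] this]
    show ?thesis unfolding Suc by simp
  qed
  show "borel_rep (\<lambda>z. 1 / fact p * shift_term f g p z)
      (fps_const (1 / fact p) * (F ^ p * (deriv_z ^^ p) G))" for p
    by (intro borel_rep_cmult rep)
next
  fix K :: "complex set" assume K: "compact K" "K \<subseteq> U"
  obtain A where A: "\<And>z. z \<in> K \<Longrightarrow> ray_bound A 0 f z"
    using compact_ray_bound[OF borel_rep_holo[OF f] K] by blast
  obtain B where B: "\<And>z. z \<in> K \<Longrightarrow> ray_bound B 0 g z"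
    using compact_ray_bound[OF borel_rep_holo[OF g] K] by blast
  obtain R where "0 < R" and R: "\<And>z. z \<in> K \<Longrightarrow> norm z \<le> R"
    using compact_imp_bounded[OF K(1)] unfolding bounded_pos by blast
  have "norm (1 / fact p * shift_term f g p z) \<le> inverse (fact p) * (A * R\<^sup>2) ^ p * B"
    if z: "z \<in> K" for p z
  proof -
    note AB = ray_boundD(1)[OF A[OF z]] ray_boundD(1)[OF B[OF z]]
    have "norm (1 / fact p * shift_term f g p z)
        \<le> A ^ p * B * norm z ^ (2 * p) / fact (2 * p) * exp (0 * norm z)"
      using z K by (intro norm_shift_term_le A B borel_rep_holo[OF f] borel_rep_holo[OF g]) auto
    \<comment> \<open>On a compact set it is enough to replace (2 p)! by the smaller p!, which makes
      the majorant an exponential series.\<close>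
    also have "\<dots> \<le> A ^ p * B * R ^ (2 * p) / fact p"
      using AB R[OF z] fact_mono[of p "2 * p", where 'a=real]
      by (auto intro!: frac_le mult_left_mono power_mono mult_nonneg_nonneg)
    also have "\<dots> = inverse (fact p) * (A * R\<^sup>2) ^ p * B"
      by (simp add: power_mult_distrib power_mult divide_inverse)
    finally show ?thesis .
  qed
  moreover have "summable (\<lambda>p. inverse (fact p) * (A * R\<^sup>2) ^ p * B)"
    by (intro summable_mult2 summable_exp)
  ultimately show "\<exists>M. summable M \<and> (\<forall>p. \<forall>z\<in>K. norm (1 / fact p * shift_term f g p z) \<le> M p)"
    by blast
qed (rule shift_compose_nth_sums)

text \<open>One factor A / \<rho> is split off so that the rest, summed over \<open>p\<close>, is
  the exponential series of A |z| / \<rho>.\<close>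

lemma norm_subst_term_le:
  assumes f: "f holomorphic_on U" and z: "z \<in> U" and A: "ray_bound A c f z"
    and h: "\<And>p. norm (h p) \<le> C / \<rho> ^ p" and \<rho>: "0 < \<rho>"
  shows "norm (h (Suc p) * borel_conv_power f p z)
    \<le> C * (A / \<rho>) * (inverse (fact p) * (A / \<rho> * norm z) ^ p) * exp (c * norm z)"
proof -
  have "norm (h (Suc p) * borel_conv_power f p z)
      \<le> C / \<rho> ^ Suc p * (A ^ Suc p * norm z ^ p / fact p * exp (c * norm z))"
    unfolding norm_mult using norm_borel_conv_power_le[OF f z A, of p] h[of "Suc p"]
    by (intro mult_mono) (auto intro: order_trans[OF norm_ge_zero])
  also have "\<dots> = C * (A / \<rho>) * (inverse (fact p) * (A / \<rho> * norm z) ^ p) * exp (c * norm z)"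
    using \<rho> by (simp add: power_mult_distrib power_divide power_inverse divide_inverse)
  finally show ?thesis .
qed

text \<open>The coefficient of index 0 of \<open>H\<close> only contributes to the \<delta> part, so
  the function starts with the first power of \<open>F\<close>, which has index 0 in
  \<open>borel_conv_power\<close>.\<close>

lemma borel_rep_fps_compose:
  assumes f: "borel_rep f F" and F0: "fps_nth F 0 = 0"
    and h: "\<And>p. norm (fps_nth H p) \<le> C / \<rho> ^ p" and \<rho>: "0 < \<rho>"
  shows "borel_rep (\<lambda>z. \<Sum>p. fps_nth H (Suc p) * borel_conv_power f p z) (fps_compose H F)"
proof (rule borel_rep_suminf)
  show "borel_rep (\<lambda>z. fps_nth H (Suc p) * borel_conv_power f p z)
      (fps_const (fps_nth H (Suc p)) * F ^ Suc p)" for p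
    by (intro borel_rep_cmult borel_rep_conv_power f F0)
next
  fix n
  have "(\<lambda>p. fps_nth H p * fps_nth (F ^ p) (Suc n)) sums (\<Sum>p\<in>{0..Suc n}. fps_nth H p * fps_nth (F ^ p) (Suc n))"
    using F0 by (intro sums_finite) (auto simp: startsby_zero_power_prefix not_le)
  then have "(\<lambda>p. fps_nth H p * fps_nth (F ^ p) (Suc n)) sums fps_nth (fps_compose H F) (Suc n)"
    by (simp only: fps_compose_nth)
  then show "(\<lambda>p. fps_nth (fps_const (fps_nth H (Suc p)) * F ^ Suc p) (Suc n)) sums
      fps_nth (fps_compose H F) (Suc n)"
    using sums_Suc_iff[of "\<lambda>p. fps_nth H p * fps_nth (F ^ p) (Suc n)"] by simp
next
  fix K :: "complex set" assume K: "compact K" "K \<subseteq> U"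
  obtain A where A: "\<And>z. z \<in> K \<Longrightarrow> ray_bound A 0 f z"
    using compact_ray_bound[OF borel_rep_holo[OF f] K] by blast
  obtain R where "0 < R" and R: "\<And>z. z \<in> K \<Longrightarrow> norm z \<le> R"
    using compact_imp_bounded[OF K(1)] unfolding bounded_pos by blast
  have C: "0 \<le> C" using h[of 0] by (auto intro: order_trans[OF norm_ge_zero])
  have "norm (fps_nth H (Suc p) * borel_conv_power f p z)
      \<le> C * (A / \<rho>) * (inverse (fact p) * (A / \<rho> * R) ^ p)" if z: "z \<in> K" for p z
  proof -
    have "norm (fps_nth H (Suc p) * borel_conv_power f p z)
      \<le> C * (A / \<rho>) * (inverse (fact p) * (A / \<rho> * norm z) ^ p) * exp (0 * norm z)"
      using z K by (intro norm_subst_term_le A borel_rep_holo[OF f] h \<rho>) auto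
    also have "\<dots> \<le> C * (A / \<rho>) * (inverse (fact p) * (A / \<rho> * R) ^ p)"
      using C \<rho> R[OF z] ray_boundD(1)[OF A[OF z]]
      by (auto intro!: mult_left_mono power_mono divide_right_mono)
    finally show ?thesis .
  qed
  moreover have "summable (\<lambda>p. C * (A / \<rho>) * (inverse (fact p) * (A / \<rho> * R) ^ p))"
    by (intro summable_mult summable_exp)
  ultimately show "\<exists>M. summable M \<and> (\<forall>p. \<forall>z\<in>K. norm (fps_nth H (Suc p) * borel_conv_power f p z) \<le> M p)"
    by blast
qed

end

section \<open>Laplace transforms along a ray\<close>

lemma exp_minus_Ici:
  assumes "0 < (k::real)"
  shows "set_integrable lborel {0..} (\<lambda>s. exp (- k * s))"
    and "(LINT s:{0..}|lborel. exp (- k * s)) = 1 / k"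
proof -
  have "(\<lambda>s. exp (- k * s)) absolutely_integrable_on {0..}"
    using integrable_on_exp_minus_to_infinity[OF assms]
    by (intro nonnegative_absolutely_integrable_1) auto
  moreover have "(\<lambda>s. indicator {0..} s *\<^sub>R exp (- k * s)) \<in> borel_measurable lborel"
    by (auto intro!: borel_measurable_continuous_on_indicator continuous_intros)
  ultimately show 1: "set_integrable lborel {0..} (\<lambda>s. exp (- k * s))"
    by (simp add: set_integrable_def integrable_completion)
  show "(LINT s:{0..}|lborel. exp (- k * s)) = 1 / k"
    using set_borel_integral_eq_integral(2)[OF 1] has_integral_exp_minus_to_infinity[OF assms, of 0]
    by (simp add: integral_unique)
qed

definition laplace_kernel :: "complex \<Rightarrow> (complex \<Rightarrow> complex) \<Rightarrow> complex \<Rightarrow> real \<Rightarrow> complex" where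
  "laplace_kernel u f z s = exp (- z * (of_real s * u)) * f (of_real s * u) * u"

definition laplace_ray :: "complex \<Rightarrow> (complex \<Rightarrow> complex) \<Rightarrow> complex \<Rightarrow> complex" where
  "laplace_ray u f z = (LINT s:{0<..}|lborel. laplace_kernel u f z s)"

text \<open>The value s = 0 is included: this forces \<open>A\<close> to be nonnegative and makes
  the bound valid on segments that start at the vertex.\<close>

definition exp_growth :: "complex \<Rightarrow> real \<Rightarrow> real \<Rightarrow> (complex \<Rightarrow> complex) \<Rightarrow> bool" where
  "exp_growth u A c f \<longleftrightarrow> (\<forall>s\<ge>0. norm (f (of_real s * u)) \<le> A * exp (c * s))"

text \<open>Some rate strictly below Re (z u), without control of the constants: enough for
  integrability, and stable under polynomial factors.\<close>

definition laplace_ok :: "complex \<Rightarrow> complex \<Rightarrow> (complex \<Rightarrow> complex) \<Rightarrow> bool" where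
  "laplace_ok u z f \<longleftrightarrow> (\<exists>A c. c < Re (z * u) \<and> exp_growth u A c f)"

lemma exp_growth_nonneg: "exp_growth u A c f \<Longrightarrow> 0 \<le> A"
  unfolding exp_growth_def by (drule spec[of _ 0]) (auto intro: order_trans[OF norm_ge_zero])

lemma exp_growth_mono:
  assumes "exp_growth u A c f" "A \<le> B" "c \<le> d"
  shows "exp_growth u B d f"
  unfolding exp_growth_def
proof (intro allI impI)
  fix s :: real assume "0 \<le> s"
  then have "norm (f (of_real s * u)) \<le> A * exp (c * s)" using assms by (simp add: exp_growth_def)
  also have "\<dots> \<le> B * exp (d * s)"
    using assms \<open>0 \<le> s\<close> exp_growth_nonneg[OF assms(1)]
    by (intro mult_mono) (auto intro: mult_right_mono)
  finally show "norm (f (of_real s * u)) \<le> B * exp (d * s)" .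
qed

lemma laplace_ok_polynomial_growth:
  assumes c: "c < Re (z * u)" and A: "0 \<le> A"
    and f: "\<And>s. 0 \<le> s \<Longrightarrow> norm (f (of_real s * u)) \<le> A * s ^ n * exp (c * s)"
  shows "laplace_ok u z f"
proof -
  \<comment> \<open>Half of the gap below Re (z u): exp (e s) dominates s^n up to the factor n!/e^n,
    and the rate c + e is still admissible.\<close>
  define e where "e = (Re (z * u) - c) / 2"
  have e: "0 < e" "c + e < Re (z * u)" using c by (auto simp: e_def field_simps)
  have "norm (f (of_real s * u)) \<le> A * fact n / e ^ n * exp ((c + e) * s)" if s: "0 \<le> s" for s
  proof -
    have "(e * s) ^ n / fact n \<le> (\<Sum>k<Suc n. (e * s) ^ k / fact k)"
      using e s by (intro member_le_sum) auto
    also have "\<dots> \<le> exp (e * s)"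
      unfolding exp_def using e s summable_exp_generic[of "e * s"]
      by (auto intro!: sum_le_suminf simp: scaleR_conv_of_real divide_inverse mult.commute simp del: sum.lessThan_Suc)
    finally have "s ^ n \<le> fact n / e ^ n * exp (e * s)"
      using e by (simp add: field_simps power_mult_distrib)
    then have "A * s ^ n * exp (c * s) \<le> A * (fact n / e ^ n * exp (e * s)) * exp (c * s)"
      using A by (intro mult_right_mono mult_left_mono) auto
    also have "\<dots> = A * fact n / e ^ n * exp ((c + e) * s)"
      by (simp add: exp_add distrib_right)
    finally show ?thesis using f[OF s] by simp
  qed
  with e show ?thesis unfolding laplace_ok_def exp_growth_def by blast
qed

lemma norm_suminf_le_bound:
  fixes f :: "nat \<Rightarrow> complex"
  assumes "\<And>N. (\<Sum>p<N. norm (f p)) \<le> M"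
  shows "summable f" "norm (\<Sum>p. f p) \<le> M"
proof -
  have s: "summable (\<lambda>p. norm (f p))"
    by (rule summableI_nonneg_bounded) (use assms in auto)
  then show "summable f" by (rule summable_norm_cancel)
  show "norm (\<Sum>p. f p) \<le> M"
    using summable_norm[OF s] suminf_le_const[OF s assms] by linarith
qed

locale star_domain_ray = star_domain +
  fixes u :: complex
  assumes norm_u: "norm u = 1" and ray: "\<And>s. 0 \<le> s \<Longrightarrow> of_real s * u \<in> U"
begin

lemma norm_laplace_kernel:
  "norm (laplace_kernel u f z s) = exp (- Re (z * u) * s) * norm (f (of_real s * u))"
proof -
  have "norm (exp (- z * (of_real s * u))) = exp (- Re (z * u) * s)" by (simp add: algebra_simps)
  then show ?thesis by (simp add: laplace_kernel_def norm_mult norm_u)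
qed

lemma norm_laplace_kernel_le:
  assumes "exp_growth u A c f" "0 \<le> s"
  shows "norm (laplace_kernel u f z s) \<le> A * exp (- (Re (z * u) - c) * s)"
proof -
  have "norm (laplace_kernel u f z s) \<le> exp (- Re (z * u) * s) * (A * exp (c * s))"
    unfolding norm_laplace_kernel using assms by (auto simp: exp_growth_def)
  also have "\<dots> = A * exp (- (Re (z * u) - c) * s)"
    by (simp add: exp_add[symmetric] algebra_simps)
  finally show ?thesis .
qed

lemma continuous_laplace_kernel:
  assumes "f holomorphic_on U"
  shows "continuous_on {0..} (laplace_kernel u f z)"
  unfolding laplace_kernel_def
  by (intro continuous_intros continuous_on_compose2[OF holomorphic_on_imp_continuous_on[OF assms]])
     (auto intro: ray)

lemma laplace_kernel_measurable:
  assumes "f holomorphic_on U"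
  shows "(\<lambda>s. indicator {0<..} s *\<^sub>R laplace_kernel u f z s) \<in> borel_measurable borel"
  by (intro borel_measurable_continuous_on_indicator
      continuous_on_subset[OF continuous_laplace_kernel[OF assms]]) auto

lemma laplace_set_integrable:
  assumes f: "f holomorphic_on U" and "laplace_ok u z f"
  shows "set_integrable lborel {0<..} (laplace_kernel u f z)"
proof -
  obtain A c where c: "c < Re (z * u)" and g: "exp_growth u A c f"
    using assms by (auto simp: laplace_ok_def)
  have "set_integrable lborel {0..} (\<lambda>s. A * exp (- (Re (z * u) - c) * s))"
    using exp_minus_Ici(1)[of "Re (z * u) - c"] c by (intro set_integrable_mult_right) auto
  then show ?thesis
    unfolding set_integrable_def
  proof (rule Bochner_Integration.integrable_bound)
    show "AE s in lborel. norm (indicator {0<..} s *\<^sub>R laplace_kernel u f z s)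
        \<le> norm (indicator {0..} s *\<^sub>R (A * exp (- (Re (z * u) - c) * s)))"
      using norm_laplace_kernel_le[OF g] exp_growth_nonneg[OF g]
      by (intro AE_I2) (auto simp: indicator_def abs_mult)
  qed (use laplace_kernel_measurable[OF f] in simp)
qed

text \<open>The exponential majorant is integrated explicitly. This one estimate later yields |S
  \<phi>| \<le> \<rho> and keeps the displaced point in its half-plane.\<close>

lemma norm_laplace_ray_le:
  assumes f: "f holomorphic_on U" and g: "exp_growth u A c f" and c: "c < Re (z * u)"
  shows "norm (laplace_ray u f z) \<le> A / (Re (z * u) - c)"
proof -
  note E = exp_minus_Ici[of "Re (z * u) - c"]
  have i: "set_integrable lborel {0..} (\<lambda>s. A * exp (- (Re (z * u) - c) * s))"
    using E c by (intro set_integrable_mult_right) auto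
  have ok: "laplace_ok u z f" using assms by (auto simp: laplace_ok_def)
  have "norm (laplace_ray u f z) \<le> (LINT s|lborel. norm (indicator {0<..} s *\<^sub>R laplace_kernel u f z s))"
    unfolding laplace_ray_def set_lebesgue_integral_def by (rule integral_norm_bound)
  also have "\<dots> \<le> (LINT s:{0..}|lborel. A * exp (- (Re (z * u) - c) * s))"
    unfolding set_lebesgue_integral_def
  proof (rule integral_mono)
    show "norm (indicator {0<..} s *\<^sub>R laplace_kernel u f z s)
        \<le> indicator {0..} s *\<^sub>R (A * exp (- (Re (z * u) - c) * s))" for s
      using norm_laplace_kernel_le[OF g] exp_growth_nonneg[OF g] by (auto simp: indicator_def)
  qed (use i integrable_norm[OF laplace_set_integrable[OF f ok, unfolded set_integrable_def]]
      in \<open>simp_all only: set_integrable_def\<close>)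
  also have "\<dots> = A / (Re (z * u) - c)"
    using E(2) c by simp
  finally show ?thesis .
qed

lemma laplace_ray_cmult: "laplace_ray u (\<lambda>\<zeta>. k * f \<zeta>) z = k * laplace_ray u f z"
proof -
  have "laplace_kernel u (\<lambda>\<zeta>. k * f \<zeta>) z = (\<lambda>s. k * laplace_kernel u f z s)"
    by (auto simp: laplace_kernel_def)
  then show ?thesis by (simp add: laplace_ray_def)
qed

lemma laplace_ray_exp_mult: "laplace_ray u (\<lambda>\<zeta>. exp (- w * \<zeta>) * f \<zeta>) z = laplace_ray u f (z + w)"
proof -
  have "laplace_kernel u (\<lambda>\<zeta>. exp (- w * \<zeta>) * f \<zeta>) z = laplace_kernel u f (z + w)"
  proof
    fix s
    have "exp (- z * (of_real s * u)) * exp (- w * (of_real s * u)) = exp (- (z + w) * (of_real s * u))"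
      unfolding exp_add[symmetric] by (simp add: algebra_simps)
    then show "laplace_kernel u (\<lambda>\<zeta>. exp (- w * \<zeta>) * f \<zeta>) z s = laplace_kernel u f (z + w) s"
      by (simp add: laplace_kernel_def flip: mult.assoc)
  qed
  then show ?thesis by (simp add: laplace_ray_def)
qed

text \<open>The convolution theorem. With the kernels cut off at 0, Fubini applies to
  \<open>F s * G (x - s)\<close>, and translation invariance of Lebesgue measure factors the double
  integral; the inner integral over (0, x) is the segment integral of the convolution.\<close>

lemma laplace_ray_conv:
  assumes f: "f holomorphic_on U" and g: "g holomorphic_on U"
    and okf: "laplace_ok u z f" and okg: "laplace_ok u z g"
  shows "laplace_ray u (borel_conv f g) z = laplace_ray u f z * laplace_ray u g z"
proof -
  define F where "F s = indicator {0<..} s *\<^sub>R laplace_kernel u f z s" for s :: real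
  define G where "G s = indicator {0<..} s *\<^sub>R laplace_kernel u g z s" for s :: real
  have [measurable]: "F \<in> borel_measurable borel" "G \<in> borel_measurable borel"
    unfolding F_def G_def using f g by (auto intro: laplace_kernel_measurable)
  have F: "integrable lborel F" and G: "integrable lborel G"
    unfolding F_def G_def using laplace_set_integrable assms by (auto simp: set_integrable_def)
  have shift: "(LINT x|lborel. h (x - s)) = (LINT x|lborel. h x)" for h :: "real \<Rightarrow> 'b::{banach,second_countable_topology}" and s
    using lborel_integral_real_affine[of 1 h "- s"] by simp
  have Gs: "integrable lborel (\<lambda>x. G (x - s))" for s
    using lborel_integrable_real_affine[OF G, of 1 "- s"] by simp
  have int: "integrable (lborel \<Otimes>\<^sub>M lborel) (\<lambda>(s, x). F s * G (x - s))"
  proof (rule lborel_pair.Fubini_integrable)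
    show "integrable lborel (\<lambda>s. LINT x|lborel. norm (case (s, x) of (s, x) \<Rightarrow> F s * G (x - s)))"
      using F by (simp add: norm_mult shift[of "\<lambda>x. norm (G x)"])
    show "AE s in lborel. integrable lborel (\<lambda>x. case (s, x) of (s, x) \<Rightarrow> F s * G (x - s))"
      using Gs by simp
  qed measurable
  have "(LINT x|lborel. LINT s|lborel. F s * G (x - s)) = (LINT s|lborel. LINT x|lborel. F s * G (x - s))"
    by (rule lborel_pair.Fubini_integral[OF int])
  also have "\<dots> = (LINT s|lborel. F s) * (LINT x|lborel. G x)"
    using F by (simp add: shift)
  also have "\<dots> = laplace_ray u f z * laplace_ray u g z"
    by (simp add: laplace_ray_def set_lebesgue_integral_def F_def G_def)
  also have "(\<lambda>x. LINT s|lborel. F s * G (x - s)) =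
      (\<lambda>x. indicator {0<..} x *\<^sub>R laplace_kernel u (borel_conv f g) z x)"
  proof
    fix x :: real
    show "(LINT s|lborel. F s * G (x - s)) = indicator {0<..} x *\<^sub>R laplace_kernel u (borel_conv f g) z x"
    proof (cases "0 < x")
      case False
      then have "(\<lambda>s. F s * G (x - s)) = (\<lambda>s. 0)"
        by (auto simp: F_def G_def indicator_def)
      with False show ?thesis by simp
    next
      case x: True
      define w where "w = of_real x * u"
      define k where "k t = f (of_real t * w) * g (of_real (1 - t) * w)" for t :: real
      have w: "w \<in> U" using ray x by (simp add: w_def)
      have "continuous_on {0..1} k"
        unfolding k_def using f g w by (rule continuous_on_conv_integrand)
      then have "set_integrable lborel {0..1} k" by (rule borel_integrable_atLeastAtMost')
      then have "set_integrable lborel {0<..<1} k" by (rule set_integrable_subset) auto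
      then have k: "(LINT t:{0<..<1}|lborel. k t) = integral {0..1} k"
        by (simp add: set_borel_integral_eq_integral(2) integral_open_interval_real)
      \<comment> \<open>The substitution s = x t produces the parametrisation of
        \<open>borel_conv\<close>. Of the two factors \<open>u\<close>, one completes
        \<open>x\<close> to \<open>w\<close> and the other is the one in the kernel.\<close>
      have "(LINT s|lborel. F s * G (x - s)) = x *\<^sub>R (LINT t|lborel. F (x * t) * G (x - x * t))"
        using lborel_integral_real_affine[of x "\<lambda>s. F s * G (x - s)" 0] x by simp
      also have "(\<lambda>t. F (x * t) * G (x - x * t)) =
          (\<lambda>t. exp (- z * w) * u\<^sup>2 * (indicator {0<..<1} t *\<^sub>R k t))"
      proof
        fix t :: real
        have "0 < x * t \<longleftrightarrow> 0 < t" "0 < x - x * t \<longleftrightarrow> t < 1"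
          using x by (auto simp: zero_less_mult_iff)
        then have "F (x * t) * G (x - x * t) = indicator {0<..<1} t *\<^sub>R
            (laplace_kernel u f z (x * t) * laplace_kernel u g z (x - x * t))"
          by (auto simp: F_def G_def indicator_def)
        moreover have "laplace_kernel u f z (x * t) * laplace_kernel u g z (x - x * t)
            = exp (- z * w) * u\<^sup>2 * k t"
        proof -
          have "exp (- z * w) = exp (- z * (of_real (x * t) * u)) * exp (- z * (of_real (x - x * t) * u))"
            by (simp add: w_def exp_add[symmetric] algebra_simps)
          moreover have "of_real (x * t) * u = of_real t * w" "of_real (x - x * t) * u = of_real (1 - t) * w"
            by (simp_all add: w_def algebra_simps)
          ultimately show ?thesis
            by (simp add: laplace_kernel_def k_def power2_eq_square del: of_real_mult of_real_diff)
        qed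
        ultimately show "F (x * t) * G (x - x * t) = exp (- z * w) * u\<^sup>2 * (indicator {0<..<1} t *\<^sub>R k t)"
          by (simp add: indicator_def)
      qed
      also have "x *\<^sub>R (LINT t|lborel. exp (- z * w) * u\<^sup>2 * (indicator {0<..<1} t *\<^sub>R k t))
          = exp (- z * w) * (w * integral {0..1} k) * u"
        using k by (simp add: set_lebesgue_integral_def w_def power2_eq_square scaleR_conv_of_real)
      also have "\<dots> = laplace_kernel u (borel_conv f g) z x"
        by (simp add: laplace_kernel_def borel_conv_def k_def[abs_def] w_def)
      finally show ?thesis using x by simp
    qed
  qed
  finally show ?thesis by (simp add: laplace_ray_def set_lebesgue_integral_def)
qed

text \<open>Dominated convergence. Bounding the partial sums of norms serves three purposes: growth
  of each term, summability at each point of the ray, and the integrable majorant.\<close>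

lemma laplace_ray_suminf:
  assumes f: "\<And>p. f p holomorphic_on U" and S: "(\<lambda>\<zeta>. \<Sum>p. f p \<zeta>) holomorphic_on U"
    and bound: "\<And>N s. 0 \<le> s \<Longrightarrow> (\<Sum>p<N. norm (f p (of_real s * u))) \<le> B * exp (c * s)"
    and c: "c < Re (z * u)"
  shows "(\<lambda>p. laplace_ray u (f p) z) sums laplace_ray u (\<lambda>\<zeta>. \<Sum>p. f p \<zeta>) z"
proof -
  define h where "h p s = indicator {0<..} s *\<^sub>R laplace_kernel u (f p) z s" for p and s :: real
  have growth: "exp_growth u B c (f p)" for p
    unfolding exp_growth_def
  proof (intro allI impI)
    fix s :: real assume "0 \<le> s"
    have "norm (f p (of_real s * u)) \<le> (\<Sum>q<Suc p. norm (f q (of_real s * u)))"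
      by (rule member_le_sum) auto
    also have "\<dots> \<le> B * exp (c * s)" by (rule bound) fact
    finally show "norm (f p (of_real s * u)) \<le> B * exp (c * s)" .
  qed
  have B: "0 \<le> B" using exp_growth_nonneg[OF growth] .
  have meas: "h p \<in> borel_measurable borel" for p
    unfolding h_def using f by (rule laplace_kernel_measurable)
  have int: "integrable lborel (h p)" for p
  proof -
    have "laplace_ok u z (f p)" using growth c by (auto simp: laplace_ok_def)
    from laplace_set_integrable[OF f this] show ?thesis by (simp add: h_def[abs_def] set_integrable_def)
  qed
  have "(\<lambda>N. LINT s|lborel. (\<Sum>p<N. h p s)) \<longlonglongrightarrow>
      (LINT s|lborel. indicator {0<..} s *\<^sub>R laplace_kernel u (\<lambda>\<zeta>. \<Sum>p. f p \<zeta>) z s)"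
  proof (rule integral_dominated_convergence)
    show "integrable lborel (\<lambda>s. indicator {0..} s *\<^sub>R (B * exp (- (Re (z * u) - c) * s)))"
      using exp_minus_Ici(1)[of "Re (z * u) - c"] c
      unfolding set_integrable_def[symmetric] by (intro set_integrable_mult_right) auto
    show "AE s in lborel. (\<lambda>N. \<Sum>p<N. h p s) \<longlonglongrightarrow>
        indicator {0<..} s *\<^sub>R laplace_kernel u (\<lambda>\<zeta>. \<Sum>p. f p \<zeta>) z s"
    proof (rule AE_I2)
      fix s :: real
      show "(\<lambda>N. \<Sum>p<N. h p s) \<longlonglongrightarrow> indicator {0<..} s *\<^sub>R laplace_kernel u (\<lambda>\<zeta>. \<Sum>p. f p \<zeta>) z s"
      proof (cases "0 < s")
        case True
        then have "(\<lambda>p. f p (of_real s * u)) sums (\<Sum>p. f p (of_real s * u))"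
          using norm_suminf_le_bound(1)[OF bound] by (intro summable_sums) auto
        then have "(\<lambda>p. laplace_kernel u (f p) z s) sums laplace_kernel u (\<lambda>\<zeta>. \<Sum>p. f p \<zeta>) z s"
          unfolding laplace_kernel_def by (intro sums_mult sums_mult2)
        then show ?thesis using True by (simp add: h_def sums_def)
      qed (simp add: h_def)
    qed
    show "AE s in lborel. norm (\<Sum>p<N. h p s)
        \<le> indicator {0..} s *\<^sub>R (B * exp (- (Re (z * u) - c) * s))" for N
    proof (rule AE_I2)
      fix s :: real
      show "norm (\<Sum>p<N. h p s) \<le> indicator {0..} s *\<^sub>R (B * exp (- (Re (z * u) - c) * s))"
      proof (cases "0 < s")
        case True
        have "norm (\<Sum>p<N. h p s) \<le> (\<Sum>p<N. exp (- Re (z * u) * s) * norm (f p (of_real s * u)))"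
          using True by (intro sum_norm_le) (simp add: h_def norm_laplace_kernel)
        also have "\<dots> \<le> exp (- Re (z * u) * s) * (B * exp (c * s))"
          unfolding sum_distrib_left[symmetric] using True bound by (intro mult_left_mono) auto
        also have "\<dots> = B * exp (- (Re (z * u) - c) * s)"
          by (simp add: exp_add[symmetric] algebra_simps)
        finally show ?thesis using True by simp
      qed (use B in \<open>auto simp: h_def indicator_def\<close>)
    qed
  qed (use meas laplace_kernel_measurable[OF S] in simp_all)
  moreover have "(LINT s|lborel. (\<Sum>p<N. h p s)) = (\<Sum>p<N. laplace_ray u (f p) z)" for N
    unfolding Bochner_Integration.integral_sum[OF int] by (simp add: laplace_ray_def set_lebesgue_integral_def h_def[abs_def])
  ultimately show ?thesis
    by (simp add: sums_def laplace_ray_def set_lebesgue_integral_def)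
qed

text \<open>The Taylor series at \<open>z\<close> of a Laplace transform, whose derivatives are the
  transforms of (- \<zeta>)^p g. Expanding exp (- w \<zeta>) under the integral adds |w| to the
  rate, hence the condition on \<open>w\<close>. It serves the shift identity and holomorphy
  alike.\<close>

lemma laplace_ray_shift_sums:
  assumes g: "g holomorphic_on U" and growth: "exp_growth u B c g" and w: "norm w < Re (z * u) - c"
  shows "(\<lambda>p. 1 / fact p * (w ^ p * laplace_ray u (\<lambda>\<zeta>. (- \<zeta>) ^ p * g \<zeta>) z)) sums laplace_ray u g (z + w)"
proof -
  define f where "f p \<zeta> = 1 / fact p * (w ^ p * ((- \<zeta>) ^ p * g \<zeta>))" for p \<zeta>
  have suminf: "(\<lambda>\<zeta>. \<Sum>p. f p \<zeta>) = (\<lambda>\<zeta>. exp (- w * \<zeta>) * g \<zeta>)"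
    using exp_shift_sums by (auto simp: f_def sums_iff)
  have "(\<lambda>p. laplace_ray u (f p) z) sums laplace_ray u (\<lambda>\<zeta>. \<Sum>p. f p \<zeta>) z"
  proof (rule laplace_ray_suminf)
    show "f p holomorphic_on U" for p
      unfolding f_def by (intro holomorphic_intros g)
    show "(\<lambda>\<zeta>. \<Sum>p. f p \<zeta>) holomorphic_on U"
      unfolding suminf by (intro holomorphic_intros g)
    show "norm w + c < Re (z * u)" using w by simp
    fix N and s :: real assume s: "0 \<le> s"
    have "(\<Sum>p<N. norm (f p (of_real s * u))) = (\<Sum>p<N. (norm w * s) ^ p / fact p) * norm (g (of_real s * u))"
      unfolding sum_distrib_right
      by (intro sum.cong) (simp_all add: f_def norm_mult norm_divide norm_power norm_u s power_mult_distrib)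
    also have "\<dots> \<le> exp (norm w * s) * (B * exp (c * s))"
    proof (intro mult_mono)
      show "(\<Sum>p<N. (norm w * s) ^ p / fact p) \<le> exp (norm w * s)"
        unfolding exp_def using s summable_exp_generic[of "norm w * s"]
        by (auto intro!: sum_le_suminf simp: scaleR_conv_of_real divide_inverse mult.commute)
    qed (use growth s in \<open>auto simp: exp_growth_def\<close>)
    also have "\<dots> = B * exp ((norm w + c) * s)"
      by (simp add: exp_add[symmetric] algebra_simps)
    finally show "(\<Sum>p<N. norm (f p (of_real s * u))) \<le> B * exp ((norm w + c) * s)" .
  qed
  then show ?thesis
    by (simp only: suminf laplace_ray_exp_mult) (simp only: f_def[abs_def] laplace_ray_cmult)
qed

lemma holomorphic_laplace_ray:
  assumes g: "g holomorphic_on U" and growth: "exp_growth u B c g"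
  shows "laplace_ray u g holomorphic_on {z. c < Re (z * u)}"
proof -
  have "laplace_ray u g field_differentiable at z within {z. c < Re (z * u)}" if z: "c < Re (z * u)" for z
  proof -
    \<comment> \<open>The distance from \<open>z\<close> to the edge of the half-plane, as |u| = 1:
      the Taylor series converges in the largest disc that fits.\<close>
    define r where "r = Re (z * u) - c"
    have "laplace_ray u g holomorphic_on ball z r"
    proof (rule power_series_holomorphic)
      fix w assume "w \<in> ball z r"
      then have "norm (w - z) < Re (z * u) - c" by (simp add: r_def dist_norm norm_minus_commute)
      from laplace_ray_shift_sums[OF g growth this]
      show "(\<lambda>p. 1 / fact p * laplace_ray u (\<lambda>\<zeta>. (- \<zeta>) ^ p * g \<zeta>) z * (w - z) ^ p) sums laplace_ray u g w"
        by (simp add: mult_ac)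
    qed
    moreover have "z \<in> ball z r" using z by (simp add: r_def)
    ultimately show ?thesis
      using holomorphic_on_imp_differentiable_at field_differentiable_at_within open_ball by blast
  qed
  then show ?thesis by (simp add: holomorphic_on_def)
qed

section \<open>The two composition series under the Laplace integral\<close>

lemma exp_growth_ray_bound:
  assumes "exp_growth u A c f" "0 \<le> s"
  shows "ray_bound A c f (of_real s * u)"
  unfolding ray_bound_def
proof (intro conjI ballI)
  fix t :: real assume t: "t \<in> {0..1}"
  then have "0 \<le> t * s" using assms by simp
  then have "norm (f (of_real (t * s) * u)) \<le> A * exp (c * (t * s))"
    using assms unfolding exp_growth_def by blast
  then show "norm (f (of_real t * (of_real s * u))) \<le> A * exp (c * (t * norm (of_real s * u)))"
    using assms by (simp add: norm_mult norm_u mult.assoc)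
qed (use exp_growth_nonneg[OF assms(1)] in simp)

lemma laplace_ok_conv_power:
  assumes f: "f holomorphic_on U" and A: "exp_growth u A c f" and c: "c < Re (z * u)"
  shows "laplace_ok u z (borel_conv_power f p)"
proof (rule laplace_ok_polynomial_growth[OF c])
  fix s :: real assume s: "0 \<le> s"
  show "norm (borel_conv_power f p (of_real s * u)) \<le> A ^ Suc p / fact p * s ^ p * exp (c * s)"
    using norm_borel_conv_power_le[OF f ray[OF s] exp_growth_ray_bound[OF A s]] s
    by (simp add: norm_mult norm_u)
qed (use exp_growth_nonneg[OF A] in simp)

lemma laplace_ray_conv_power:
  assumes f: "f holomorphic_on U" and A: "exp_growth u A c f" and c: "c < Re (z * u)"
  shows "laplace_ray u (borel_conv_power f p) z = laplace_ray u f z ^ Suc p"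
proof (induction p)
  case (Suc p)
  have "laplace_ok u z f" using A c by (auto simp: laplace_ok_def)
  with Suc laplace_ok_conv_power[OF assms] show ?case
    by (simp add: laplace_ray_conv f holomorphic_borel_conv_power)
qed simp

lemma laplace_ray_shift_term:
  assumes f: "f holomorphic_on U" and A: "exp_growth u A c f" and g: "g holomorphic_on U"
    and B: "exp_growth u B c g" and c: "c < Re (z * u)"
  shows "laplace_ray u (shift_term f g p) z = laplace_ray u f z ^ p * laplace_ray u (\<lambda>\<zeta>. (- \<zeta>) ^ p * g \<zeta>) z"
proof (cases p)
  case (Suc q)
  have "laplace_ok u z (\<lambda>\<zeta>. (- \<zeta>) ^ p * g \<zeta>)"
  proof (rule laplace_ok_polynomial_growth[OF c])
    fix s :: real assume s: "0 \<le> s"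
    with B have "s ^ p * norm (g (of_real s * u)) \<le> s ^ p * (B * exp (c * s))"
      by (intro mult_left_mono) (auto simp: exp_growth_def)
    with s show "norm ((- (of_real s * u)) ^ p * g (of_real s * u)) \<le> B * s ^ p * exp (c * s)"
      by (simp add: norm_mult norm_power norm_u mult_ac)
  qed (use exp_growth_nonneg[OF B] in simp)
  moreover have "(\<lambda>\<zeta>. (- \<zeta>) ^ p * g \<zeta>) holomorphic_on U"
    by (intro holomorphic_intros g)
  ultimately show ?thesis
    using laplace_ray_conv[OF holomorphic_borel_conv_power[OF f] _ laplace_ok_conv_power[OF f A c]]
      laplace_ray_conv_power[OF f A c, of q]
    by (simp add: Suc)
qed simp

lemma sum_norm_shift_term_le:
  assumes f: "f holomorphic_on U" and A: "exp_growth u A c f" and g: "g holomorphic_on U"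
    and B: "exp_growth u B c g" and s: "0 \<le> s"
  shows "(\<Sum>p<N. norm (1 / fact p * shift_term f g p (of_real s * u))) \<le> B * exp ((c + sqrt A) * s)"
proof -
  note A0 = exp_growth_nonneg[OF A] and B0 = exp_growth_nonneg[OF B]
  have "(\<Sum>p<N. norm (1 / fact p * shift_term f g p (of_real s * u)))
      \<le> (\<Sum>p<N. (sqrt A * s) ^ (2 * p) / fact (2 * p) * (B * exp (c * s)))"
  proof (rule sum_mono)
    fix p
    have "norm (1 / fact p * shift_term f g p (of_real s * u))
      \<le> A ^ p * B * norm (of_real s * u) ^ (2 * p) / fact (2 * p) * exp (c * norm (of_real s * u))"
      using A B s by (intro norm_shift_term_le f g ray exp_growth_ray_bound)
    also have "\<dots> = (sqrt A * s) ^ (2 * p) / fact (2 * p) * (B * exp (c * s))"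
      using A0 s by (simp add: norm_mult norm_u power_mult_distrib power_mult)
    finally show "norm (1 / fact p * shift_term f g p (of_real s * u))
      \<le> (sqrt A * s) ^ (2 * p) / fact (2 * p) * (B * exp (c * s))" .
  qed
  also have "\<dots> \<le> exp (sqrt A * s) * (B * exp (c * s))"
    unfolding sum_distrib_right[symmetric] using A0 B0 s
    by (intro mult_right_mono sum_even_power_le_exp) auto
  also have "\<dots> = B * exp ((c + sqrt A) * s)"
    by (simp add: exp_add[symmetric] algebra_simps)
  finally show ?thesis .
qed

text \<open>Both sides are sums of one series, with terms w^p/p! times the transform of (-
  \<zeta>)^p g, where \<open>w\<close> is the transform of \<open>f\<close>: on the left by
  dominated convergence and the convolution theorem, on the right by Taylor expansion at
  \<open>z\<close>.\<close>

lemma laplace_ray_shift: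
  assumes f: "f holomorphic_on U" and A: "exp_growth u A c f" and g: "g holomorphic_on U"
    and B: "exp_growth u B c g"
    and S: "(\<lambda>z. \<Sum>p. 1 / fact p * shift_term f g p z) holomorphic_on U"
    and c: "c + sqrt A < Re (z * u)" and w: "norm (laplace_ray u f z) < Re (z * u) - c"
  shows "laplace_ray u (\<lambda>z. \<Sum>p. 1 / fact p * shift_term f g p z) z = laplace_ray u g (z + laplace_ray u f z)"
proof (rule sums_unique2)
  have c': "c < Re (z * u)" using c exp_growth_nonneg[OF A] by (smt (verit) real_sqrt_ge_zero)
  have holo: "shift_term f g p holomorphic_on U" for p
    by (cases p) (auto intro!: holomorphic_borel_conv holomorphic_borel_conv_power holomorphic_intros f g)
  show "(\<lambda>p. laplace_ray u (\<lambda>z. 1 / fact p * shift_term f g p z) z) sums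
      laplace_ray u (\<lambda>z. \<Sum>p. 1 / fact p * shift_term f g p z) z"
    by (rule laplace_ray_suminf[OF _ S sum_norm_shift_term_le[OF f A g B] c])
       (intro holomorphic_intros holo)
  show "(\<lambda>p. laplace_ray u (\<lambda>z. 1 / fact p * shift_term f g p z) z) sums
      laplace_ray u g (z + laplace_ray u f z)"
    unfolding laplace_ray_cmult laplace_ray_shift_term[OF f A g B c']
    using laplace_ray_shift_sums[OF g B w] .
qed

lemma sum_norm_subst_term_le:
  assumes f: "f holomorphic_on U" and A: "exp_growth u A c f"
    and h: "\<And>p. norm (h p) \<le> C / \<rho> ^ p" and \<rho>: "0 < \<rho>" and s: "0 \<le> s"
  shows "(\<Sum>p<N. norm (h (Suc p) * borel_conv_power f p (of_real s * u)))
    \<le> C * (A / \<rho>) * exp ((c + inverse \<rho> * A) * s)"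
proof -
  note A0 = exp_growth_nonneg[OF A]
  have C: "0 \<le> C" using h[of 0] by (auto intro: order_trans[OF norm_ge_zero])
  have "(\<Sum>p<N. norm (h (Suc p) * borel_conv_power f p (of_real s * u)))
      \<le> (\<Sum>p<N. C * (A / \<rho>) * (inverse (fact p) * (A / \<rho> * norm (of_real s * u)) ^ p) * exp (c * norm (of_real s * u)))"
    using s by (intro sum_mono norm_subst_term_le f ray exp_growth_ray_bound A h \<rho>)
  also have "\<dots> = C * (A / \<rho>) * (\<Sum>p<N. inverse (fact p) * (A / \<rho> * s) ^ p) * exp (c * s)"
    using s by (simp add: norm_mult norm_u sum_distrib_left sum_distrib_right)
  also have "\<dots> \<le> C * (A / \<rho>) * exp (A / \<rho> * s) * exp (c * s)"
  proof (intro mult_right_mono mult_left_mono)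
    show "(\<Sum>p<N. inverse (fact p) * (A / \<rho> * s) ^ p) \<le> exp (A / \<rho> * s)"
      unfolding exp_def using s A0 \<rho> summable_exp_generic[of "A / \<rho> * s"]
      by (auto intro!: sum_le_suminf)
  qed (use C A0 \<rho> in auto)
  also have "\<dots> = C * (A / \<rho>) * exp ((c + inverse \<rho> * A) * s)"
    by (simp add: exp_add[symmetric] algebra_simps divide_inverse)
  finally show ?thesis .
qed

text \<open>The integral accounts for the powers from 1 on; the term \<open>h 0\<close> stands
  outside because it is the coefficient of \<delta>.\<close>

lemma laplace_ray_subst:
  assumes f: "f holomorphic_on U" and A: "exp_growth u A c f"
    and h: "\<And>p. norm (h p) \<le> C / \<rho> ^ p" and \<rho>: "0 < \<rho>"
    and S: "(\<lambda>z. \<Sum>p. h (Suc p) * borel_conv_power f p z) holomorphic_on U"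
    and c: "c + inverse \<rho> * A < Re (z * u)"
  shows "(\<lambda>p. h p * laplace_ray u f z ^ p) sums (h 0 + laplace_ray u (\<lambda>z. \<Sum>p. h (Suc p) * borel_conv_power f p z) z)"
proof -
  have "0 \<le> inverse \<rho> * A" using \<rho> exp_growth_nonneg[OF A] by simp
  then have c': "c < Re (z * u)" using c by simp
  have "(\<lambda>p. laplace_ray u (\<lambda>z. h (Suc p) * borel_conv_power f p z) z) sums
      laplace_ray u (\<lambda>z. \<Sum>p. h (Suc p) * borel_conv_power f p z) z"
    by (rule laplace_ray_suminf[OF _ S sum_norm_subst_term_le[OF f A h \<rho>] c])
       (intro holomorphic_intros holomorphic_borel_conv_power f)
  then have "(\<lambda>p. h (Suc p) * laplace_ray u f z ^ Suc p) sums
      laplace_ray u (\<lambda>z. \<Sum>p. h (Suc p) * borel_conv_power f p z) z"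
    unfolding laplace_ray_cmult laplace_ray_conv_power[OF f A c'] .
  then show ?thesis
    using sums_Suc_iff[of "\<lambda>p. h p * laplace_ray u f z ^ p"] by (simp add: add.commute)
qed

end

section \<open>Sectors and the independence of the direction\<close>

context star_domain_ray
begin

text \<open>Replaces an integral over a ray by boundary values of a primitive, so that rays in two
  directions can be compared through their far end points.\<close>

lemma laplace_ray_eq_limit:
  assumes f: "f holomorphic_on U" and ok: "laplace_ok u z f"
    and P: "\<And>\<zeta>. \<zeta> \<in> U \<Longrightarrow> (P has_field_derivative exp (- z * \<zeta>) * f \<zeta>) (at \<zeta>)"
  shows "((\<lambda>R. P (of_real R * u) - P 0) \<longlongrightarrow> laplace_ray u f z) at_top"
proof -
  note cont = continuous_laplace_kernel[OF f, of z]
  \<comment> \<open>The point 0 is a null set; passing to the closed half-line fits the truncation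
    to \<open>{0..R}\<close> below.\<close>
  have AE: "AE s in lborel. indicator {0<..} s *\<^sub>R laplace_kernel u f z s
      = indicator {0..} s *\<^sub>R laplace_kernel u f z s"
    using AE_lborel_singleton[of "0::real"] by eventually_elim (auto simp: indicator_def)
  have meas: "(\<lambda>s. indicator {0..} s *\<^sub>R laplace_kernel u f z s) \<in> borel_measurable borel"
    using cont by (intro borel_measurable_continuous_on_indicator) auto
  have int: "set_integrable lborel {0..} (laplace_kernel u f z)"
    using laplace_set_integrable[OF f ok] AE meas laplace_kernel_measurable[OF f]
    unfolding set_integrable_def by (subst integrable_cong_AE[symmetric]) auto
  have eq: "laplace_ray u f z = (LINT s:{0..}|lborel. laplace_kernel u f z s)"
    unfolding laplace_ray_def set_lebesgue_integral_def
    using AE meas laplace_kernel_measurable[OF f] by (intro integral_cong_AE) auto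
  have "((\<lambda>R. LINT s:{0..R}|lborel. laplace_kernel u f z s) \<longlongrightarrow> laplace_ray u f z) at_top"
    unfolding eq by (rule tendsto_set_lebesgue_integral_at_top[OF _ int]) auto
  moreover have "(LINT s:{0..R}|lborel. laplace_kernel u f z s) = P (of_real R * u) - P 0" if R: "0 \<le> R" for R
  proof -
    have "(laplace_kernel u f z has_integral P (of_real R * u) - P (of_real 0 * u)) {0..R}"
    proof (rule fundamental_theorem_of_calculus[OF R])
      fix s :: real assume "s \<in> {0..R}"
      then have "of_real s * u \<in> U" by (auto intro: ray)
      have "((\<lambda>\<zeta>. P (\<zeta> * u)) has_field_derivative (exp (- z * (of_real s * u)) * f (of_real s * u)) * u) (at (of_real s))"
        by (rule DERIV_chain2[where f=P, OF P]) (fact | auto intro!: derivative_eq_intros)+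
      then show "((\<lambda>s. P (of_real s * u)) has_vector_derivative laplace_kernel u f z s) (at s within {0..R})"
        unfolding laplace_kernel_def by (rule has_vector_derivative_real_field)
    qed
    moreover have "set_integrable lborel {0..R} (laplace_kernel u f z)"
      using continuous_on_subset[OF cont, of "{0..R}"] by (intro borel_integrable_atLeastAtMost') auto
    ultimately show ?thesis by (simp add: set_borel_integral_eq_integral(2) integral_unique)
  qed
  ultimately show ?thesis
    by (auto intro: Lim_transform_eventually eventually_mono[OF eventually_ge_at_top[of 0]])
qed

end

text \<open>As the image of a horizontal strip the sector inherits connectedness, and openness by
  the open mapping theorem, also when the strip is so wide that exp is not injective on it.\<close>

lemma sector_eq_exp_image: "sector I = exp ` {w. Im w \<in> I}"
proof (intro equalityI subsetI)
  fix z assume "z \<in> sector I"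
  then obtain \<xi> \<theta> where "\<xi> > 0" "\<theta> \<in> I" "z = rcis \<xi> \<theta>" by (auto simp: sector_def)
  then have "z = exp (Complex (ln \<xi>) \<theta>)" "Complex (ln \<xi>) \<theta> \<in> {w. Im w \<in> I}"
    by (simp_all add: exp_eq_polar rcis_def)
  then show "z \<in> exp ` {w. Im w \<in> I}" by blast
next
  fix z assume "z \<in> exp ` {w. Im w \<in> I}"
  then obtain w where "Im w \<in> I" "z = rcis (exp (Re w)) (Im w)"
    by (auto simp: exp_eq_polar rcis_def)
  then show "z \<in> sector I" unfolding sector_def by force
qed

lemma open_sector: "open I \<Longrightarrow> open (sector I)"
  unfolding sector_eq_exp_image
proof (rule open_mapping_thm[where S=UNIV and f=exp])
  show "\<not> (exp :: complex \<Rightarrow> complex) constant_on UNIV"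
  proof
    assume "(exp :: complex \<Rightarrow> complex) constant_on UNIV"
    then obtain y where "exp x = y" for x :: complex unfolding constant_on_def by auto
    from this[of 0] this[of "of_real pi * \<i>"] have "exp (0::complex) = exp (of_real pi * \<i>)" by simp
    then show False by (simp add: exp_pi_i)
  qed
  show "open {w. Im w \<in> I}" if "open I"
    using open_vimage[OF that, of Im] by (simp add: vimage_def continuous_intros)
qed (auto intro!: holomorphic_intros)

lemma connected_sector: "is_interval I \<Longrightarrow> connected (sector I)"
  unfolding sector_eq_exp_image
  using convex_linear_vimage[OF bounded_linear.linear[OF bounded_linear_Im], of I]
  by (intro connected_continuous_image continuous_intros convex_connected)
     (simp add: is_interval_convex vimage_def)

lemma ray_in_sector: "\<theta> \<in> I \<Longrightarrow> 0 < s \<Longrightarrow> of_real s * cis \<theta> \<in> sector I"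
  unfolding sector_def rcis_def by blast

text \<open>Both extensions agree with the germ on a nonempty open set near 0, and the identity
  theorem spreads this over the connected sector. Hence the choice made in \<open>borel_ext\<close>
  is immaterial.\<close>

lemma extends_to_sector_unique:
  assumes I: "open I" "is_interval I" and F: "extends_to_sector I g F" and G: "extends_to_sector I g G"
    and z: "z \<in> sector I"
  shows "F z = G z"
proof -
  obtain r where r: "r > 0" "\<And>\<zeta>. \<zeta> \<in> sector I \<Longrightarrow> norm \<zeta> < r \<Longrightarrow> F \<zeta> = eval_fps g \<zeta>"
    using F by (auto simp: extends_to_sector_def)
  obtain r' where r': "r' > 0" "\<And>\<zeta>. \<zeta> \<in> sector I \<Longrightarrow> norm \<zeta> < r' \<Longrightarrow> G \<zeta> = eval_fps g \<zeta>"
    using G by (auto simp: extends_to_sector_def)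
  define S where "S = sector I \<inter> ball 0 (min r r')"
  obtain \<theta> where "\<theta> \<in> I" using z by (auto simp: sector_def)
  then have "of_real (min r r' / 2) * cis \<theta> \<in> S"
    using r(1) r'(1) ray_in_sector[of \<theta> I "min r r' / 2"]
    by (auto simp: S_def norm_mult simp del: of_real_divide)
  then have "S \<noteq> {}" by blast
  show ?thesis
  proof (rule analytic_continuation_open[of S "sector I" F G])
    show "open S" unfolding S_def using open_sector[OF I(1)] by auto
    show "F \<zeta> = G \<zeta>" if "\<zeta> \<in> S" for \<zeta> using that r(2) r'(2) by (auto simp: S_def)
  qed (use \<open>S \<noteq> {}\<close> F G z I open_sector connected_sector
    in \<open>auto simp: S_def extends_to_sector_def\<close>)
qed

text \<open>The disc of the germ supplies the vertex 0: the union is open and star-shaped, contains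
  the closed rays, and Taylor coefficients at 0 make sense on it.\<close>

definition germ_domain :: "real set \<Rightarrow> real \<Rightarrow> complex set" where
  "germ_domain I r = sector I \<union> ball 0 r"

lemma star_domain_germ_domain:
  assumes "open I" "0 < r"
  shows "star_domain (germ_domain I r)"
proof
  show "open (germ_domain I r)" using open_sector[OF assms(1)] by (auto simp: germ_domain_def)
  show "0 \<in> germ_domain I r" using assms(2) by (simp add: germ_domain_def)
  fix z :: complex and t :: real assume z: "z \<in> germ_domain I r" and t: "0 \<le> t" "t \<le> 1"
  show "of_real t * z \<in> germ_domain I r"
  proof (cases "z \<in> ball 0 r \<or> t = 0")
    case True
    have "t * norm z \<le> norm z" using t by (simp add: mult_left_le_one_le)
    then show ?thesis using True assms(2) t by (auto simp: germ_domain_def norm_mult)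
  next
    case False
    then obtain \<xi> \<theta> where "\<xi> > 0" "\<theta> \<in> I" "z = rcis \<xi> \<theta>"
      using z by (auto simp: germ_domain_def sector_def)
    with False t ray_in_sector[of \<theta> I "t * \<xi>"] show ?thesis
      by (simp add: germ_domain_def rcis_def mult.assoc)
  qed
qed

lemma star_domain_ray_germ_domain:
  assumes "open I" "0 < r" "\<theta> \<in> I"
  shows "star_domain_ray (germ_domain I r) (cis \<theta>)"
proof -
  interpret star_domain "germ_domain I r" by (rule star_domain_germ_domain[OF assms(1,2)])
  show ?thesis
  proof
    show "of_real s * cis \<theta> \<in> germ_domain I r" if "0 \<le> s" for s
    proof (cases "s = 0")
      case True
      with assms show ?thesis by (simp add: germ_domain_def)
    qed (use that ray_in_sector[OF assms(3)] in \<open>auto simp: germ_domain_def\<close>)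
  qed simp
qed

text \<open>Germ and continuation are glued to one function \<open>F\<close>, with the bounds
  extended to the vertex. This frees the sequel from the existential in \<open>NN_bound\<close> and
  from the choice in \<open>borel_ext\<close>.\<close>

definition borel_model ::
    "real set \<Rightarrow> real \<Rightarrow> (real \<Rightarrow> real) \<Rightarrow> (real \<Rightarrow> real) \<Rightarrow> complex fps \<Rightarrow> (complex \<Rightarrow> complex) \<Rightarrow> bool" where
  "borel_model I r \<gamma> \<alpha> f F \<longleftrightarrow> open I \<and> is_interval I \<and> 0 < r \<and>
     star_domain.borel_rep (germ_domain I r) F f \<and>
     (\<forall>\<theta>\<in>I. exp_growth (cis \<theta>) (\<alpha> \<theta>) (\<gamma> \<theta>) F)"

lemma borel_model_iff:
  "borel_model I r \<gamma> \<alpha> f F \<longleftrightarrow> open I \<and> is_interval I \<and> 0 < r \<and>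
     F holomorphic_on germ_domain I r \<and> (\<forall>n. (deriv ^^ n) F 0 = fps_nth f (Suc n)) \<and>
     (\<forall>\<theta>\<in>I. exp_growth (cis \<theta>) (\<alpha> \<theta>) (\<gamma> \<theta>) F)"
  unfolding borel_model_def
  using star_domain.borel_rep_def[OF star_domain_germ_domain, of I r F f] by blast

lemma borel_model_holomorphic: "borel_model I r \<gamma> \<alpha> f F \<Longrightarrow> F holomorphic_on germ_domain I r"
  by (simp add: borel_model_iff)

lemma borel_model_growth: "borel_model I r \<gamma> \<alpha> f F \<Longrightarrow> \<theta> \<in> I \<Longrightarrow> exp_growth (cis \<theta>) (\<alpha> \<theta>) (\<gamma> \<theta>) F"
  by (simp add: borel_model_def)

lemma borel_model_shrink:
  assumes "borel_model I r \<gamma> \<alpha> f F" "0 < r'" "r' \<le> r"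
  shows "borel_model I r' \<gamma> \<alpha> f F"
proof -
  have "F holomorphic_on germ_domain I r'"
    using borel_model_holomorphic[OF assms(1)]
    by (rule holomorphic_on_subset) (use assms in \<open>auto simp: germ_domain_def\<close>)
  then show ?thesis
    using assms by (simp add: borel_model_iff)
qed

text \<open>A model does not see the constant term, so \<phi> and a + \<phi> share theirs.\<close>

lemma borel_model_cong:
  assumes "borel_model I r \<gamma> \<alpha> f F" "\<And>n. fps_nth g (Suc n) = fps_nth f (Suc n)"
  shows "borel_model I r \<gamma> \<alpha> g F"
  using assms by (simp add: borel_model_iff)

lemma borel_model_exists:
  assumes I: "open I" "is_interval I" and f: "snd (borel_transform f) \<in> NN_bound I \<gamma> \<alpha>"
  obtains r F where "borel_model I r \<gamma> \<alpha> f F"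
proof -
  define g where "g = snd (borel_transform f)"
  obtain F where g: "fps_conv_radius g > 0" and F: "extends_to_sector I g F"
    and bound: "\<And>\<theta> \<xi>. \<theta> \<in> I \<Longrightarrow> \<xi> > 0 \<Longrightarrow> norm (F (rcis \<xi> \<theta>)) \<le> \<alpha> \<theta> * exp (\<gamma> \<theta> * \<xi>)"
    using f by (auto simp: NN_bound_def g_def)
  obtain r0 where r0: "r0 > 0" "\<And>\<zeta>. \<zeta> \<in> sector I \<Longrightarrow> norm \<zeta> < r0 \<Longrightarrow> F \<zeta> = eval_fps g \<zeta>"
    using F by (auto simp: extends_to_sector_def)
  \<comment> \<open>A radius within which the germ converges and agrees with \<open>F\<close>, so
    that the two cases in the definition of \<open>G\<close> match on the overlap.\<close>
  obtain r where r: "0 < r" "r \<le> r0" "ereal r \<le> fps_conv_radius g"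
  proof -
    obtain q where "0 < ereal q" "ereal q < fps_conv_radius g"
      using ereal_dense2[OF g] by auto
    then have "ereal (min q r0) \<le> fps_conv_radius g"
      using less_imp_le[OF \<open>ereal q < fps_conv_radius g\<close>] by (simp add: min.coboundedI1)
    with \<open>0 < ereal q\<close> r0(1) that[of "min q r0"] show ?thesis by simp
  qed
  define G where "G \<zeta> = (if \<zeta> \<in> sector I then F \<zeta> else eval_fps g \<zeta>)" for \<zeta>
  have G_ball: "G \<zeta> = eval_fps g \<zeta>" if "\<zeta> \<in> ball 0 r" for \<zeta>
    using that r0(2) r by (auto simp: G_def)
  interpret star_domain "germ_domain I r"
    by (rule star_domain_germ_domain[OF I(1) r(1)])
  have "G holomorphic_on ball 0 r"
  proof (rule holomorphic_transform)
    show "eval_fps g holomorphic_on ball 0 r"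
    proof (intro holomorphic_on_eval_fps subsetI)
      fix x :: complex assume "x \<in> ball 0 r"
      then have "ereal (norm x) < ereal r" by simp
      also note r(3)
      finally show "x \<in> eball 0 (fps_conv_radius g)" by simp
    qed
  qed (use G_ball in auto)
  moreover have "G holomorphic_on sector I"
    using F by (auto simp: extends_to_sector_def G_def[abs_def] intro: holomorphic_transform)
  ultimately have holo: "G holomorphic_on germ_domain I r"
    unfolding germ_domain_def using open_sector[OF I(1)] by (intro holomorphic_on_Un) auto
  have "\<forall>\<^sub>F \<zeta> in nhds 0. eval_fps g \<zeta> = G \<zeta>"
    using r(1) by (intro eventually_nhds[THEN iffD2] exI[of _ "ball 0 r"]) (auto simp: G_ball)
  then have "G has_fps_expansion g" using g by (simp add: has_fps_expansion_def)
  from fps_nth_fps_expansion[OF this] have "(deriv ^^ n) G 0 = fps_nth f (Suc n)" for n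
    by (simp add: g_def borel_transform_def)
  with holo have "borel_rep G f" by (simp add: borel_rep_def)
  moreover have "exp_growth (cis \<theta>) (\<alpha> \<theta>) (\<gamma> \<theta>) G" if \<theta>: "\<theta> \<in> I" for \<theta>
    unfolding exp_growth_def
  proof (intro allI impI)
    interpret star_domain_ray "germ_domain I r" "cis \<theta>"
      by (rule star_domain_ray_germ_domain[OF I(1) r(1) \<theta>])
    have pos: "norm (G (of_real s * cis \<theta>)) \<le> \<alpha> \<theta> * exp (\<gamma> \<theta> * s)" if "0 < s" for s
      using bound[OF \<theta> that] ray_in_sector[OF \<theta> that] by (simp add: G_def rcis_def)
    fix s :: real assume s: "0 \<le> s"
    show "norm (G (of_real s * cis \<theta>)) \<le> \<alpha> \<theta> * exp (\<gamma> \<theta> * s)"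
    proof (cases "s = 0")
      case True
      \<comment> \<open>\<open>NN_bound\<close> gives the bound for positive radii; at the vertex it
        follows by letting \<open>s\<close> tend to 0 from the right.\<close>
      have "continuous_on {0..} (\<lambda>s. norm (G (of_real s * cis \<theta>)))"
        by (intro continuous_intros continuous_on_compose2[OF holomorphic_on_imp_continuous_on[OF holo]])
           (auto intro: ray)
      then have "((\<lambda>s. norm (G (of_real s * cis \<theta>))) \<longlongrightarrow> norm (G (of_real 0 * cis \<theta>))) (at 0 within {0..})"
        unfolding continuous_on_def by (rule bspec) simp
      then have 1: "((\<lambda>s. norm (G (of_real s * cis \<theta>))) \<longlongrightarrow> norm (G (of_real 0 * cis \<theta>))) (at_right 0)"
        by (rule tendsto_within_subset) auto
      have 2: "((\<lambda>s. \<alpha> \<theta> * exp (\<gamma> \<theta> * s)) \<longlongrightarrow> \<alpha> \<theta> * exp (\<gamma> \<theta> * 0)) (at_right 0)"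
        by (intro tendsto_intros)
      have "norm (G (of_real 0 * cis \<theta>)) \<le> \<alpha> \<theta> * exp (\<gamma> \<theta> * 0)"
        by (rule tendsto_le[OF _ 2 1]) (auto simp: eventually_at_right_less pos intro!: eventually_mono[OF eventually_at_right_less[of 0]])
      with True show ?thesis by simp
    qed (use s pos in auto)
  qed
  ultimately show ?thesis using that I r(1) unfolding borel_model_def by blast
qed

text \<open>The Taylor series of \<open>F\<close> at 0 is the Borel transform, and holomorphy on the
  disc of radius \<open>r\<close> makes it converge there to \<open>F\<close>.\<close>

lemma borel_model_extends:
  assumes "borel_model I r \<gamma> \<alpha> f F"
  shows "fps_conv_radius (snd (borel_transform f)) > 0" "extends_to_sector I (snd (borel_transform f)) F"
proof -
  define g where "g = snd (borel_transform f)"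
  have I: "open I" and r: "0 < r" using assms by (auto simp: borel_model_def)
  have holo: "F holomorphic_on germ_domain I r" by (rule borel_model_holomorphic[OF assms])
  have "fps_expansion F 0 = g"
    using assms by (simp add: fps_expansion_def g_def borel_transform_def borel_model_iff)
  moreover have b: "F holomorphic_on eball 0 (ereal r)"
    using holo by (rule holomorphic_on_subset) (auto simp: germ_domain_def)
  ultimately have "ereal r \<le> fps_conv_radius g"
    using conv_radius_fps_expansion[OF b] by simp
  then show "fps_conv_radius (snd (borel_transform f)) > 0"
    unfolding g_def[symmetric] using r by (simp add: less_le_trans[of 0 "ereal r"])
  have "\<forall>\<zeta>\<in>sector I. norm \<zeta> < r \<longrightarrow> F \<zeta> = eval_fps g \<zeta>"
    using eval_fps_expansion'[OF b] unfolding \<open>fps_expansion F 0 = g\<close> by simp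
  moreover have "F holomorphic_on sector I"
    using holo by (rule holomorphic_on_subset) (auto simp: germ_domain_def)
  ultimately show "extends_to_sector I (snd (borel_transform f)) F"
    using r by (auto simp: extends_to_sector_def g_def)
qed

lemma borel_model_NN_bound:
  assumes "borel_model I r \<gamma> \<alpha> f F"
  shows "snd (borel_transform f) \<in> NN_bound I \<gamma> \<alpha>"
proof -
  have "norm (F (rcis \<xi> \<theta>)) \<le> \<alpha> \<theta> * exp (\<gamma> \<theta> * \<xi>)" if "\<theta> \<in> I" "\<xi> > 0" for \<theta> \<xi>
    using borel_model_growth[OF assms that(1)] that by (auto simp: exp_growth_def rcis_def)
  with borel_model_extends[OF assms] show ?thesis unfolding NN_bound_def by blast
qed

text \<open>By uniqueness of the extension, the chosen \<open>borel_ext\<close> coincides with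
  \<open>F\<close> on the open ray, which is all that the integral sees.\<close>

lemma laplace_dir_eq_laplace_ray:
  assumes "borel_model I r \<gamma> \<alpha> f F" and \<theta>: "\<theta> \<in> I"
  shows "laplace_dir I \<theta> f z = fps_nth f 0 + laplace_ray (cis \<theta>) F z"
proof -
  have I: "open I" "is_interval I" using assms by (auto simp: borel_model_def)
  note F = borel_model_extends(2)[OF assms(1)]
  have "extends_to_sector I (snd (borel_transform f)) (borel_ext I f)"
    unfolding borel_ext_def by (rule someI[of "extends_to_sector I (snd (borel_transform f))", OF F])
  from extends_to_sector_unique[OF I this F]
  have "borel_ext I f (rcis \<xi> \<theta>) = F (rcis \<xi> \<theta>)" if "0 < \<xi>" for \<xi>
    using ray_in_sector[OF \<theta> that] by (simp add: rcis_def)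
  then have "(LINT \<xi>:{0<..}|lborel. exp (- z * rcis \<xi> \<theta>) * borel_ext I f (rcis \<xi> \<theta>) * cis \<theta>)
      = laplace_ray (cis \<theta>) F z"
    unfolding laplace_ray_def
    by (intro set_lebesgue_integral_cong) (auto simp: laplace_kernel_def rcis_def)
  then show ?thesis by (simp add: laplace_dir_def borel_transform_def)
qed

section \<open>Rotation of the direction of integration\<close>

lemma locally_bounded_on_iff:
  "locally_bounded_on I g \<longleftrightarrow> (\<forall>s t. {s..t} \<subseteq> I \<longrightarrow> (\<exists>M. \<forall>x\<in>{s..t}. \<bar>g x\<bar> \<le> M))"
  by (auto simp: locally_bounded_on_def bounded_iff)

lemma open_half_plane: "open (half_plane \<theta> c)"
  unfolding half_plane_def by (intro open_Collect_less continuous_intros)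

lemma convex_half_plane: "convex (half_plane \<theta> c)"
proof -
  have "half_plane \<theta> c = (\<lambda>z. z * cis \<theta>) -` {z. Re z > c}" by (auto simp: half_plane_def)
  then show ?thesis
    using convex_linear_vimage[OF bounded_linear.linear[OF bounded_linear_mult_left[of "cis \<theta>"]] convex_halfspace_Re_gt[of c]]
    by (simp only:)
qed

lemma holomorphic_laplace_ray_model:
  assumes "borel_model I r \<gamma> \<alpha> f F" "\<theta> \<in> I"
  shows "laplace_ray (cis \<theta>) F holomorphic_on half_plane \<theta> (\<gamma> \<theta>)"
proof -
  interpret star_domain_ray "germ_domain I r" "cis \<theta>"
    using assms by (intro star_domain_ray_germ_domain) (auto simp: borel_model_def)
  show ?thesis
    unfolding half_plane_def
    by (rule holomorphic_laplace_ray[OF borel_model_holomorphic[OF assms(1)] borel_model_growth[OF assms]])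
qed

text \<open>A primitive of \<open>exp (- z \<zeta>) F \<zeta>\<close> on the germ domain reduces the difference of the two
  integrals to the increment of this primitive along an arc of large radius.\<close>

lemma laplace_ray_rotate_far:
  assumes model: "borel_model I r \<gamma> \<alpha> f F" and \<theta>: "\<theta>1 \<in> I" "\<theta>2 \<in> I" "\<theta>1 \<le> \<theta>2"
    and bounds: "\<And>\<theta>. \<theta> \<in> {\<theta>1..\<theta>2} \<Longrightarrow> \<gamma> \<theta> \<le> C \<and> \<alpha> \<theta> \<le> A \<and> C + 1 \<le> Re (z * cis \<theta>)"
  shows "laplace_ray (cis \<theta>1) F z = laplace_ray (cis \<theta>2) F z"
proof -
  have I: "open I" "is_interval I" and r: "0 < r" using model by (auto simp: borel_model_def)
  have sub: "{\<theta>1..\<theta>2} \<subseteq> I" using mem_is_interval_1_I[OF I(2) \<theta>(1,2)] by auto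
  have holo: "F holomorphic_on germ_domain I r" by (rule borel_model_holomorphic[OF model])
  interpret star_domain "germ_domain I r" by (rule star_domain_germ_domain[OF I(1) r])
  define h where "h \<zeta> = exp (- z * \<zeta>) * F \<zeta>" for \<zeta>
  have h: "h holomorphic_on germ_domain I r"
    unfolding h_def by (intro holomorphic_intros holo)
  \<comment> \<open>Cauchy's theorem enters here: on a star-shaped domain a holomorphic function has
    a primitive.\<close>
  have "\<exists>P. \<forall>\<zeta>\<in>germ_domain I r. (P has_field_derivative h \<zeta>) (at \<zeta>)"
    by (rule holomorphic_starlike_primitive[where k="{}"])
       (use h open_U starlike_U in \<open>auto intro: holomorphic_on_imp_continuous_on holomorphic_on_imp_differentiable_at\<close>)
  then obtain P where P: "\<And>\<zeta>. \<zeta> \<in> germ_domain I r \<Longrightarrow> (P has_field_derivative h \<zeta>) (at \<zeta>)"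
    by blast
  have growth: "exp_growth (cis \<theta>) A C F" if "\<theta> \<in> {\<theta>1..\<theta>2}" for \<theta>
    using exp_growth_mono[OF borel_model_growth[OF model]] that bounds[OF that] sub by (auto simp: subset_iff)
  have A: "0 \<le> A" using growth[of \<theta>1] \<theta> exp_growth_nonneg by auto
  have lim: "((\<lambda>R. P (of_real R * cis \<theta>) - P 0) \<longlongrightarrow> laplace_ray (cis \<theta>) F z) at_top"
    if t: "\<theta> \<in> {\<theta>1..\<theta>2}" for \<theta>
  proof -
    interpret star_domain_ray "germ_domain I r" "cis \<theta>"
      using sub t by (intro star_domain_ray_germ_domain I r) auto
    have "C < Re (z * cis \<theta>)" using bounds[OF t] by linarith
    then have "laplace_ok (cis \<theta>) z F" using growth[OF t] unfolding laplace_ok_def by blast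
    then show ?thesis by (rule laplace_ray_eq_limit[OF holo]) (use P in \<open>simp add: h_def\<close>)
  qed
  \<comment> \<open>The margin 1 between \<open>C\<close> and Re (z exp(i \<theta>)) leaves exp (-
    R) against an arc of length R (\<theta>2 - \<theta>1). The form \<open>R ^ 1\<close> has the
    shape of \<open>tendsto_power_div_exp_0\<close>.\<close>
  have arc: "norm (P (of_real R * cis \<theta>2) - P (of_real R * cis \<theta>1)) \<le> A * (\<theta>2 - \<theta>1) * (R ^ 1 / exp R)"
    if R: "0 < R" for R
  proof -
    define p' where "p' t = h (of_real R * cis t) * (of_real R * (\<i> * cis t))" for t
    have "(p' has_integral P (of_real R * cis \<theta>2) - P (of_real R * cis \<theta>1)) {\<theta>1..\<theta>2}"
    proof (rule fundamental_theorem_of_calculus[OF \<theta>(3)])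
      fix t assume t: "t \<in> {\<theta>1..\<theta>2}"
      then have "of_real R * cis t \<in> germ_domain I r"
        using ray_in_sector[of t I R] R sub by (auto simp: germ_domain_def)
      moreover have "((\<lambda>w. of_real R * exp (\<i> * w)) has_field_derivative of_real R * (\<i> * cis t)) (at (of_real t))"
        unfolding cis_conv_exp by (auto intro!: derivative_eq_intros)
      ultimately have "((\<lambda>w. P (of_real R * exp (\<i> * w))) has_field_derivative p' t) (at (of_real t))"
        unfolding p'_def cis_conv_exp by (intro DERIV_chain2[where f=P] P)
      then show "((\<lambda>t. P (of_real R * cis t)) has_vector_derivative p' t) (at t within {\<theta>1..\<theta>2})"
        unfolding cis_conv_exp by (rule has_vector_derivative_real_field)
    qed
    moreover have "norm (p' t) \<le> A * R / exp R" if t: "t \<in> {\<theta>1..\<theta>2}" for t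
    proof -
      have "norm (h (of_real R * cis t)) = exp (- (R * Re (z * cis t))) * norm (F (of_real R * cis t))"
        by (simp add: h_def norm_mult algebra_simps)
      also have "\<dots> \<le> exp (- (R * (C + 1))) * (A * exp (C * R))"
        using bounds[OF t] growth[OF t] R
        by (intro mult_mono) (auto simp: exp_growth_def intro!: mult_left_mono)
      also have "\<dots> = A * exp (- R)"
      proof -
        have "exp (- (R * (C + 1))) * exp (C * R) = exp (- R)"
          unfolding exp_add[symmetric] by (simp add: algebra_simps)
        then show ?thesis by (simp add: mult.left_commute)
      qed
      also have "\<dots> = A / exp R"
        by (simp add: exp_minus divide_inverse)
      finally have "norm (h (of_real R * cis t)) * R \<le> A / exp R * R"
        using R by (intro mult_right_mono) auto
      then show ?thesis using R by (simp add: p'_def norm_mult)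
    qed
    ultimately have "norm (P (of_real R * cis \<theta>2) - P (of_real R * cis \<theta>1)) \<le> (A * R / exp R) * measure lborel {\<theta>1..\<theta>2}"
      using A R by (intro has_integral_bound_real[where S="{}"]) auto
    then show ?thesis using \<theta> by (simp add: mult_ac)
  qed
  have "((\<lambda>R. A * (\<theta>2 - \<theta>1) * (R ^ 1 / exp R)) \<longlongrightarrow> A * (\<theta>2 - \<theta>1) * 0) at_top"
    by (intro tendsto_mult_left tendsto_power_div_exp_0)
  then have "((\<lambda>R. P (of_real R * cis \<theta>2) - P (of_real R * cis \<theta>1)) \<longlongrightarrow> 0) at_top"
    using Lim_null_comparison[OF eventually_mono[OF eventually_gt_at_top[of 0] arc]] by simp
  moreover have "((\<lambda>R. P (of_real R * cis \<theta>2) - P (of_real R * cis \<theta>1)) \<longlongrightarrow>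
      laplace_ray (cis \<theta>2) F z - laplace_ray (cis \<theta>1) F z) at_top"
    using tendsto_diff[OF lim lim, of \<theta>2 \<theta>1] \<theta> by simp
  ultimately have "laplace_ray (cis \<theta>2) F z - laplace_ray (cis \<theta>1) F z = 0"
    using tendsto_unique[OF trivial_limit_at_top_linorder] by blast
  then show ?thesis by simp
qed

text \<open>Since \<theta>1 and \<theta>2 deviate from their bisector by less than pi/2, all
  half-planes between them contain a common disc far away, where
  \<open>laplace_ray_rotate_far\<close> applies. The identity theorem carries the equality to
  \<open>z\<close> inside the convex intersection of the two outer half-planes.\<close>

lemma laplace_ray_rotate:
  assumes model: "borel_model I r \<gamma> \<alpha> f F" and lb: "locally_bounded_on I \<gamma>" "locally_bounded_on I \<alpha>"
    and \<theta>: "\<theta>1 \<in> I" "\<theta>2 \<in> I" "\<theta>1 \<le> \<theta>2" "\<theta>2 - \<theta>1 < pi"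
    and z: "z \<in> half_plane \<theta>1 (\<gamma> \<theta>1)" "z \<in> half_plane \<theta>2 (\<gamma> \<theta>2)"
  shows "laplace_ray (cis \<theta>1) F z = laplace_ray (cis \<theta>2) F z"
proof -
  have sub: "{\<theta>1..\<theta>2} \<subseteq> I" using model mem_is_interval_1_I[OF _ \<theta>(1,2)] by (auto simp: borel_model_def)
  obtain C where C: "\<And>\<theta>. \<theta> \<in> {\<theta>1..\<theta>2} \<Longrightarrow> \<bar>\<gamma> \<theta>\<bar> \<le> C"
    using lb(1) sub unfolding locally_bounded_on_iff by blast
  obtain A where A: "\<And>\<theta>. \<theta> \<in> {\<theta>1..\<theta>2} \<Longrightarrow> \<bar>\<alpha> \<theta>\<bar> \<le> A"
    using lb(2) sub unfolding locally_bounded_on_iff by blast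
  \<comment> \<open>K cos \<delta> = C + 2 provides 1 for the radius of the disc and 1 for the decay
    on the arcs. The centre \<open>z0\<close> has angle - m because half-planes are given by Re (z
    exp(i \<theta>)).\<close>
  define m \<delta> K where "m = (\<theta>1 + \<theta>2) / 2" and "\<delta> = (\<theta>2 - \<theta>1) / 2" and "K = (C + 2) / cos \<delta>"
  define z0 where "z0 = of_real K * cis (- m)"
  have C0: "0 \<le> C" using C[of \<theta>1] \<theta> by auto
  have \<delta>: "0 \<le> \<delta>" "\<delta> < pi / 2" using \<theta> by (auto simp: \<delta>_def)
  then have cos: "0 < cos \<delta>" by (intro cos_gt_zero_pi) auto
  have K: "0 \<le> K" "K * cos \<delta> = C + 2" using C0 cos by (auto simp: K_def)
  have far: "C + 1 \<le> Re (w * cis \<theta>)" if w: "w \<in> ball z0 1" and t: "\<theta> \<in> {\<theta>1..\<theta>2}" for w \<theta>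
  proof -
    have "cos \<delta> \<le> cos \<bar>\<theta> - m\<bar>"
      using t \<delta> by (intro cos_monotone_0_pi_le) (auto simp: m_def \<delta>_def abs_le_iff field_simps)
    then have "C + 2 \<le> K * cos (\<theta> - m)"
      using K mult_left_mono[of "cos \<delta>" "cos (\<theta> - m)" K] by simp
    moreover have "z0 * cis \<theta> = of_real K * cis (\<theta> - m)"
      by (simp add: z0_def cis_mult mult.assoc)
    then have "Re (z0 * cis \<theta>) = K * cos (\<theta> - m)" by simp
    moreover have "\<bar>Re ((w - z0) * cis \<theta>)\<bar> \<le> norm (w - z0)"
      using abs_Re_le_cmod[of "(w - z0) * cis \<theta>"] by (simp add: norm_mult)
    moreover have "Re ((w - z0) * cis \<theta>) = Re (w * cis \<theta>) - Re (z0 * cis \<theta>)"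
      by (simp add: algebra_simps)
    ultimately show ?thesis using w by (simp add: dist_norm norm_minus_commute abs_le_iff)
  qed
  let ?S = "half_plane \<theta>1 (\<gamma> \<theta>1) \<inter> half_plane \<theta>2 (\<gamma> \<theta>2)"
  have holo: "laplace_ray (cis \<theta>) F holomorphic_on half_plane \<theta> (\<gamma> \<theta>)" if "\<theta> \<in> I" for \<theta>
    using holomorphic_laplace_ray_model[OF model that] .
  show ?thesis
  proof (rule analytic_continuation_open[of "ball z0 1" ?S "laplace_ray (cis \<theta>1) F" "laplace_ray (cis \<theta>2) F"])
    show "ball z0 1 \<subseteq> ?S"
    proof
      fix w assume "w \<in> ball z0 1"
      from far[OF this, of \<theta>1] far[OF this, of \<theta>2] show "w \<in> ?S"
        using C[of \<theta>1] C[of \<theta>2] \<theta> by (auto simp: half_plane_def)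
    qed
    show "laplace_ray (cis \<theta>1) F w = laplace_ray (cis \<theta>2) F w" if "w \<in> ball z0 1" for w
    proof (rule laplace_ray_rotate_far[OF model \<theta>(1-3)])
      show "\<gamma> \<theta> \<le> C \<and> \<alpha> \<theta> \<le> A \<and> C + 1 \<le> Re (w * cis \<theta>)" if "\<theta> \<in> {\<theta>1..\<theta>2}" for \<theta>
        using C[OF that] A[OF that] far[OF \<open>w \<in> ball z0 1\<close> that] by (simp add: abs_le_iff)
    qed
    show "connected ?S" by (intro convex_connected convex_Int convex_half_plane)
    show "laplace_ray (cis \<theta>1) F holomorphic_on ?S" "laplace_ray (cis \<theta>2) F holomorphic_on ?S"
      using holo \<theta> by (auto intro: holomorphic_on_subset)
  qed (use z open_half_plane in auto)
qed

lemma laplace_dir_indep: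
  assumes I: "open I" "is_interval I" and f: "borel_transform f \<in> UNIV \<times> NN_rate I \<gamma>"
    and lb: "locally_bounded_on I \<gamma>"
    and \<theta>: "\<theta> \<in> I" "\<theta>' \<in> I" "\<bar>\<theta> - \<theta>'\<bar> < pi"
    and z: "z \<in> half_plane \<theta> (\<gamma> \<theta>)" "z \<in> half_plane \<theta>' (\<gamma> \<theta>')"
  shows "laplace_dir I \<theta> f z = laplace_dir I \<theta>' f z"
proof -
  obtain \<alpha> where \<alpha>: "locally_bounded_on I \<alpha>" and "snd (borel_transform f) \<in> NN_bound I \<gamma> \<alpha>"
    using f by (auto simp: NN_rate_def mem_Times_iff)
  from borel_model_exists[OF I this(2)] obtain r F where model: "borel_model I r \<gamma> \<alpha> f F" .
  have "laplace_ray (cis \<theta>) F z = laplace_ray (cis \<theta>') F z"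
  proof (cases "\<theta> \<le> \<theta>'")
    case True
    then show ?thesis using \<theta> by (intro laplace_ray_rotate[OF model lb \<alpha> _ _ _ _ z]) auto
  next
    case False
    then show ?thesis using \<theta> by (intro laplace_ray_rotate[OF model lb \<alpha> _ _ _ _ z(2,1), symmetric]) auto
  qed
  then show ?thesis using laplace_dir_eq_laplace_ray[OF model] \<theta> by simp
qed

section \<open>Borel sums in the plane and on the Riemann surface of the logarithm\<close>

lemma short_interval_diff_less_pi:
  assumes "open I" "is_interval I" "\<not> long_interval I" "\<theta> \<in> I" "\<theta>' \<in> I"
  shows "\<bar>\<theta> - \<theta>'\<bar> < pi"
proof -
  have *: "b - a < pi" if "a \<in> I" "b \<in> I" "a \<le> b" for a b
  proof (rule ccontr)
    assume "\<not> b - a < pi"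
    \<comment> \<open>Openness leaves room beyond \<open>b\<close>, so a distance of at least pi
      would make the length exceed pi strictly.\<close>
    obtain e where e: "e > 0" "ball b e \<subseteq> I" using \<open>b \<in> I\<close> assms(1) openE by blast
    then have "b + e / 2 \<in> I" by (auto simp: dist_real_def subset_iff)
    then have "{a..b + e / 2} \<subseteq> I" using mem_is_interval_1_I[OF assms(2) \<open>a \<in> I\<close>] by auto
    then have "emeasure lborel {a..b + e / 2} \<le> emeasure lborel I"
      using assms(1) by (intro emeasure_mono) auto
    then have "ennreal (b + e / 2 - a) \<le> emeasure lborel I" using that e by simp
    moreover have "ennreal pi < ennreal (b + e / 2 - a)"
    proof (rule ennreal_lessI)
      show "pi < b + e / 2 - a" using \<open>\<not> b - a < pi\<close> e by linarith
      then show "0 < b + e / 2 - a" using pi_gt_zero by linarith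
    qed
    ultimately show False using assms(3) by (auto simp: long_interval_def)
  qed
  show ?thesis using *[of \<theta> \<theta>'] *[of \<theta>' \<theta>] assms(4,5) by (cases "\<theta> \<le> \<theta>'") auto
qed

text \<open>In a short interval any two directions are less than pi apart, so the value does not
  depend on the direction and the description operator is well defined.\<close>

lemma borel_sum_eq:
  assumes "open I" "is_interval I" "borel_transform f \<in> UNIV \<times> NN_rate I \<gamma>"
    and "locally_bounded_on I \<gamma>" and short: "\<not> long_interval I"
    and \<theta>: "\<theta> \<in> I" and z: "z \<in> half_plane \<theta> (\<gamma> \<theta>)"
  shows "borel_sum I \<gamma> f z = laplace_dir I \<theta> f z"
  unfolding borel_sum_def
proof (rule the_equality)
  show "\<forall>\<theta>'\<in>I. z \<in> half_plane \<theta>' (\<gamma> \<theta>') \<longrightarrow> laplace_dir I \<theta> f z = laplace_dir I \<theta>' f z"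
    using laplace_dir_indep[OF assms(1-4) \<theta>] z short_interval_diff_less_pi[OF assms(1,2) short \<theta>] by blast
qed (use \<theta> z in blast)

text \<open>Positivity of \<open>c\<close> keeps arccos (c / r) below pi/2. So two lifted
  half-planes with a common point have directions less than pi apart, which substitutes for
  shortness of the interval.\<close>

lemma log_half_planeD:
  assumes "p \<in> log_half_plane \<theta> c" "0 < c"
  shows "log_proj p \<in> half_plane \<theta> c" "\<bar>snd p + \<theta>\<bar> < pi / 2"
proof -
  obtain r t where p: "p = (r, t)" by (cases p)
  have r: "c < r" and t: "\<bar>t + \<theta>\<bar> < arccos (c / r)" using assms by (auto simp: log_half_plane_def p)
  have c: "0 < c / r" "c / r < 1" using r assms(2) by auto
  then have "arccos (c / r) < arccos 0" by (intro arccos_less_arccos) auto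
  with t show 2: "\<bar>snd p + \<theta>\<bar> < pi / 2" by (simp add: p)
  have "cos (arccos (c / r)) < cos \<bar>t + \<theta>\<bar>"
    using t arccos_ubound[of "c / r"] c by (intro cos_monotone_0_pi) auto
  then have "c / r < cos (t + \<theta>)" using c by simp
  then have "c < r * cos (t + \<theta>)" using r assms(2) by (simp add: field_simps)
  moreover have "rcis r t * cis \<theta> = of_real r * cis (t + \<theta>)" by (simp add: rcis_def cis_mult mult.assoc)
  then have "Re (rcis r t * cis \<theta>) = r * cos (t + \<theta>)" by simp
  ultimately show "log_proj p \<in> half_plane \<theta> c"
    by (simp only: p log_proj_def half_plane_def fst_conv snd_conv mem_Collect_eq)
qed

lemma log_half_plane_antimono:
  assumes "p \<in> log_half_plane \<theta> c'" "0 < c" "c \<le> c'"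
  shows "p \<in> log_half_plane \<theta> c"
proof -
  obtain r t where p: "p = (r, t)" by (cases p)
  have r: "c' < r" and t: "\<bar>t + \<theta>\<bar> < arccos (c' / r)" using assms by (auto simp: log_half_plane_def p)
  have "arccos (c' / r) \<le> arccos (c / r)"
  proof (rule arccos_le_arccos)
    have "0 \<le> c / r" using r assms by simp
    then show "- 1 \<le> c / r" by linarith
  qed (use r assms in \<open>auto simp: divide_right_mono\<close>)
  then show ?thesis using r t assms by (auto simp: log_half_plane_def p)
qed

text \<open>\<open>log_add\<close> takes the principal argument relative to \<theta>, of absolute
  value at most pi. There the cosine decreases in the absolute value, so the half-plane inequality
  becomes a bound on the angle.\<close>

lemma log_add_in_log_half_plane:
  assumes "0 < c" "log_proj p + w \<in> half_plane \<theta> c"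
  shows "log_add \<theta> p w \<in> log_half_plane \<theta> c"
proof -
  define V where "V = (log_proj p + w) * cis \<theta>"
  have V: "c < Re V" and n: "norm V = norm (log_proj p + w)"
    using assms by (auto simp: V_def half_plane_def norm_mult)
  have cn: "c < norm V" using V complex_Re_le_cmod[of V] by linarith
  have "Re V = norm V * cos (Arg V)" by (metis rcis_cmod_Arg Re_rcis)
  then have cos: "c / norm V < cos \<bar>Arg V\<bar>" using V less_trans[OF assms(1) cn] by (simp add: pos_divide_less_eq mult.commute)
  have "\<bar>Arg V\<bar> < arccos (c / norm V)"
  proof (rule ccontr)
    assume "\<not> \<bar>Arg V\<bar> < arccos (c / norm V)"
    moreover have b: "0 \<le> c / norm V" "c / norm V \<le> 1"
      using cn assms(1) less_trans[OF assms(1) cn] by (auto simp: pos_divide_le_eq)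
    then have "0 \<le> arccos (c / norm V)" by (intro arccos_lbound) auto
    moreover have "\<bar>Arg V\<bar> \<le> pi" using Arg_bounded[of V] by auto
    ultimately have "cos \<bar>Arg V\<bar> \<le> cos (arccos (c / norm V))" by (intro cos_monotone_0_pi_le) auto
    also have "\<dots> = c / norm V" using b by (intro cos_arccos) auto
    finally show False using cos by simp
  qed
  then show ?thesis using cn n by (simp add: log_add_def log_half_plane_def flip: V_def)
qed

lemma log_borel_sum_eq:
  assumes "open I" "is_interval I" "borel_transform f \<in> UNIV \<times> NN_rate I \<gamma>"
    and "locally_bounded_on I \<gamma>" and pos: "\<forall>\<theta>\<in>I. \<gamma> \<theta> > 0"
    and \<theta>: "\<theta> \<in> I" and p: "p \<in> log_half_plane \<theta> (\<gamma> \<theta>)"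
  shows "log_borel_sum I \<gamma> f p = laplace_dir I \<theta> f (log_proj p)"
  unfolding log_borel_sum_def
proof (rule the_equality)
  show "\<forall>\<theta>'\<in>I. p \<in> log_half_plane \<theta>' (\<gamma> \<theta>') \<longrightarrow> laplace_dir I \<theta> f (log_proj p) = laplace_dir I \<theta>' f (log_proj p)"
  proof (intro ballI impI)
    fix \<theta>' assume \<theta>': "\<theta>' \<in> I" "p \<in> log_half_plane \<theta>' (\<gamma> \<theta>')"
    note d = log_half_planeD[OF p] log_half_planeD[OF \<theta>'(2)]
    show "laplace_dir I \<theta> f (log_proj p) = laplace_dir I \<theta>' f (log_proj p)"
    proof (rule laplace_dir_indep[OF assms(1-4) \<theta> \<theta>'(1)])
      \<comment> \<open>The argument of \<open>p\<close> is within pi/2 of both - \<theta> and -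
        \<theta>'.\<close>
      show "\<bar>\<theta> - \<theta>'\<bar> < pi" using d(2,4) pos \<theta> \<theta>'(1) by (simp add: abs_if split: if_splits)
    qed (use d(1,3) pos \<theta> \<theta>'(1) in auto)
  qed
qed (use \<theta> p in blast)

section \<open>Composition of 1-summable series\<close>

lemma locally_bounded_on_const: "locally_bounded_on I (\<lambda>_. c)"
  by (auto simp: locally_bounded_on_iff)

lemma locally_bounded_on_add:
  assumes "locally_bounded_on I g" "locally_bounded_on I h"
  shows "locally_bounded_on I (\<lambda>x. g x + h x)"
  unfolding locally_bounded_on_iff
proof (intro allI impI)
  fix s t assume "{s..t} \<subseteq> I"
  then obtain M N where "\<forall>x\<in>{s..t}. \<bar>g x\<bar> \<le> M" "\<forall>x\<in>{s..t}. \<bar>h x\<bar> \<le> N"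
    using assms unfolding locally_bounded_on_iff by blast
  then have "\<forall>x\<in>{s..t}. \<bar>g x + h x\<bar> \<le> M + N" by (auto intro: order_trans[OF abs_triangle_ineq] add_mono)
  then show "\<exists>M. \<forall>x\<in>{s..t}. \<bar>g x + h x\<bar> \<le> M" ..
qed

lemma locally_bounded_on_dominated:
  assumes "locally_bounded_on I g" "\<And>x. x \<in> I \<Longrightarrow> \<bar>h x\<bar> \<le> \<bar>g x\<bar>"
  shows "locally_bounded_on I h"
  unfolding locally_bounded_on_iff
proof (intro allI impI)
  fix s t assume st: "{s..t} \<subseteq> I"
  then obtain M where "\<forall>x\<in>{s..t}. \<bar>g x\<bar> \<le> M"
    using assms unfolding locally_bounded_on_iff by blast
  then have "\<forall>x\<in>{s..t}. \<bar>h x\<bar> \<le> M" using assms(2) st by (meson order_trans subsetD)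
  then show "\<exists>M. \<forall>x\<in>{s..t}. \<bar>h x\<bar> \<le> M" ..
qed

lemma locally_bounded_on_cmult:
  assumes "locally_bounded_on I g"
  shows "locally_bounded_on I (\<lambda>x. c * g x)"
  unfolding locally_bounded_on_iff
proof (intro allI impI)
  fix s t assume st: "{s..t} \<subseteq> I"
  then obtain M where "\<forall>x\<in>{s..t}. \<bar>g x\<bar> \<le> M"
    using assms unfolding locally_bounded_on_iff by blast
  then have "\<forall>x\<in>{s..t}. \<bar>c * g x\<bar> \<le> \<bar>c\<bar> * M" by (auto simp: abs_mult intro: mult_left_mono)
  then show "\<exists>M. \<forall>x\<in>{s..t}. \<bar>c * g x\<bar> \<le> M" ..
qed

lemma locally_bounded_on_sqrt:
  assumes "locally_bounded_on I g" "\<And>x. x \<in> I \<Longrightarrow> 0 \<le> g x"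
  shows "locally_bounded_on I (\<lambda>x. sqrt (g x))"
proof (rule locally_bounded_on_dominated)
  show "locally_bounded_on I (\<lambda>x. g x + 1)"
    by (intro locally_bounded_on_add locally_bounded_on_const assms)
  show "\<bar>sqrt (g x)\<bar> \<le> \<bar>g x + 1\<bar>" if "x \<in> I" for x
  proof -
    have "sqrt (g x) \<le> g x + 1"
      using assms(2)[OF that] by (intro real_le_lsqrt) (auto simp: power2_sum)
    then show ?thesis using assms(2)[OF that] by simp
  qed
qed

section \<open>Both compositions in a fixed direction\<close>

lemma fps_nth_bound_below_conv_radius:
  fixes H :: "complex fps"
  assumes "0 < \<rho>" "ereal \<rho> < fps_conv_radius H"
  obtains C where "\<And>p. norm (fps_nth H p) \<le> C / \<rho> ^ p"
proof -
  have "summable (\<lambda>p. fps_nth H p * of_real \<rho> ^ p)"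
    using assms by (intro summable_fps) simp
  then have "Bseq (\<lambda>p. fps_nth H p * of_real \<rho> ^ p)"
    by (intro convergent_imp_Bseq convergentI[OF summable_LIMSEQ_zero])
  then obtain C where "\<And>p. norm (fps_nth H p * of_real \<rho> ^ p) \<le> C"
    unfolding Bseq_def by blast
  with assms(1) that[of C] show ?thesis
    by (simp add: norm_mult norm_power field_simps)
qed

lemma subst_direction:
  assumes I: "open I" "is_interval I" and \<phi>0: "fps_nth \<phi> 0 = 0"
    and \<alpha>: "locally_bounded_on I \<alpha>"
    and \<phi>: "snd (borel_transform \<phi>) \<in> NN_bound I \<gamma> \<alpha>"
    and \<rho>: "0 < \<rho>" "ereal \<rho> < fps_conv_radius H"
  shows "snd (borel_transform (fps_compose H \<phi>)) \<in> NN_rate I (\<lambda>\<theta>. \<gamma> \<theta> + inverse \<rho> * \<alpha> \<theta>)"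
    and "\<And>\<theta> z. \<theta> \<in> I \<Longrightarrow> z \<in> half_plane \<theta> (\<gamma> \<theta> + inverse \<rho> * \<alpha> \<theta>) \<Longrightarrow>
      norm (laplace_dir I \<theta> \<phi> z) \<le> \<rho> \<and>
      laplace_dir I \<theta> (fps_compose H \<phi>) z = eval_fps H (laplace_dir I \<theta> \<phi> z)"
proof -
  obtain C where C: "\<And>p. norm (fps_nth H p) \<le> C / \<rho> ^ p"
    using fps_nth_bound_below_conv_radius[OF \<rho>] by blast
  have C0: "0 \<le> C" using C[of 0] by (auto intro: order_trans[OF norm_ge_zero])
  obtain r F where model: "borel_model I r \<gamma> \<alpha> \<phi> F" using borel_model_exists[OF I \<phi>] .
  have r: "0 < r" using model by (simp add: borel_model_def)
  have F: "F holomorphic_on germ_domain I r" by (rule borel_model_holomorphic[OF model])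
  define \<gamma>2 where "\<gamma>2 \<theta> = \<gamma> \<theta> + inverse \<rho> * \<alpha> \<theta>" for \<theta>
  define G where "G = (\<lambda>z. \<Sum>p. fps_nth H (Suc p) * borel_conv_power F p z)"
  have model_G: "borel_model I r \<gamma>2 (\<lambda>\<theta>. C * (\<alpha> \<theta> / \<rho>)) (fps_compose H \<phi>) G"
    unfolding borel_model_def
  proof (intro conjI ballI I r)
    interpret star_domain "germ_domain I r" by (rule star_domain_germ_domain[OF I(1) r])
    show "borel_rep G (fps_compose H \<phi>)"
      unfolding G_def using model \<phi>0 C \<rho>(1)
      by (intro borel_rep_fps_compose) (auto simp: borel_model_def)
  next
    fix \<theta> assume \<theta>: "\<theta> \<in> I"
    interpret star_domain_ray "germ_domain I r" "cis \<theta>"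
      by (rule star_domain_ray_germ_domain[OF I(1) r \<theta>])
    show "exp_growth (cis \<theta>) (C * (\<alpha> \<theta> / \<rho>)) (\<gamma>2 \<theta>) G"
      unfolding exp_growth_def G_def \<gamma>2_def
      using norm_suminf_le_bound(2)[OF sum_norm_subst_term_le[OF F borel_model_growth[OF model \<theta>] C \<rho>(1)]]
      by blast
  qed
  have \<alpha>_nonneg: "0 \<le> \<alpha> \<theta>" if "\<theta> \<in> I" for \<theta>
    using exp_growth_nonneg[OF borel_model_growth[OF model that]] .
  have "locally_bounded_on I (\<lambda>\<theta>. C * (\<alpha> \<theta> / \<rho>))"
    using locally_bounded_on_cmult[OF \<alpha>, of "C / \<rho>"] by simp
  moreover have "\<forall>\<theta>\<in>I. 0 \<le> C * (\<alpha> \<theta> / \<rho>)" using C0 \<alpha>_nonneg \<rho>(1) by simp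
  ultimately show "snd (borel_transform (fps_compose H \<phi>)) \<in> NN_rate I (\<lambda>\<theta>. \<gamma> \<theta> + inverse \<rho> * \<alpha> \<theta>)"
    using borel_model_NN_bound[OF model_G] unfolding NN_rate_def \<gamma>2_def by blast
  fix \<theta> z assume \<theta>: "\<theta> \<in> I" and "z \<in> half_plane \<theta> (\<gamma> \<theta> + inverse \<rho> * \<alpha> \<theta>)"
  then have z: "\<gamma> \<theta> + inverse \<rho> * \<alpha> \<theta> < Re (z * cis \<theta>)" by (simp only: half_plane_def mem_Collect_eq)
  interpret star_domain_ray "germ_domain I r" "cis \<theta>"
    by (rule star_domain_ray_germ_domain[OF I(1) r \<theta>])
  note growth = borel_model_growth[OF model \<theta>]
  \<comment> \<open>In terms of this gap the half-plane of rate \<gamma> + \<alpha>/\<rho> says x >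
    \<alpha>/\<rho>, that is \<alpha>/x < \<rho> for positive \<open>x\<close>, and \<alpha>/x is
    the bound of the Laplace integral.\<close>
  define x where "x = Re (z * cis \<theta>) - \<gamma> \<theta>"
  have x: "0 < x" "\<alpha> \<theta> < \<rho> * x"
  proof -
    have "inverse \<rho> * \<alpha> \<theta> < x" using z by (simp add: x_def)
    moreover have "0 \<le> inverse \<rho> * \<alpha> \<theta>" using \<rho>(1) \<alpha>_nonneg[OF \<theta>] by simp
    ultimately show "0 < x" by linarith
    show "\<alpha> \<theta> < \<rho> * x" using \<open>inverse \<rho> * \<alpha> \<theta> < x\<close> \<rho>(1) by (simp add: field_simps)
  qed
  define w where "w = laplace_ray (cis \<theta>) F z"
  have w: "laplace_dir I \<theta> \<phi> z = w"
    using laplace_dir_eq_laplace_ray[OF model \<theta>] \<phi>0 by (simp add: w_def)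
  have "norm w \<le> \<alpha> \<theta> / x"
    using norm_laplace_ray_le[OF F growth, of z] x by (simp add: w_def x_def)
  also have "\<dots> \<le> \<rho>" using x by (simp add: field_simps)
  finally have "norm w \<le> \<rho>" .
  moreover have "(\<lambda>p. fps_nth H p * w ^ p) sums (fps_nth H 0 + laplace_ray (cis \<theta>) G z)"
    unfolding w_def G_def
    by (rule laplace_ray_subst[OF F growth C \<rho>(1) borel_model_holomorphic[OF model_G, unfolded G_def] z])
  then have "eval_fps H w = laplace_dir I \<theta> (fps_compose H \<phi>) z"
    by (simp add: eval_fps_def sums_iff laplace_dir_eq_laplace_ray[OF model_G \<theta>])
  ultimately show "norm (laplace_dir I \<theta> \<phi> z) \<le> \<rho> \<and>
      laplace_dir I \<theta> (fps_compose H \<phi>) z = eval_fps H (laplace_dir I \<theta> \<phi> z)"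
    by (simp add: w)
qed

lemma fps_nth_shift_compose_0: "fps_nth (shift_compose \<psi> \<omega>) 0 = fps_nth \<psi> 0"
  by (simp add: shift_compose_nth)

lemma shift_direction:
  assumes I: "open I" "is_interval I" and \<phi>0: "fps_nth \<phi> 0 = 0"
    and \<phi>: "snd (borel_transform \<phi>) \<in> NN_bound I \<gamma> \<alpha>"
    and \<psi>: "snd (borel_transform \<psi>) \<in> NN_rate I \<gamma>"
  shows "snd (borel_transform (shift_compose \<psi> (fps_const a + \<phi>)))
      \<in> NN_rate I (\<lambda>\<theta>. \<gamma> \<theta> + norm a + sqrt (\<alpha> \<theta>))"
    and "\<And>\<theta> z. \<theta> \<in> I \<Longrightarrow> z \<in> half_plane \<theta> (\<gamma> \<theta> + norm a + sqrt (\<alpha> \<theta>)) \<Longrightarrow>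
      z + laplace_dir I \<theta> (fps_const a + \<phi>) z \<in> half_plane \<theta> (\<gamma> \<theta>) \<and>
      laplace_dir I \<theta> (shift_compose \<psi> (fps_const a + \<phi>)) z =
        laplace_dir I \<theta> \<psi> (z + laplace_dir I \<theta> (fps_const a + \<phi>) z)"
proof -
  obtain \<beta> where \<beta>: "locally_bounded_on I \<beta>" "\<forall>\<theta>\<in>I. 0 \<le> \<beta> \<theta>"
    and \<psi>\<beta>: "snd (borel_transform \<psi>) \<in> NN_bound I \<gamma> \<beta>"
    using \<psi> by (auto simp: NN_rate_def)
  obtain r1 F where model1: "borel_model I r1 \<gamma> \<alpha> \<phi> F" using borel_model_exists[OF I \<phi>] .
  obtain r2 P where model2: "borel_model I r2 \<gamma> \<beta> \<psi> P" using borel_model_exists[OF I \<psi>\<beta>] .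
  define r where "r = min r1 r2"
  have r: "0 < r" using model1 model2 by (simp add: borel_model_def r_def)
  have mF: "borel_model I r \<gamma> \<alpha> \<phi> F" using borel_model_shrink[OF model1 r] by (simp add: r_def)
  have mP: "borel_model I r \<gamma> \<beta> \<psi> P" using borel_model_shrink[OF model2 r] by (simp add: r_def)
  have F: "F holomorphic_on germ_domain I r" by (rule borel_model_holomorphic[OF mF])
  have P: "P holomorphic_on germ_domain I r" by (rule borel_model_holomorphic[OF mP])
  \<comment> \<open>Represents \<psi> o (id + a), so that the shift by \<phi> that remains has no
    constant term.\<close>
  define X where "X = (\<lambda>z. exp (- a * z) * P z)"
  have X: "X holomorphic_on germ_domain I r" unfolding X_def by (intro holomorphic_intros P)
  define G where "G = (\<lambda>z. \<Sum>p. 1 / fact p * shift_term F X p z)"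
  define S where "S = shift_compose \<psi> (fps_const a + \<phi>)"
  define \<gamma>1 where "\<gamma>1 \<theta> = \<gamma> \<theta> + norm a + sqrt (\<alpha> \<theta>)" for \<theta>
  \<comment> \<open>\<open>F\<close> is also assigned the larger rate \<gamma> + |a|, because the
    convolution estimates work with one rate for both factors.\<close>
  have growth_F: "exp_growth (cis \<theta>) (\<alpha> \<theta>) (\<gamma> \<theta> + norm a) F" if "\<theta> \<in> I" for \<theta>
    using exp_growth_mono[OF borel_model_growth[OF mF that]] by simp
  have growth_X: "exp_growth (cis \<theta>) (\<beta> \<theta>) (\<gamma> \<theta> + norm a) X" if "\<theta> \<in> I" for \<theta>
    unfolding exp_growth_def
  proof (intro allI impI)
    fix s :: real assume s: "0 \<le> s"
    have "Re (- a * (of_real s * cis \<theta>)) \<le> norm a * s"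
      using complex_Re_le_cmod[of "- a * (of_real s * cis \<theta>)"] s by (simp add: norm_mult)
    then have "norm (X (of_real s * cis \<theta>)) \<le> exp (norm a * s) * (\<beta> \<theta> * exp (\<gamma> \<theta> * s))"
      unfolding X_def norm_mult norm_exp_eq_Re
      using borel_model_growth[OF mP that] s by (intro mult_mono) (auto simp: exp_growth_def)
    also have "\<dots> = \<beta> \<theta> * exp ((\<gamma> \<theta> + norm a) * s)"
      by (simp add: distrib_right exp_add)
    finally show "norm (X (of_real s * cis \<theta>)) \<le> \<beta> \<theta> * exp ((\<gamma> \<theta> + norm a) * s)" .
  qed
  have mG: "borel_model I r \<gamma>1 \<beta> S G"
    unfolding borel_model_def
  proof (intro conjI ballI I r)
    interpret star_domain "germ_domain I r" by (rule star_domain_germ_domain[OF I(1) r])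
    have "borel_rep F \<phi>" "borel_rep P \<psi>" using mF mP by (auto simp: borel_model_def)
    then have "borel_rep G (shift_compose (shift_compose \<psi> (fps_const a)) \<phi>)"
      unfolding G_def X_def using \<phi>0 by (intro borel_rep_shift borel_rep_shift_const)
    then show "borel_rep G S" by (simp add: S_def shift_compose_const_add)
  next
    fix \<theta> assume \<theta>: "\<theta> \<in> I"
    interpret star_domain_ray "germ_domain I r" "cis \<theta>"
      by (rule star_domain_ray_germ_domain[OF I(1) r \<theta>])
    show "exp_growth (cis \<theta>) (\<beta> \<theta>) (\<gamma>1 \<theta>) G"
      unfolding exp_growth_def G_def \<gamma>1_def
      using norm_suminf_le_bound(2)[OF sum_norm_shift_term_le[OF F growth_F[OF \<theta>] X growth_X[OF \<theta>]]]
      by blast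
  qed
  show "snd (borel_transform (shift_compose \<psi> (fps_const a + \<phi>)))
      \<in> NN_rate I (\<lambda>\<theta>. \<gamma> \<theta> + norm a + sqrt (\<alpha> \<theta>))"
    using borel_model_NN_bound[OF mG] \<beta> unfolding NN_rate_def \<gamma>1_def S_def by blast
  fix \<theta> z assume \<theta>: "\<theta> \<in> I" and "z \<in> half_plane \<theta> (\<gamma> \<theta> + norm a + sqrt (\<alpha> \<theta>))"
  then have z: "\<gamma> \<theta> + norm a + sqrt (\<alpha> \<theta>) < Re (z * cis \<theta>)" by (simp only: half_plane_def mem_Collect_eq)
  interpret star_domain_ray "germ_domain I r" "cis \<theta>"
    by (rule star_domain_ray_germ_domain[OF I(1) r \<theta>])
  define x where "x = Re (z * cis \<theta>) - \<gamma> \<theta>"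
  define w where "w = laplace_ray (cis \<theta>) F z"
  have \<alpha>: "0 \<le> \<alpha> \<theta>" using exp_growth_nonneg[OF borel_model_growth[OF mF \<theta>]] .
  have x: "norm a + sqrt (\<alpha> \<theta>) < x" using z by (simp add: x_def)
  have s0: "0 \<le> sqrt (\<alpha> \<theta>)" using \<alpha> by simp
  have x0: "sqrt (\<alpha> \<theta>) < x" "0 < x" using x s0 norm_ge_zero[of a] by linarith+
  \<comment> \<open>Here \<open>F\<close> keeps its own rate \<gamma>: the gap \<open>x\<close>
    exceeds |a| + sqrt \<alpha>, so \<alpha>/x \<le> sqrt \<alpha> leaves |a| to spare for the
    displacement by \<open>a\<close>.\<close>
  have "norm w \<le> \<alpha> \<theta> / x"
    using norm_laplace_ray_le[OF F borel_model_growth[OF mF \<theta>], of z] x0 by (simp add: w_def x_def)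
  also have "\<dots> \<le> sqrt (\<alpha> \<theta>)"
  proof -
    have "\<alpha> \<theta> = sqrt (\<alpha> \<theta>) * sqrt (\<alpha> \<theta>)" using \<alpha> by simp
    also have "\<dots> \<le> sqrt (\<alpha> \<theta>) * x" using x0 s0 by (intro mult_left_mono) auto
    finally show ?thesis using x0 by (simp add: pos_divide_le_eq)
  qed
  finally have w: "norm w < x - norm a" using x by linarith
  have dir: "laplace_dir I \<theta> (fps_const a + \<phi>) z = a + w"
    using laplace_dir_eq_laplace_ray[OF borel_model_cong[OF mF] \<theta>, of "fps_const a + \<phi>" z] \<phi>0
    by (simp add: w_def)
  have "\<bar>Re ((a + w) * cis \<theta>)\<bar> \<le> norm a + norm w"
    using abs_Re_le_cmod[of "(a + w) * cis \<theta>"] norm_triangle_ineq[of a w] by (simp add: norm_mult)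
  moreover have "Re ((z + (a + w)) * cis \<theta>) = Re (z * cis \<theta>) + Re ((a + w) * cis \<theta>)"
    by (simp add: algebra_simps)
  ultimately have "\<gamma> \<theta> < Re ((z + (a + w)) * cis \<theta>)" using w unfolding x_def by linarith
  then have "z + laplace_dir I \<theta> (fps_const a + \<phi>) z \<in> half_plane \<theta> (\<gamma> \<theta>)"
    by (simp only: dir half_plane_def mem_Collect_eq)
  moreover have "laplace_ray (cis \<theta>) G z = laplace_ray (cis \<theta>) X (z + w)"
    unfolding w_def G_def
  proof (rule laplace_ray_shift[OF F growth_F[OF \<theta>] X growth_X[OF \<theta>] _ z])
    show "norm (laplace_ray (cis \<theta>) F z) < Re (z * cis \<theta>) - (\<gamma> \<theta> + norm a)"
      using w by (simp only: w_def x_def)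
  qed (use borel_model_holomorphic[OF mG] in \<open>simp add: G_def\<close>)
  \<comment> \<open>The factor exp (- a \<zeta>) in \<open>X\<close> translates the argument z + w
    by \<open>a\<close>; the \<delta> parts agree by \<open>fps_nth_shift_compose_0\<close>.\<close>
  then have "laplace_dir I \<theta> S z = laplace_dir I \<theta> \<psi> (z + (a + w))"
    using laplace_dir_eq_laplace_ray[OF mG \<theta>, of z] laplace_dir_eq_laplace_ray[OF mP \<theta>, of "z + (a + w)"]
      laplace_ray_exp_mult[of a P "z + w"]
    by (simp add: S_def fps_nth_shift_compose_0 X_def add_ac)
  ultimately show "z + laplace_dir I \<theta> (fps_const a + \<phi>) z \<in> half_plane \<theta> (\<gamma> \<theta>) \<and>
      laplace_dir I \<theta> (shift_compose \<psi> (fps_const a + \<phi>)) z =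
        laplace_dir I \<theta> \<psi> (z + laplace_dir I \<theta> (fps_const a + \<phi>) z)"
    by (simp add: dir S_def)
qed

section \<open>From a fixed direction to the domains of the Borel sums\<close>

lemma half_plane_antimono: "c \<le> c' \<Longrightarrow> z \<in> half_plane \<theta> c' \<Longrightarrow> z \<in> half_plane \<theta> c"
  unfolding half_plane_def mem_Collect_eq by linarith

text \<open>Each point of the domain lies in the half-plane of some direction, where all Borel sums
  involved are Laplace integrals in that one direction; for these the claim is
  \<open>dir\<close>.\<close>

lemma subst_identity:
  assumes I: "open I" "is_interval I" and g: "growth_rate I \<gamma>" "growth_rate I \<gamma>'"
    and le: "\<And>\<theta>. \<theta> \<in> I \<Longrightarrow> \<gamma> \<theta> \<le> \<gamma>' \<theta>"
    and rate: "borel_transform \<phi> \<in> UNIV \<times> NN_rate I \<gamma>"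
      "borel_transform (fps_compose H \<phi>) \<in> UNIV \<times> NN_rate I \<gamma>'"
    and dir: "\<And>\<theta> z. \<theta> \<in> I \<Longrightarrow> z \<in> half_plane \<theta> (\<gamma>' \<theta>) \<Longrightarrow>
      norm (laplace_dir I \<theta> \<phi> z) \<le> \<rho> \<and>
      laplace_dir I \<theta> (fps_compose H \<phi>) z = eval_fps H (laplace_dir I \<theta> \<phi> z)"
  shows "subst_identity_on I \<gamma> \<gamma>' \<rho> H \<phi>"
proof (cases "long_interval I")
  case True
  have lb: "locally_bounded_on I \<gamma>" "locally_bounded_on I \<gamma>'"
    and pos: "\<forall>\<theta>\<in>I. \<gamma> \<theta> > 0" "\<forall>\<theta>\<in>I. \<gamma>' \<theta> > 0"
    using g True by (auto simp: growth_rate_def)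
  have "p \<in> log_DD I \<gamma> \<and> norm (log_borel_sum I \<gamma> \<phi> p) \<le> \<rho> \<and>
      log_borel_sum I \<gamma>' (fps_compose H \<phi>) p = eval_fps H (log_borel_sum I \<gamma> \<phi> p)"
    if \<theta>: "\<theta> \<in> I" and p: "p \<in> log_half_plane \<theta> (\<gamma>' \<theta>)" for p \<theta>
  proof -
    have p': "p \<in> log_half_plane \<theta> (\<gamma> \<theta>)" using log_half_plane_antimono[OF p] pos le \<theta> by blast
    have "log_proj p \<in> half_plane \<theta> (\<gamma>' \<theta>)" using log_half_planeD[OF p] pos \<theta> by blast
    from dir[OF \<theta> this] \<theta> p' show ?thesis
      unfolding log_borel_sum_eq[OF I rate(1) lb(1) pos(1) \<theta> p']
        log_borel_sum_eq[OF I rate(2) lb(2) pos(2) \<theta> p] log_DD_def by blast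
  qed
  with True show ?thesis by (auto simp: subst_identity_on_def log_DD_def)
next
  case False
  have lb: "locally_bounded_on I \<gamma>" "locally_bounded_on I \<gamma>'" using g by (auto simp: growth_rate_def)
  have "z \<in> DD I \<gamma> \<and> norm (borel_sum I \<gamma> \<phi> z) \<le> \<rho> \<and>
      borel_sum I \<gamma>' (fps_compose H \<phi>) z = eval_fps H (borel_sum I \<gamma> \<phi> z)"
    if \<theta>: "\<theta> \<in> I" and z: "z \<in> half_plane \<theta> (\<gamma>' \<theta>)" for z \<theta>
  proof -
    have z': "z \<in> half_plane \<theta> (\<gamma> \<theta>)" using half_plane_antimono[OF le[OF \<theta>] z] .
    from dir[OF \<theta> z] \<theta> z' show ?thesis
      unfolding borel_sum_eq[OF I rate(1) lb(1) False \<theta> z']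
        borel_sum_eq[OF I rate(2) lb(2) False \<theta> z] DD_def by blast
  qed
  with False show ?thesis by (auto simp: subst_identity_on_def DD_def)
qed

text \<open>The displaced point stays in the half-plane of the same direction, so the outer Borel
  sum is a Laplace integral in that direction too. On the logarithmic surface \<open>log_add\<close>
  performs the displacement and \<open>log_proj_log_add\<close> projects it to the plane.\<close>

lemma shift_identity:
  assumes I: "open I" "is_interval I" and g: "growth_rate I \<gamma>" "growth_rate I \<gamma>'"
    and le: "\<And>\<theta>. \<theta> \<in> I \<Longrightarrow> \<gamma> \<theta> \<le> \<gamma>' \<theta>"
    and rate: "borel_transform \<omega> \<in> UNIV \<times> NN_rate I \<gamma>" "borel_transform \<psi> \<in> UNIV \<times> NN_rate I \<gamma>"
      "borel_transform (shift_compose \<psi> \<omega>) \<in> UNIV \<times> NN_rate I \<gamma>'"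
    and dir: "\<And>\<theta> z. \<theta> \<in> I \<Longrightarrow> z \<in> half_plane \<theta> (\<gamma>' \<theta>) \<Longrightarrow>
      z + laplace_dir I \<theta> \<omega> z \<in> half_plane \<theta> (\<gamma> \<theta>) \<and>
      laplace_dir I \<theta> (shift_compose \<psi> \<omega>) z = laplace_dir I \<theta> \<psi> (z + laplace_dir I \<theta> \<omega> z)"
  shows "shift_identity_on I \<gamma> \<gamma>' \<psi> \<omega>"
proof (cases "long_interval I")
  case True
  have lb: "locally_bounded_on I \<gamma>" "locally_bounded_on I \<gamma>'"
    and pos: "\<forall>\<theta>\<in>I. \<gamma> \<theta> > 0" "\<forall>\<theta>\<in>I. \<gamma>' \<theta> > 0"
    using g True by (auto simp: growth_rate_def)
  have "p \<in> log_DD I \<gamma> \<and>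
      log_add \<theta> p (log_borel_sum I \<gamma> \<omega> p) \<in> log_half_plane \<theta> (\<gamma> \<theta>) \<and>
      log_borel_sum I \<gamma>' (shift_compose \<psi> \<omega>) p =
        log_borel_sum I \<gamma> \<psi> (log_add \<theta> p (log_borel_sum I \<gamma> \<omega> p))"
    if \<theta>: "\<theta> \<in> I" and p: "p \<in> log_half_plane \<theta> (\<gamma>' \<theta>)" for p \<theta>
  proof -
    define w where "w = laplace_dir I \<theta> \<omega> (log_proj p)"
    have p': "p \<in> log_half_plane \<theta> (\<gamma> \<theta>)" using log_half_plane_antimono[OF p] pos le \<theta> by blast
    have "log_proj p \<in> half_plane \<theta> (\<gamma>' \<theta>)" using log_half_planeD[OF p] pos \<theta> by blast
    note d = dir[OF \<theta> this, folded w_def]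
    then have q: "log_add \<theta> p w \<in> log_half_plane \<theta> (\<gamma> \<theta>)"
      using pos \<theta> by (intro log_add_in_log_half_plane) auto
    show ?thesis
      unfolding log_borel_sum_eq[OF I rate(1) lb(1) pos(1) \<theta> p', folded w_def]
        log_borel_sum_eq[OF I rate(2) lb(1) pos(1) \<theta> q]
        log_borel_sum_eq[OF I rate(3) lb(2) pos(2) \<theta> p] log_proj_log_add log_DD_def
      using d q p' \<theta> by blast
  qed
  with True show ?thesis unfolding shift_identity_on_def by simp
next
  case False
  have lb: "locally_bounded_on I \<gamma>" "locally_bounded_on I \<gamma>'" using g by (auto simp: growth_rate_def)
  have "z \<in> DD I \<gamma> \<and> z + borel_sum I \<gamma> \<omega> z \<in> DD I \<gamma> \<and>
      borel_sum I \<gamma>' (shift_compose \<psi> \<omega>) z = borel_sum I \<gamma> \<psi> (z + borel_sum I \<gamma> \<omega> z)"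
    if \<theta>: "\<theta> \<in> I" and z: "z \<in> half_plane \<theta> (\<gamma>' \<theta>)" for z \<theta>
  proof -
    define w where "w = laplace_dir I \<theta> \<omega> z"
    have z': "z \<in> half_plane \<theta> (\<gamma> \<theta>)" using half_plane_antimono[OF le[OF \<theta>] z] .
    note d = dir[OF \<theta> z, folded w_def]
    then have q: "z + w \<in> half_plane \<theta> (\<gamma> \<theta>)" by blast
    show ?thesis
      unfolding borel_sum_eq[OF I rate(1) lb(1) False \<theta> z', folded w_def]
        borel_sum_eq[OF I rate(2) lb(1) False \<theta> q]
        borel_sum_eq[OF I rate(3) lb(2) False \<theta> z] DD_def
      using d q z' \<theta> by blast
  qed
  with False show ?thesis by (auto simp: shift_identity_on_def DD_def)
qed

lemma growth_rate_mono:
  assumes "growth_rate I \<gamma>" "locally_bounded_on I \<gamma>'" "\<And>\<theta>. \<theta> \<in> I \<Longrightarrow> \<gamma> \<theta> \<le> \<gamma>' \<theta>"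
  shows "growth_rate I \<gamma>'"
  using assms by (fastforce simp: growth_rate_def intro: less_le_trans)

lemma NN_bound_mono:
  assumes "g \<in> NN_bound I \<gamma> \<alpha>" "\<And>\<theta>. \<theta> \<in> I \<Longrightarrow> \<gamma> \<theta> \<le> \<gamma>' \<theta>" "\<And>\<theta>. \<theta> \<in> I \<Longrightarrow> 0 \<le> \<alpha> \<theta>"
  shows "g \<in> NN_bound I \<gamma>' \<alpha>"
proof -
  obtain F where F: "fps_conv_radius g > 0" "extends_to_sector I g F"
    and b: "\<And>\<theta> \<xi>. \<theta> \<in> I \<Longrightarrow> \<xi> > 0 \<Longrightarrow> norm (F (rcis \<xi> \<theta>)) \<le> \<alpha> \<theta> * exp (\<gamma> \<theta> * \<xi>)"
    using assms(1) unfolding NN_bound_def by blast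
  have "norm (F (rcis \<xi> \<theta>)) \<le> \<alpha> \<theta> * exp (\<gamma>' \<theta> * \<xi>)" if "\<theta> \<in> I" "\<xi> > 0" for \<theta> \<xi>
    using b[OF that] assms(2,3)[OF that(1)] that(2)
    by (intro order_trans[OF b[OF that]] mult_left_mono) (auto intro: mult_right_mono)
  with F show ?thesis unfolding NN_bound_def by blast
qed

text \<open>Collects the results for prescribed rates. Positivity on long intervals, contained in
  \<open>growth_rate\<close>, enters with the lifted half-planes and passes to the larger
  rates.\<close>

lemma composition_summability:
  fixes I :: "real set" and \<gamma> \<alpha> :: "real \<Rightarrow> real" and a :: complex
  assumes I: "open I" "is_interval I" and \<phi>0: "fps_nth \<phi> 0 = 0"
    and lb: "locally_bounded_on I \<gamma>" "locally_bounded_on I \<alpha>" "\<forall>\<theta>\<in>I. 0 \<le> \<alpha> \<theta>"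
    and \<phi>: "snd (borel_transform \<phi>) \<in> NN_bound I \<gamma> \<alpha>"
    and \<psi>: "borel_transform \<psi> \<in> UNIV \<times> NN_rate I \<gamma>"
    and \<rho>: "0 < \<rho>" "ereal \<rho> < fps_conv_radius H"
  defines "\<gamma>\<^sub>1 \<equiv> \<lambda>\<theta>. \<gamma> \<theta> + norm a + sqrt (\<alpha> \<theta>)" and "\<gamma>\<^sub>2 \<equiv> \<lambda>\<theta>. \<gamma> \<theta> + inverse \<rho> * \<alpha> \<theta>"
  shows "locally_bounded_on I \<gamma>\<^sub>1" "locally_bounded_on I \<gamma>\<^sub>2"
    and "borel_transform (fps_const a + \<phi>) \<in> UNIV \<times> NN_rate I \<gamma>"
    and "borel_transform (shift_compose \<psi> (fps_const a + \<phi>)) \<in> UNIV \<times> NN_rate I \<gamma>\<^sub>1"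
    and "borel_transform (fps_compose H \<phi>) \<in> UNIV \<times> NN_rate I \<gamma>\<^sub>2"
    and "growth_rate I \<gamma> \<Longrightarrow> growth_rate I \<gamma>\<^sub>1 \<and> growth_rate I \<gamma>\<^sub>2 \<and>
      shift_identity_on I \<gamma> \<gamma>\<^sub>1 \<psi> (fps_const a + \<phi>) \<and> subst_identity_on I \<gamma> \<gamma>\<^sub>2 \<rho> H \<phi>"
proof -
  have sqrt: "locally_bounded_on I (\<lambda>\<theta>. sqrt (\<alpha> \<theta>))" using lb by (intro locally_bounded_on_sqrt) auto
  show lb1: "locally_bounded_on I \<gamma>\<^sub>1" and lb2: "locally_bounded_on I \<gamma>\<^sub>2"
    unfolding \<gamma>\<^sub>1_def \<gamma>\<^sub>2_def
    by (intro locally_bounded_on_add locally_bounded_on_cmult locally_bounded_on_const lb sqrt)+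
  have le1: "\<gamma> \<theta> \<le> \<gamma>\<^sub>1 \<theta>" and le2: "\<gamma> \<theta> \<le> \<gamma>\<^sub>2 \<theta>" if "\<theta> \<in> I" for \<theta>
    using lb(3) \<rho>(1) that by (auto simp: \<gamma>\<^sub>1_def \<gamma>\<^sub>2_def)
  have \<phi>_rate: "borel_transform \<phi> \<in> UNIV \<times> NN_rate I \<gamma>"
    using \<phi> lb by (auto simp: NN_rate_def mem_Times_iff)
  then show \<omega>_rate: "borel_transform (fps_const a + \<phi>) \<in> UNIV \<times> NN_rate I \<gamma>"
    by (simp add: borel_transform_def)
  have \<psi>': "snd (borel_transform \<psi>) \<in> NN_rate I \<gamma>" using \<psi> by (simp add: mem_Times_iff)
  note shift = shift_direction[where a=a, OF I \<phi>0 \<phi> \<psi>', folded \<gamma>\<^sub>1_def]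
  note subst = subst_direction[OF I \<phi>0 lb(2) \<phi> \<rho>, folded \<gamma>\<^sub>2_def]
  show S: "borel_transform (shift_compose \<psi> (fps_const a + \<phi>)) \<in> UNIV \<times> NN_rate I \<gamma>\<^sub>1"
    using shift(1) by (simp add: mem_Times_iff)
  show T: "borel_transform (fps_compose H \<phi>) \<in> UNIV \<times> NN_rate I \<gamma>\<^sub>2"
    using subst(1) by (simp add: mem_Times_iff)
  assume g: "growth_rate I \<gamma>"
  have g1: "growth_rate I \<gamma>\<^sub>1" and g2: "growth_rate I \<gamma>\<^sub>2"
    using growth_rate_mono[OF g lb1 le1] growth_rate_mono[OF g lb2 le2] by blast+
  have "shift_identity_on I \<gamma> \<gamma>\<^sub>1 \<psi> (fps_const a + \<phi>)"
    using shift(2) by (intro shift_identity[OF I g g1 le1 \<omega>_rate \<psi> S]) (auto simp: \<gamma>\<^sub>1_def)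
  moreover have "subst_identity_on I \<gamma> \<gamma>\<^sub>2 \<rho> H \<phi>"
    using subst(2) by (intro subst_identity[OF I g g2 le2 \<phi>_rate T]) (auto simp: \<gamma>\<^sub>2_def)
  ultimately show "growth_rate I \<gamma>\<^sub>1 \<and> growth_rate I \<gamma>\<^sub>2 \<and>
      shift_identity_on I \<gamma> \<gamma>\<^sub>1 \<psi> (fps_const a + \<phi>) \<and> subst_identity_on I \<gamma> \<gamma>\<^sub>2 \<rho> H \<phi>"
    using g1 g2 by blast
qed

theorem theorem13p3:
  fixes I :: "real set" and a :: complex and \<phi> \<phi>\<^sub>0 \<psi>\<^sub>0 H :: "complex fps"
  assumes "open I" and "is_interval I" and "I \<noteq> {}"
    and "fps_nth \<phi> 0 = 0" and "\<phi>\<^sub>0 = fps_const a + \<phi>"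
    and "one_summable I \<phi>\<^sub>0" and "one_summable I \<psi>\<^sub>0"
    and "fps_conv_radius H > 0"
  shows
    "one_summable I (shift_compose \<psi>\<^sub>0 \<phi>\<^sub>0) \<and>
     one_summable I (fps_compose H \<phi>) \<and>
     (\<exists>\<gamma> \<gamma>\<^sub>1 \<gamma>\<^sub>2 \<rho>. growth_rate I \<gamma> \<and> growth_rate I \<gamma>\<^sub>1 \<and> growth_rate I \<gamma>\<^sub>2 \<and>
        borel_transform \<phi>\<^sub>0 \<in> UNIV \<times> NN_rate I \<gamma> \<and> borel_transform \<psi>\<^sub>0 \<in> UNIV \<times> NN_rate I \<gamma> \<and>
        borel_transform (shift_compose \<psi>\<^sub>0 \<phi>\<^sub>0) \<in> UNIV \<times> NN_rate I \<gamma>\<^sub>1 \<and>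
        borel_transform (fps_compose H \<phi>) \<in> UNIV \<times> NN_rate I \<gamma>\<^sub>2 \<and>
        0 < \<rho> \<and> ereal \<rho> < fps_conv_radius H \<and>
        shift_identity_on I \<gamma> \<gamma>\<^sub>1 \<psi>\<^sub>0 \<phi>\<^sub>0 \<and>
        subst_identity_on I \<gamma> \<gamma>\<^sub>2 \<rho> H \<phi>) \<and>
     (\<forall>(\<gamma> :: real \<Rightarrow> real) (\<alpha> :: real \<Rightarrow> real) (\<rho> :: real).
        locally_bounded_on I \<gamma> \<and> locally_bounded_on I \<alpha> \<and> (\<forall>\<theta>\<in>I. \<alpha> \<theta> \<ge> 0) \<and>
        borel_transform \<phi> \<in> {0} \<times> NN_bound I \<gamma> \<alpha> \<and> borel_transform \<psi>\<^sub>0 \<in> UNIV \<times> NN_rate I \<gamma> \<and>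
        0 < \<rho> \<and> ereal \<rho> < fps_conv_radius H
        \<longrightarrow>
        (let \<gamma>\<^sub>1 = (\<lambda>\<theta>. \<gamma> \<theta> + norm a + sqrt (\<alpha> \<theta>));
             \<gamma>\<^sub>2 = (\<lambda>\<theta>. \<gamma> \<theta> + inverse \<rho> * \<alpha> \<theta>)
         in borel_transform (shift_compose \<psi>\<^sub>0 \<phi>\<^sub>0) \<in> UNIV \<times> NN_rate I \<gamma>\<^sub>1 \<and>
            borel_transform (fps_compose H \<phi>) \<in> UNIV \<times> NN_rate I \<gamma>\<^sub>2 \<and>
            (growth_rate I \<gamma> \<longrightarrow>
               shift_identity_on I \<gamma> \<gamma>\<^sub>1 \<psi>\<^sub>0 \<phi>\<^sub>0 \<and>
               subst_identity_on I \<gamma> \<gamma>\<^sub>2 \<rho> H \<phi>)))"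
proof -
  note I = assms(1,2)
  note \<phi>0 = assms(4)
  have more_precise: "(let \<gamma>\<^sub>1 = (\<lambda>\<theta>. \<gamma> \<theta> + norm a + sqrt (\<alpha> \<theta>));
             \<gamma>\<^sub>2 = (\<lambda>\<theta>. \<gamma> \<theta> + inverse \<rho> * \<alpha> \<theta>)
         in borel_transform (shift_compose \<psi>\<^sub>0 \<phi>\<^sub>0) \<in> UNIV \<times> NN_rate I \<gamma>\<^sub>1 \<and>
            borel_transform (fps_compose H \<phi>) \<in> UNIV \<times> NN_rate I \<gamma>\<^sub>2 \<and>
            (growth_rate I \<gamma> \<longrightarrow>
               shift_identity_on I \<gamma> \<gamma>\<^sub>1 \<psi>\<^sub>0 \<phi>\<^sub>0 \<and>
               subst_identity_on I \<gamma> \<gamma>\<^sub>2 \<rho> H \<phi>))"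
    if h: "locally_bounded_on I \<gamma> \<and> locally_bounded_on I \<alpha> \<and> (\<forall>\<theta>\<in>I. \<alpha> \<theta> \<ge> 0) \<and>
        borel_transform \<phi> \<in> {0} \<times> NN_bound I \<gamma> \<alpha> \<and> borel_transform \<psi>\<^sub>0 \<in> UNIV \<times> NN_rate I \<gamma> \<and>
        0 < \<rho> \<and> ereal \<rho> < fps_conv_radius H" for \<gamma> \<alpha> \<rho>
  proof -
    have \<phi>: "snd (borel_transform \<phi>) \<in> NN_bound I \<gamma> \<alpha>" using h by (auto simp: mem_Times_iff)
    have h': "locally_bounded_on I \<gamma>" "locally_bounded_on I \<alpha>" "\<forall>\<theta>\<in>I. 0 \<le> \<alpha> \<theta>"
      "borel_transform \<psi>\<^sub>0 \<in> UNIV \<times> NN_rate I \<gamma>" "0 < \<rho>" "ereal \<rho> < fps_conv_radius H"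
      using h by blast+
    show ?thesis
      using composition_summability(4,6)[where a=a, OF I \<phi>0 h'(1-3) \<phi> h'(4-6)]
        composition_summability(5)[OF I \<phi>0 h'(1-3) \<phi> h'(4-6)]
      unfolding Let_def assms(5) by blast
  qed
  obtain \<gamma>a \<alpha> where a: "locally_bounded_on I \<gamma>a" "locally_bounded_on I \<alpha>" "\<forall>\<theta>\<in>I. 0 \<le> \<alpha> \<theta>"
    "snd (borel_transform \<phi>\<^sub>0) \<in> NN_bound I \<gamma>a \<alpha>"
    using assms(6) unfolding one_summable_def NN_def NN_rate_def mem_Times_iff by blast
  obtain \<gamma>b \<beta> where b: "locally_bounded_on I \<gamma>b" "locally_bounded_on I \<beta>" "\<forall>\<theta>\<in>I. 0 \<le> \<beta> \<theta>"
    "snd (borel_transform \<psi>\<^sub>0) \<in> NN_bound I \<gamma>b \<beta>"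
    using assms(7) unfolding one_summable_def NN_def NN_rate_def mem_Times_iff by blast
  \<comment> \<open>A common rate above both given ones; the summand 1 makes it positive, as
    \<open>growth_rate\<close> demands on long intervals.\<close>
  define \<gamma> where "\<gamma> \<theta> = \<bar>\<gamma>a \<theta>\<bar> + \<bar>\<gamma>b \<theta>\<bar> + 1" for \<theta>
  have lb: "locally_bounded_on I \<gamma>"
    unfolding \<gamma>_def using a(1) b(1)
    by (intro locally_bounded_on_add locally_bounded_on_const)
       (auto intro: locally_bounded_on_dominated)
  then have g: "growth_rate I \<gamma>" by (auto simp: growth_rate_def \<gamma>_def)
  \<comment> \<open>The two series differ only in the constant term, which is the \<delta>
    part.\<close>
  have "snd (borel_transform \<phi>) = snd (borel_transform \<phi>\<^sub>0)"
    by (simp add: borel_transform_def assms(5))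
  then have \<phi>: "snd (borel_transform \<phi>) \<in> NN_bound I \<gamma> \<alpha>"
    using a(3) NN_bound_mono[OF a(4), of \<gamma>] by (force simp: \<gamma>_def)
  have "snd (borel_transform \<psi>\<^sub>0) \<in> NN_bound I \<gamma> \<beta>"
    using b(3) NN_bound_mono[OF b(4), of \<gamma>] by (force simp: \<gamma>_def)
  then have \<psi>: "borel_transform \<psi>\<^sub>0 \<in> UNIV \<times> NN_rate I \<gamma>"
    using b(2,3) unfolding NN_rate_def mem_Times_iff by blast
  obtain \<rho> where \<rho>: "0 < \<rho>" "ereal \<rho> < fps_conv_radius H"
    using ereal_dense2[OF assms(8)] by auto
  note shift = composition_summability(1,3,4,6)[where a=a, OF I \<phi>0 lb a(2,3) \<phi> \<psi> \<rho>, folded assms(5)]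
  note subst = composition_summability(2,5)[OF I \<phi>0 lb a(2,3) \<phi> \<psi> \<rho>]
  have "one_summable I (shift_compose \<psi>\<^sub>0 \<phi>\<^sub>0)" "one_summable I (fps_compose H \<phi>)"
    using shift(1,3) subst unfolding one_summable_def NN_def mem_Times_iff by blast+
  moreover have "\<exists>\<gamma> \<gamma>\<^sub>1 \<gamma>\<^sub>2 \<rho>. growth_rate I \<gamma> \<and> growth_rate I \<gamma>\<^sub>1 \<and> growth_rate I \<gamma>\<^sub>2 \<and>
        borel_transform \<phi>\<^sub>0 \<in> UNIV \<times> NN_rate I \<gamma> \<and> borel_transform \<psi>\<^sub>0 \<in> UNIV \<times> NN_rate I \<gamma> \<and>
        borel_transform (shift_compose \<psi>\<^sub>0 \<phi>\<^sub>0) \<in> UNIV \<times> NN_rate I \<gamma>\<^sub>1 \<and>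
        borel_transform (fps_compose H \<phi>) \<in> UNIV \<times> NN_rate I \<gamma>\<^sub>2 \<and>
        0 < \<rho> \<and> ereal \<rho> < fps_conv_radius H \<and>
        shift_identity_on I \<gamma> \<gamma>\<^sub>1 \<psi>\<^sub>0 \<phi>\<^sub>0 \<and>
        subst_identity_on I \<gamma> \<gamma>\<^sub>2 \<rho> H \<phi>"
    using shift(2,3) shift(4)[OF g] subst(2) \<psi> \<rho> g
    by - (rule exI[of _ \<gamma>], rule exI[of _ "\<lambda>\<theta>. \<gamma> \<theta> + norm a + sqrt (\<alpha> \<theta>)"],
      rule exI[of _ "\<lambda>\<theta>. \<gamma> \<theta> + inverse \<rho> * \<alpha> \<theta>"], rule exI[of _ \<rho>],
      elim conjE, intro conjI; assumption)
  ultimately show ?thesis using more_precise by (intro conjI allI impI)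
qed

end
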